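(* Fix an integer $n>1$ and let $D\subset\mathbb{C}^n$ be a smooth connected non-bifurcated hypersurface. Let $X$ be a simply connected manifold and let $F:X\to\mathbb{C}^n$ be a local diffeomorphism which is a $d$-fold covering map away from $D$. Then $d=1$ or $d=\infty$.
   Context: A hypersurface $D\subset\mathbb{C}^n$ is the zero set of a polynomial; let $f\in\mathbb{C}[z_1,\dots,z_n]$ be the polynomial of minimal degree defining $D$, so $D=f^{-1}(0)$. By a theorem of Verdier there is a finite set $B\subset\mathbb{C}$ such that $f:\mathbb{C}^n-f^{-1}(B)\to\mathbb{C}-B$ is a locally trivial fibration; the smallest such set is denoted $B_f$ and called the bifurcation locus of $f$. The hypersurface $D$ is called non-bifurcated if $0\notin B_f$, i.e. $f$ is a trivial fibration in a neighborhood of $D=f^{-1}(0)$. "$F$ is a $d$-fold covering map away from $D$" means that the restriction $F: X-F^{-1}(D)\to\mathbb{C}^n-D$ is a $d$-sheeted covering map; here $d$ is a positive integer or $\infty$. Manifolds and local diffeomorphisms are smooth, with $\mathbb{C}^n$ viewed as a smooth manifold of real dimension $2n$. Simply connected means path connected with trivial fundamental group. *)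

theory Defs
  imports
    "HOL-Analysis.Analysis"
    "HOL-Library.Poly_Mapping"
    "HOL-Library.Extended_Nat"
begin

section \<open>Polynomials and hypersurfaces\<close>

text \<open>
  A monomial is an exponent vector of type \<open>'n \<Rightarrow>\<^sub>0 nat\<close>; the variables are indexed by
  the finite type \<open>'n\<close>, and \<open>\<complex>\<^sup>n\<close> is \<open>complex ^ 'n\<close>.
\<close>

type_synonym 'n cpoly = "('n \<Rightarrow>\<^sub>0 nat) \<Rightarrow>\<^sub>0 complex"

definition poly_eval :: "'n::finite cpoly \<Rightarrow> complex ^ 'n \<Rightarrow> complex" where
  "poly_eval f z =
     (\<Sum>m\<in>Poly_Mapping.keys f.
        Poly_Mapping.lookup f m * (\<Prod>i\<in>UNIV. (z $ i) ^ Poly_Mapping.lookup m i))"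

definition total_degree :: "'n::finite cpoly \<Rightarrow> nat" where
  "total_degree f =
     Max (insert 0 ((\<lambda>m. \<Sum>i\<in>UNIV. Poly_Mapping.lookup m i) ` Poly_Mapping.keys f))"

definition zero_set :: "'n::finite cpoly \<Rightarrow> (complex ^ 'n) set" where
  "zero_set f = {z. poly_eval f z = 0}"

text \<open>
  The polynomial is required to be nonconstant, so that the empty set and the whole space are
  not hypersurfaces.
\<close>

definition hypersurface :: "(complex ^ 'n::finite) set \<Rightarrow> bool" where
  "hypersurface D \<longleftrightarrow> (\<exists>g. total_degree g > 0 \<and> D = zero_set g)"

definition minimal_polynomial :: "'n::finite cpoly \<Rightarrow> (complex ^ 'n) set \<Rightarrow> bool" where
  "minimal_polynomial f D \<longleftrightarrow>
     zero_set f = D \<and> (\<forall>g. zero_set g = D \<longrightarrow> total_degree f \<le> total_degree g)"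

definition partial_deriv :: "'n::finite \<Rightarrow> 'n cpoly \<Rightarrow> complex ^ 'n \<Rightarrow> complex" where
  "partial_deriv i f z = deriv (\<lambda>t. poly_eval f (z + axis i t)) 0"

text \<open>
  Smoothness in the sense of the Jacobian criterion.  It is meaningful because it refers to a
  defining polynomial of minimal degree, which is reduced and unique up to a scalar factor.
\<close>

definition smooth_hypersurface :: "(complex ^ 'n::finite) set \<Rightarrow> bool" where
  "smooth_hypersurface D \<longleftrightarrow>
     hypersurface D \<and>
     (\<forall>f. minimal_polynomial f D \<longrightarrow> (\<forall>z\<in>D. \<exists>i. partial_deriv i f z \<noteq> 0))"


section \<open>Locally trivial fibrations and the bifurcation locus\<close>

text \<open>
  The model fibre is a subset of the type of the total space; this is no restriction, since a
  fibre over a point of \<open>W\<close> always serves as model fibre.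
\<close>

definition locally_trivial_fibration ::
    "'a::topological_space set \<Rightarrow> ('a \<Rightarrow> 'b::topological_space) \<Rightarrow> 'b set \<Rightarrow> bool" where
  "locally_trivial_fibration E p B \<longleftrightarrow>
     continuous_on E p \<and> p ` E \<subseteq> B \<and>
     (\<forall>b\<in>B. \<exists>W (Fib :: 'a set) h k.
        b \<in> W \<and> openin (top_of_set B) W \<and>
        homeomorphism (E \<inter> p -` W) (W \<times> Fib) h k \<and>
        (\<forall>x \<in> E \<inter> p -` W. fst (h x) = p x))"

definition fibration_away_from :: "'n::finite cpoly \<Rightarrow> complex set \<Rightarrow> bool" where
  "fibration_away_from f B \<longleftrightarrow>
     finite B \<and> locally_trivial_fibration (- (poly_eval f -` B)) (poly_eval f) (- B)"

definition bifurcation_locus :: "'n::finite cpoly \<Rightarrow> complex set" where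
  "bifurcation_locus f = \<Inter> {B. fibration_away_from f B}"

text \<open>
  As soon as one finite set as above exists (Verdier), the intersection is the smallest one.
\<close>

lemma continuous_on_poly_eval: "continuous_on S (poly_eval f)"
  unfolding poly_eval_def by (intro continuous_intros)

lemma bifurcation_locus_smallest:
  assumes "fibration_away_from f B"
  shows "fibration_away_from f (bifurcation_locus f)"
    and "bifurcation_locus f \<subseteq> B"
proof -
  let ?L = "bifurcation_locus f"
  show sub: "?L \<subseteq> B"
    using assms by (auto simp: bifurcation_locus_def)
  have fin: "finite ?L"
    using sub assms finite_subset by (auto simp: fibration_away_from_def)
  have "\<exists>W (Fib :: (complex ^ 'a) set) h k. b \<in> W \<and> openin (top_of_set (- ?L)) W \<and>
          homeomorphism (- (poly_eval f -` ?L) \<inter> poly_eval f -` W) (W \<times> Fib) h k \<and>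
          (\<forall>x \<in> - (poly_eval f -` ?L) \<inter> poly_eval f -` W. fst (h x) = poly_eval f x)"
    if "b \<in> - ?L" for b
  proof -
    from that obtain C where C: "fibration_away_from f C" "b \<notin> C"
      by (auto simp: bifurcation_locus_def)
    have LC: "?L \<subseteq> C"
      using C by (auto simp: bifurcation_locus_def)
    from C obtain W and Fib :: "(complex ^ 'a) set" and h k where
      W: "b \<in> W" "openin (top_of_set (- C)) W"
        "homeomorphism (- (poly_eval f -` C) \<inter> poly_eval f -` W) (W \<times> Fib) h k"
        "\<forall>x \<in> - (poly_eval f -` C) \<inter> poly_eval f -` W. fst (h x) = poly_eval f x"
      unfolding fibration_away_from_def locally_trivial_fibration_def by blast
    have "open (- C)"
      using C by (auto simp: fibration_away_from_def finite_imp_closed open_Compl)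
    then have "open W" "W \<subseteq> - C"
      using W(2) openin_open_eq by blast+
    then have "openin (top_of_set (- ?L)) W"
      using LC by (auto simp: openin_open)
    moreover have "- (poly_eval f -` ?L) \<inter> poly_eval f -` W = - (poly_eval f -` C) \<inter> poly_eval f -` W"
      using \<open>W \<subseteq> - C\<close> LC by auto
    ultimately show ?thesis
      using W by metis
  qed
  then show "fibration_away_from f ?L"
    using fin unfolding fibration_away_from_def locally_trivial_fibration_def
    by (auto simp: continuous_on_poly_eval)
qed

definition non_bifurcated :: "(complex ^ 'n::finite) set \<Rightarrow> bool" where
  "non_bifurcated D \<longleftrightarrow> (\<forall>f. minimal_polynomial f D \<longrightarrow> 0 \<notin> bifurcation_locus f)"


section \<open>Smooth manifolds and local diffeomorphisms\<close>

text \<open>Differentiability is over the reals; the domain \<open>S\<close> is meant to be open.\<close>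

primrec times_differentiable_on ::
    "nat \<Rightarrow> 'a::real_normed_vector set \<Rightarrow> ('a \<Rightarrow> 'b::real_normed_vector) \<Rightarrow> bool" where
  "times_differentiable_on 0 S f \<longleftrightarrow> continuous_on S f"
| "times_differentiable_on (Suc k) S f \<longleftrightarrow>
     (\<forall>x\<in>S. f differentiable (at x)) \<and>
     (\<forall>v. times_differentiable_on k S (\<lambda>x. frechet_derivative f (at x) v))"

definition smooth_on ::
    "'a::euclidean_space set \<Rightarrow> ('a \<Rightarrow> 'b::euclidean_space) \<Rightarrow> bool" where
  "smooth_on S f \<longleftrightarrow> (\<forall>k. times_differentiable_on k S f)"

text \<open>
  A manifold is a set \<open>X\<close> with the subspace topology and an atlas of charts \<open>(U, \<phi>)\<close> into
  a Euclidean space \<open>'e\<close>.  Outside \<open>U\<close> the values of \<open>\<phi>\<close> are irrelevant.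
\<close>

definition is_chart ::
    "'a::topological_space set \<Rightarrow> 'a set \<Rightarrow> ('a \<Rightarrow> 'e::euclidean_space) \<Rightarrow> bool" where
  "is_chart X U \<phi> \<longleftrightarrow>
     openin (top_of_set X) U \<and> open (\<phi> ` U) \<and> (\<exists>\<psi>. homeomorphism U (\<phi> ` U) \<phi> \<psi>)"

definition smooth_atlas ::
    "'a::topological_space set \<Rightarrow> ('a set \<times> ('a \<Rightarrow> 'e::euclidean_space)) set \<Rightarrow> bool" where
  "smooth_atlas X \<A> \<longleftrightarrow>
     (\<forall>(U, \<phi>) \<in> \<A>. is_chart X U \<phi>) \<and>
     (\<Union>(U, \<phi>) \<in> \<A>. U) = X \<and>
     (\<forall>(U, \<phi>) \<in> \<A>. \<forall>(V, \<psi>) \<in> \<A>. smooth_on (\<phi> ` (U \<inter> V)) (\<psi> \<circ> the_inv_into U \<phi>))"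

definition smooth_manifold ::
    "'a::topological_space set \<Rightarrow> ('a set \<times> ('a \<Rightarrow> 'e::euclidean_space)) set \<Rightarrow> bool" where
  "smooth_manifold X \<A> \<longleftrightarrow>
     Hausdorff_space (top_of_set X) \<and> second_countable (top_of_set X) \<and> smooth_atlas X \<A>"

text \<open>
  Every point has an open neighbourhood \<open>U\<close> that \<open>F\<close> maps diffeomorphically, with inverse
  \<open>G\<close>, onto an open set; smoothness of \<open>F\<close> and of \<open>G\<close> is tested in the charts of \<open>X\<close>.
\<close>

definition local_diffeomorphism ::
    "'a::topological_space set \<Rightarrow> ('a set \<times> ('a \<Rightarrow> 'e::euclidean_space)) set \<Rightarrow>
     ('a \<Rightarrow> 'b::euclidean_space) \<Rightarrow> bool" where
  "local_diffeomorphism X \<A> F \<longleftrightarrow>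
     (\<forall>p\<in>X. \<exists>U G.
        p \<in> U \<and> openin (top_of_set X) U \<and> open (F ` U) \<and> homeomorphism U (F ` U) F G \<and>
        (\<forall>(V, \<phi>) \<in> \<A>. smooth_on (\<phi> ` (U \<inter> V)) (F \<circ> the_inv_into V \<phi>) \<and>
                       smooth_on (F ` (U \<inter> V)) (\<phi> \<circ> G)))"


section \<open>Covering maps with a given number of sheets\<close>

definition ecard :: "'a set \<Rightarrow> enat" where
  "ecard A = (if finite A then enat (card A) else \<infinity>)"

definition sheeted_covering ::
    "enat \<Rightarrow> 'a::topological_space set \<Rightarrow> ('a \<Rightarrow> 'b::topological_space) \<Rightarrow> 'b set \<Rightarrow> bool" where
  "sheeted_covering d E p B \<longleftrightarrow>
     covering_space E p B \<and> (\<forall>b\<in>B. ecard (E \<inter> p -` {b}) = d)"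

definition covering_away_from ::
    "enat \<Rightarrow> 'a::topological_space set \<Rightarrow> ('a \<Rightarrow> complex ^ 'n::finite) \<Rightarrow>
     (complex ^ 'n) set \<Rightarrow> bool" where
  "covering_away_from d X F D \<longleftrightarrow> sheeted_covering d (X - F -` D) F (- D)"

end

theory Submission
  imports Defs "HOL-Complex_Analysis.Complex_Analysis"
begin

text \<open>
  Let \<open>f\<close> be the polynomial of minimal degree defining \<open>D\<close>, let \<open>B\<close> be a finite set with
  \<open>0 \<notin> B\<close> such that \<open>f\<close> is a locally trivial fibration away from \<open>B\<close>, and put
  \<open>E = X - F -` D\<close>, so that \<open>F\<close> is a covering of the complement of \<open>D\<close> by the connected
  set \<open>E\<close>.  If \<open>D\<close> is empty, \<open>F\<close> is a connected covering of affine space and so has one sheet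
  (\<open>covering_of_normed_space_injective\<close>).  Let \<open>D\<close> be nonempty.

  The reason for the theorem is that the fundamental group \<open>G\<close> of the complement of \<open>D\<close> is
  infinite cyclic, generated by a meridian of \<open>D\<close>.  Indeed \<open>D\<close> is connected and is itself a general
  fibre, so all general fibres are connected.  Let \<open>N\<close> be the image in \<open>G\<close> of the fundamental
  group of a general fibre.  It is normal, and the meridian commutes with it because \<open>f\<close> is a
  product near \<open>D\<close>.  The quotient \<open>G / N\<close> is generated by loops in the base around \<open>0\<close> and
  around the points \<open>b \<in> B\<close>.  A loop around \<open>b\<close> that survived in \<open>G / N\<close> would produce a
  \<open>k\<close>-th root of \<open>f - b\<close> with \<open>k \<ge> 2\<close>, and then a general fibre would split into the parts on
  which this root takes its different values, contradicting connectedness.  So \<open>G\<close> is generated by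
  \<open>N\<close> and the meridian, the meridian is central, and since affine space is simply connected
  the meridian alone generates \<open>G\<close>.

  If \<open>F\<close> meets \<open>D\<close>, a local inverse of \<open>F\<close> at a point over \<open>D\<close> is a closed lift of a small
  meridian; as \<open>G\<close> is generated by a central element with a fixed point in the fibre, the
  covering has one sheet (\<open>injective_of_local_section\<close>).  If \<open>F\<close> misses \<open>D\<close>, the simply connected
  \<open>X\<close> covers the complement of \<open>D\<close>; lifts of multiples of a meridian never close up, because
  \<open>f \<circ> F\<close> has a logarithm along them, and there are infinitely many sheets
  (\<open>infinite_sheets_of_simply_connected\<close>).

  The group \<open>G\<close> itself does not occur below.  Its role is taken by clopen subsets of \<open>E\<close> and of
  the pulled back coverings \<open>log_cover a V\<close>, on which a logarithm of \<open>f \<circ> F - a\<close> is given.  A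
  clopen subset over a small disc of logarithms spreads over a convex set of logarithms
  (\<open>clopen_family_extends\<close>), also across the points over \<open>B\<close> (\<open>extends_at_singular\<close>).  The
  second statement is where the roots of \<open>f - b\<close> enter (\<open>meridian_connected\<close>, \<open>no_local_roots\<close>).
  That affine space is simply connected is used through \<open>lift_across_thin_set\<close>: a
  covering of the complement of a thin set that has enough sections near the thin set has a
  global section.  These spreading arguments rest on induction along segments, in the form
  \<open>local_sections_extend\<close>.
\<close>

section \<open>Covering maps of topological spaces\<close>

text \<open>
  The form in which connectedness is used throughout: a connected set that meets one of two
  relatively open sets covering it disjointly lies inside that set.
\<close>

lemma connected_subset_of_open_split:
  assumes C: "connected C" "C \<subseteq> E"
    and QR: "openin (top_of_set E) Q" "openin (top_of_set E) R" "C \<subseteq> Q \<union> R" "Q \<inter> R \<inter> C = {}"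
    and ne: "C \<inter> Q \<noteq> {}"
  shows "C \<subseteq> Q"
proof -
  obtain A where A: "open A" "Q = E \<inter> A" using QR(1) unfolding openin_open by blast
  obtain B where B: "open B" "R = E \<inter> B" using QR(2) unfolding openin_open by blast
  have "A \<inter> B \<inter> C = {}" "C \<subseteq> A \<union> B" using A B QR C(2) by blast+
  then have "A \<inter> C = {} \<or> B \<inter> C = {}" using connectedD[OF C(1) A(1) B(1)] by blast
  then show ?thesis using ne A B QR(3) C(2) by blast
qed

lemma connected_component_open_split:
  assumes "locally connected S"
  shows "openin (top_of_set S) (connected_component_set S x)"
    "openin (top_of_set S) (S - connected_component_set S x)"
proof -
  show "openin (top_of_set S) (connected_component_set S x)"
    using openin_connected_component_locally_connected[OF assms] .
  have "S - connected_component_set S x = \<Union>(connected_component_set S ` (S - connected_component_set S x))"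
  proof
    show "S - connected_component_set S x \<subseteq> \<Union>(connected_component_set S ` (S - connected_component_set S x))"
      by (auto intro: connected_component_refl)
    show "\<Union>(connected_component_set S ` (S - connected_component_set S x)) \<subseteq> S - connected_component_set S x"
      by (auto dest: connected_component_in connected_component_sym connected_component_trans)
  qed
  moreover have "openin (top_of_set S) (\<Union>(connected_component_set S ` (S - connected_component_set S x)))"
    using openin_connected_component_locally_connected[OF assms] by (intro openin_Union) auto
  ultimately show "openin (top_of_set S) (S - connected_component_set S x)" by simp
qed

text \<open>
  The range is an arbitrary topological space, where continuity within a set at a point is only
  available as a limit.
\<close>

lemma continuous_on_openin_Union:
  assumes "\<And>x. x \<in> S \<Longrightarrow> \<exists>U. openin (top_of_set S) U \<and> x \<in> U \<and> continuous_on U f"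
  shows "continuous_on S f"
  unfolding continuous_on_def
proof
  fix x assume x: "x \<in> S"
  then obtain U where U: "openin (top_of_set S) U" "x \<in> U" "continuous_on U f" using assms by blast
  then obtain A where A: "open A" "U = S \<inter> A" unfolding openin_open by blast
  have "at x within S = at x within U"
    by (rule at_within_nhd[of x A]) (use A U in auto)
  then show "(f \<longlongrightarrow> f x) (at x within S)"
    using U unfolding continuous_on_def by metis
qed

text \<open>
  A free homotopy between two constant loops contains a path between their values.
\<close>

lemma simply_connected_connected:
  fixes S :: "'a::topological_space set"
  assumes "simply_connected S"
  shows "connected S"
proof (rule connected_iff_connected_component[THEN iffD2], intro ballI)
  fix a b assume ab: "a \<in> S" "b \<in> S"
  have "path (\<lambda>_. x)" "pathfinish (\<lambda>_. x) = pathstart (\<lambda>_. x)" "path_image (\<lambda>_. x) \<subseteq> S" if "x \<in> S" for x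
    using that by (auto simp: path_def path_image_def pathstart_def pathfinish_def)
  then have "homotopic_loops S (\<lambda>_. a) (\<lambda>_. b)"
    using assms[unfolded simply_connected_def, rule_format, of "\<lambda>_. a" "\<lambda>_. b"] ab by metis
  then obtain h where h: "continuous_on ({0..1} \<times> {0..1}) h" "h ` ({0..1} \<times> {0..1}) \<subseteq> S"
    "\<And>x. h (0::real, x::real) = a" "\<And>x. h (1, x) = b"
    by (auto simp: homotopic_loops_def homotopic_with_def prod_topology_subtopology_eu image_subset_iff_funcset)
  let ?C = "h ` ({0..1} \<times> {0..1})"
  have "connected ({0..1::real} \<times> {0..1::real})" by (intro connected_Times) auto
  then have "connected ?C" using h(1) connected_continuous_image by blast
  moreover have "a \<in> ?C" using h(3)[of 0] by (intro image_eqI[of _ _ "(0, 0)"]) auto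
  moreover have "b \<in> ?C" using h(4)[of 0] by (intro image_eqI[of _ _ "(1, 0)"]) auto
  ultimately show "connected_component S a b" using h(2) unfolding connected_component_def by blast
qed

lemma covering_space_sheet:
  assumes "covering_space E p S" "x \<in> S"
  obtains T \<U> where "x \<in> T" "openin (top_of_set S) T" "\<Union>\<U> = E \<inter> p -` T"
    "\<And>u. u \<in> \<U> \<Longrightarrow> openin (top_of_set E) u" "pairwise disjnt \<U>"
    "\<And>u. u \<in> \<U> \<Longrightarrow> \<exists>q. homeomorphism u T p q"
  using assms unfolding covering_space_def by metis

lemma covering_space_image_open:
  fixes p :: "'a::topological_space \<Rightarrow> 'b::topological_space"
  assumes cov: "covering_space E p S" and Q: "openin (top_of_set E) Q"
  shows "openin (top_of_set S) (p ` Q)"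
proof (subst openin_subopen, intro ballI)
  fix y assume "y \<in> p ` Q"
  then obtain e where e: "e \<in> Q" "y = p e" by auto
  have "e \<in> E" using e Q openin_imp_subset by blast
  then obtain u T q where u: "e \<in> u" "openin (top_of_set E) u" "p e \<in> T" "openin (top_of_set S) T"
    "homeomorphism u T p q"
    using covering_space_local_homeomorphism[OF cov] by metis
  have "openin (top_of_set u) (u \<inter> Q)"
    using Q u(2) by (metis inf_commute openin_Int openin_imp_subset openin_subset_trans inf_le2)
  then have "openin (top_of_set T) (p ` (u \<inter> Q))"
    using homeomorphism_imp_open_map[OF u(5)] by blast
  then have "openin (top_of_set S) (p ` (u \<inter> Q))"
    using u(4) openin_trans by blast
  then show "\<exists>T. openin (top_of_set S) T \<and> y \<in> T \<and> T \<subseteq> p ` Q"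
    using e u(1) by (intro exI[of _ "p ` (u \<inter> Q)"]) auto
qed

text \<open>
  Two lifts agree on an open set because sheets are mapped injectively, and differ on an open set
  because sheets over the same set are disjoint; the second point replaces a separation axiom.
\<close>

lemma covering_space_lifts_agree:
  fixes p :: "'a::topological_space \<Rightarrow> 'b::topological_space"
    and g1 g2 :: "'c::topological_space \<Rightarrow> 'a"
  assumes cov: "covering_space E p S" and T: "connected T"
    and g1: "continuous_on T g1" "g1 \<in> T \<rightarrow> E" and g2: "continuous_on T g2" "g2 \<in> T \<rightarrow> E"
    and eq: "\<And>x. x \<in> T \<Longrightarrow> p (g1 x) = p (g2 x)"
    and a: "a \<in> T" "g1 a = g2 a" and x: "x \<in> T"
  shows "g1 x = g2 x"
proof -
  have key: "\<exists>N. openin (top_of_set T) N \<and> x \<in> N \<and>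
     ((\<forall>z\<in>N. g1 z = g2 z) \<or> (\<forall>z\<in>N. g1 z \<noteq> g2 z))" if x: "x \<in> T" for x
  proof -
    have "p (g1 x) \<in> S" using cov g1(2) x covering_space_imp_surjective by blast
    then obtain O1 \<U> where O1: "p (g1 x) \<in> O1" "\<Union>\<U> = E \<inter> p -` O1"
      and \<U>: "\<And>u. u \<in> \<U> \<Longrightarrow> openin (top_of_set E) u" "pairwise disjnt \<U>"
        "\<And>u. u \<in> \<U> \<Longrightarrow> \<exists>q. homeomorphism u O1 p q"
      using covering_space_sheet[OF cov] by metis
    have "g1 x \<in> \<Union>\<U>" using O1 g1 x by auto
    moreover have "g2 x \<in> \<Union>\<U>" using O1 g2 eq[OF x] x by auto
    ultimately obtain u1 u2 where u: "u1 \<in> \<U>" "u2 \<in> \<U>" "g1 x \<in> u1" "g2 x \<in> u2" by auto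
    let ?N = "(T \<inter> g1 -` u1) \<inter> (T \<inter> g2 -` u2)"
    have N: "openin (top_of_set T) ?N"
      using continuous_openin_preimage[OF g1] continuous_openin_preimage[OF g2] \<U>(1) u by blast
    have xN: "x \<in> ?N" using u x by auto
    show ?thesis
    proof (cases "u1 = u2")
      case True
      obtain q where "homeomorphism u1 O1 p q" using \<U>(3) u by blast
      then have "inj_on p u1" by (metis homeomorphism_apply1 inj_on_inverseI)
      then have "\<forall>z\<in>?N. g1 z = g2 z" using True eq by (auto dest: inj_onD)
      then show ?thesis using N xN by blast
    next
      case False
      then have "u1 \<inter> u2 = {}" using \<U>(2) u by (metis pairwiseD disjnt_def)
      then have "\<forall>z\<in>?N. g1 z \<noteq> g2 z" by auto
      then show ?thesis using N xN by blast
    qed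
  qed
  show ?thesis
  proof (rule connected_induction_simple[OF T a(1) x, of "\<lambda>x. g1 x = g2 x"])
    fix z assume "z \<in> T"
    from key[OF this] obtain N where "openin (top_of_set T) N" "z \<in> N"
      "(\<forall>z\<in>N. g1 z = g2 z) \<or> (\<forall>z\<in>N. g1 z \<noteq> g2 z)" by blast
    then show "\<exists>N. openin (top_of_set T) N \<and> z \<in> N \<and> (\<forall>x\<in>N. \<forall>y\<in>N. g1 x = g2 x \<longrightarrow> g1 y = g2 y)"
      by (intro exI[of _ N]) blast
  qed (rule a(2))
qed

text \<open>
  Over a connected evenly covered set, a clopen subset contains each sheet entirely or not at all.
\<close>

lemma covering_space_clopen_image:
  fixes p :: "'a::topological_space \<Rightarrow> 'b::topological_space"
  assumes cov: "covering_space E p S" and S: "locally connected S"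
    and Q: "openin (top_of_set E) Q" "openin (top_of_set E) (E - Q)"
  shows "openin (top_of_set S) (S - p ` Q)"
proof (subst openin_subopen, intro ballI)
  fix y assume y: "y \<in> S - p ` Q"
  then obtain T \<U> where T: "y \<in> T" "openin (top_of_set S) T" "\<Union>\<U> = E \<inter> p -` T"
    and \<U>: "\<And>u. u \<in> \<U> \<Longrightarrow> openin (top_of_set E) u"
      "\<And>u. u \<in> \<U> \<Longrightarrow> \<exists>q. homeomorphism u T p q"
    using covering_space_sheet[OF cov] by (metis DiffD1)
  obtain T' where T': "openin (top_of_set S) T'" "connected T'" "y \<in> T'" "T' \<subseteq> T"
    using S T unfolding locally_connected by metis
  have "T' \<inter> p ` Q = {}"
  proof (rule ccontr)
    assume "T' \<inter> p ` Q \<noteq> {}"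
    then obtain e where e: "e \<in> Q" "p e \<in> T'" by auto
    have "e \<in> E" using e(1) openin_imp_subset[OF Q(1)] by blast
    then have "e \<in> \<Union>\<U>" using T(3) T'(4) e(2) by blast
    then obtain u where u: "u \<in> \<U>" "e \<in> u" by auto
    then obtain q where q: "homeomorphism u T p q" using \<U> by blast
    let ?C = "q ` T'"
    have C: "connected ?C" 
      using T' q by (meson connected_continuous_image continuous_on_subset homeomorphism_cont2)
    have "?C \<subseteq> u" using T'(4) homeomorphism_image2[OF q] by blast
    moreover have "u \<subseteq> E" using \<U>(1)[OF u(1)] openin_imp_subset by blast
    ultimately have CE: "?C \<subseteq> E" by blast
    have "q (p e) = e" using homeomorphism_apply1[OF q u(2)] .
    then have "e \<in> ?C" using e(2) by (metis imageI)
    then have "?C \<subseteq> Q"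
      using connected_subset_of_open_split[OF C CE Q] CE e(1) by blast
    then have "q y \<in> Q" using T'(3) by blast
    moreover have "p (q y) = y" using homeomorphism_apply2[OF q T(1)] .
    ultimately have "y \<in> p ` Q" by (metis imageI)
    then show False using y by simp
  qed
  then show "\<exists>T. openin (top_of_set S) T \<and> y \<in> T \<and> T \<subseteq> S - p ` Q"
    using T'(1,3) openin_imp_subset[OF T'(1)] by (intro exI[of _ T']) auto
qed

lemma covering_space_total_locally_connected:
  fixes p :: "'a::topological_space \<Rightarrow> 'b::topological_space"
  assumes cov: "covering_space E p S" and S: "locally connected S"
  shows "locally connected E"
  unfolding locally_connected
proof (intro allI impI)
  fix v x assume v: "openin (top_of_set E) v \<and> x \<in> v"
  then have "x \<in> E" using openin_imp_subset by blast
  then obtain u T q where u: "x \<in> u" "openin (top_of_set E) u" "p x \<in> T" "openin (top_of_set S) T"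
    "homeomorphism u T p q"
    using covering_space_local_homeomorphism[OF cov] by metis
  have uv: "openin (top_of_set E) (u \<inter> v)" using u v by blast
  have "openin (top_of_set S) (p ` (u \<inter> v))" by (rule covering_space_image_open[OF cov uv])
  then obtain C where C: "openin (top_of_set S) C" "connected C" "p x \<in> C" "C \<subseteq> p ` (u \<inter> v)"
    using S u v unfolding locally_connected by (metis IntI imageI)
  have CT: "C \<subseteq> T" using C(4) u(5) homeomorphism_image1 by blast
  have "openin (top_of_set T) C" using C(1) CT u(4) by (meson openin_imp_subset openin_subset_trans)
  then have "openin (top_of_set u) (q ` C)"
    using homeomorphism_imp_open_map[OF u(5)[THEN homeomorphism_sym[THEN iffD1]]] by blast
  then have "openin (top_of_set E) (q ` C)" using u(2) openin_trans by blast
  moreover have "connected (q ` C)"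
    by (meson C(2) CT connected_continuous_image continuous_on_subset homeomorphism_cont2 u(5))
  moreover have "x \<in> q ` C" using C(3) u by (metis homeomorphism_apply1 imageI)
  moreover have "q ` C \<subseteq> v"
  proof
    fix z assume "z \<in> q ` C"
    then obtain w where w: "w \<in> u \<inter> v" "z = q (p w)" using C(4) by blast
    then show "z \<in> v" using u(5) by (simp add: homeomorphism_apply1)
  qed
  ultimately show "\<exists>u. openin (top_of_set E) u \<and> connected u \<and> x \<in> u \<and> u \<subseteq> v" by blast
qed

text \<open>
  The sheets of the pullback over the preimage of an evenly covered set are graphs of sections
  composed with \<open>g\<close>.
\<close>

lemma covering_space_pullback:
  fixes p :: "'a::topological_space \<Rightarrow> 'b::topological_space" and g :: "'c::topological_space \<Rightarrow> 'b"
  assumes cov: "covering_space C p S" and g: "continuous_on Z g" "g \<in> Z \<rightarrow> S"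
  shows "covering_space {(c, z). c \<in> C \<and> z \<in> Z \<and> p c = g z} snd Z" (is "covering_space ?P _ _")
proof
  show "continuous_on ?P snd" by (intro continuous_intros)
  show "snd ` ?P = Z"
  proof
    show "Z \<subseteq> snd ` ?P"
    proof
      fix z assume z: "z \<in> Z"
      then have "g z \<in> p ` C"
        using g(2) covering_space_imp_surjective[OF cov] by (simp add: Pi_iff)
      then obtain c where "c \<in> C" "p c = g z" by (metis imageE)
      then show "z \<in> snd ` ?P" using z by (intro image_eqI[of _ _ "(c, z)"]) auto
    qed
  qed auto
  fix z assume z: "z \<in> Z"
  then obtain T \<U> where T: "g z \<in> T" "openin (top_of_set S) T" "\<Union>\<U> = C \<inter> p -` T"
    and \<U>: "\<And>u. u \<in> \<U> \<Longrightarrow> openin (top_of_set C) u" "pairwise disjnt \<U>"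
      "\<And>u. u \<in> \<U> \<Longrightarrow> \<exists>q. homeomorphism u T p q"
    using covering_space_sheet[OF cov, of "g z"] g(2) by blast
  let ?T = "Z \<inter> g -` T"
  let ?v = "\<lambda>u. ?P \<inter> fst -` u"
  have cP: "continuous_on ?P fst" by (intro continuous_intros)
  show "\<exists>T. z \<in> T \<and> openin (top_of_set Z) T \<and> (\<exists>v. \<Union>v = ?P \<inter> snd -` T \<and>
      (\<forall>u\<in>v. openin (top_of_set ?P) u) \<and> pairwise disjnt v \<and> (\<forall>u\<in>v. \<exists>q. homeomorphism u T snd q))"
  proof (intro exI[of _ ?T] conjI exI[of _ "?v ` \<U>"] ballI)
    show "z \<in> ?T" using z T by auto
    show "openin (top_of_set Z) ?T" using continuous_openin_preimage[OF g T(2)] .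
    have "\<Union> (?v ` \<U>) = ?P \<inter> fst -` (\<Union>\<U>)" by blast
    also have "\<dots> = ?P \<inter> snd -` ?T" unfolding T(3) by auto
    finally show "\<Union> (?v ` \<U>) = ?P \<inter> snd -` ?T" .
    show "pairwise disjnt (?v ` \<U>)"
      using \<U>(2) unfolding pairwise_def disjnt_def by blast
  next
    fix w assume "w \<in> ?v ` \<U>"
    then obtain u where u: "u \<in> \<U>" "w = ?v u" by auto
    show "openin (top_of_set ?P) w" unfolding u(2)
      by (rule continuous_openin_preimage[OF cP _ \<U>(1)[OF u(1)]]) auto
    obtain q where q: "homeomorphism u T p q" using \<U>(3)[OF u(1)] by blast
    have uC: "u \<subseteq> C" using \<U>(1)[OF u(1)] openin_imp_subset by blast
    show "\<exists>q. homeomorphism w ?T snd q"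
    proof (intro exI[of _ "\<lambda>z. (q (g z), z)"] homeomorphismI)
      show "continuous_on w snd" by (intro continuous_intros)
      show "continuous_on ?T (\<lambda>z. (q (g z), z))"
        by (intro continuous_intros continuous_on_compose2[OF homeomorphism_cont2[OF q]]
             continuous_on_subset[OF g(1)]) auto
      have "p ` u \<subseteq> T" using homeomorphism_image1[OF q] by blast
      then show "snd ` w \<subseteq> ?T" unfolding u(2) by (fastforce simp flip: image_subset_iff)
      show "(\<lambda>z. (q (g z), z)) ` ?T \<subseteq> w"
        using u uC homeomorphism_image2[OF q] homeomorphism_apply2[OF q] by auto
      show "(q (g (snd x)), snd x) = x" if "x \<in> w" for x
        using that u homeomorphism_apply1[OF q] by fastforce
    qed auto
  qed
qed

lemma covering_space_restrict:
  assumes cov: "covering_space E p S" and S': "S' \<subseteq> S"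
  shows "covering_space (E \<inter> p -` S') p S'"
proof
  have cp: "continuous_on E p" using cov covering_space_imp_continuous by blast
  then show "continuous_on (E \<inter> p -` S') p" by (rule continuous_on_subset) auto
  show "p ` (E \<inter> p -` S') = S'" using covering_space_imp_surjective[OF cov] S' by blast
  fix x assume x: "x \<in> S'"
  then obtain T \<U> where T: "x \<in> T" "openin (top_of_set S) T" "\<Union>\<U> = E \<inter> p -` T"
    and \<U>: "\<And>u. u \<in> \<U> \<Longrightarrow> openin (top_of_set E) u" "pairwise disjnt \<U>"
      "\<And>u. u \<in> \<U> \<Longrightarrow> \<exists>q. homeomorphism u T p q"
    using covering_space_sheet[OF cov, of x] S' by blast
  let ?v = "\<lambda>u. u \<inter> p -` S'"
  show "\<exists>T. x \<in> T \<and> openin (top_of_set S') T \<and> (\<exists>v. \<Union>v = (E \<inter> p -` S') \<inter> p -` T \<and>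
      (\<forall>u\<in>v. openin (top_of_set (E \<inter> p -` S')) u) \<and> pairwise disjnt v \<and> (\<forall>u\<in>v. \<exists>q. homeomorphism u T p q))"
  proof (intro exI[of _ "T \<inter> S'"] conjI exI[of _ "?v ` \<U>"] ballI)
    show "x \<in> T \<inter> S'" using x T by blast
    obtain A where "open A" "T = S \<inter> A" using T(2) unfolding openin_open by blast
    then have "T \<inter> S' = S' \<inter> A" using S' by blast
    then show "openin (top_of_set S') (T \<inter> S')" using \<open>open A\<close> by (simp add: openin_open_Int)
    have "\<Union> (?v ` \<U>) = (\<Union>\<U>) \<inter> p -` S'" by blast
    then show "\<Union> (?v ` \<U>) = E \<inter> p -` S' \<inter> p -` (T \<inter> S')" unfolding T(3) by blast
    show "pairwise disjnt (?v ` \<U>)" using \<U>(2) unfolding pairwise_def disjnt_def by blast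
    fix w assume "w \<in> ?v ` \<U>"
    then obtain u where u: "u \<in> \<U>" "w = ?v u" by blast
    have uE: "u \<subseteq> E" using openin_imp_subset[OF \<U>(1)[OF u(1)]] .
    obtain A where "open A" "u = E \<inter> A" using \<U>(1)[OF u(1)] unfolding openin_open by blast
    then have "w = (E \<inter> p -` S') \<inter> A" using u(2) by blast
    then show "openin (top_of_set (E \<inter> p -` S')) w" using \<open>open A\<close> by (simp add: openin_open_Int)
    obtain q where q: "homeomorphism u T p q" using \<U>(3)[OF u(1)] by blast
    have "p ` w = T \<inter> S'" using homeomorphism_image1[OF q] u(2) by blast
    then have "homeomorphism w (T \<inter> S') p q"
      using homeomorphism_of_subsets[OF q, of w "T \<inter> S'"] u(2) by blast
    then show "\<exists>q. homeomorphism w (T \<inter> S') p q" by blast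
  qed
qed

section \<open>Extending local sections over convex sets\<close>

text \<open>
  Induction along a segment.  By compactness, balls of one fixed radius around points of the
  segment are good.  The convex sets \<open>C\<close> are tubes around growing initial pieces of the segment;
  each piece is so short that the next tube is covered by the previous one and a single good ball,
  so only two convex sets have to be compared at a time.
\<close>

lemma convex_neighbourhood_induct:
  fixes y0 y :: "'b::real_normed_vector"
  assumes good: "\<And>q. q \<in> closed_segment y0 y \<Longrightarrow> \<exists>\<rho>>0. G (ball q \<rho>)"
    and init: "\<epsilon> > 0" "R (ball y0 \<epsilon>)"
    and mono: "\<And>C C'. \<lbrakk>R C; convex C'; open C'; y0 \<in> C'; C' \<subseteq> C\<rbrakk> \<Longrightarrow> R C'"
    and step: "\<And>C B C'. \<lbrakk>R C; convex C; open C; y0 \<in> C; G B; convex B; open B; C \<inter> B \<noteq> {};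
                 convex C'; open C'; y0 \<in> C'; C' \<subseteq> C \<union> B\<rbrakk> \<Longrightarrow> R C'"
  shows "\<exists>C. convex C \<and> open C \<and> closed_segment y0 y \<subseteq> C \<and> R C"
proof -
  let ?\<G> = "{ball q \<rho> |q \<rho>. \<rho> > 0 \<and> G (ball q \<rho>)}"
  have "closed_segment y0 y \<subseteq> \<Union>?\<G>"
  proof
    fix q assume "q \<in> closed_segment y0 y"
    then obtain \<rho> where "\<rho> > 0" "G (ball q \<rho>)" using good by blast
    then show "q \<in> \<Union>?\<G>" by (intro UnionI[of "ball q \<rho>"]) auto
  qed
  then obtain e where e: "e > 0" "\<And>x. x \<in> closed_segment y0 y \<Longrightarrow> \<exists>B\<in>?\<G>. ball x e \<subseteq> B"
    using Heine_Borel_lemma[OF compact_segment, of y0 y ?\<G>] by blast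
  define \<rho> where "\<rho> = min (e/2) \<epsilon>"
  have \<rho>: "\<rho> > 0" "2 * \<rho> \<le> e" "\<rho> \<le> \<epsilon>" using e init by (auto simp: \<rho>_def)
  define \<gamma> where "\<gamma> = (\<lambda>t::real. y0 + t *\<^sub>R (y - y0))"
  \<comment> \<open>The tube of radius \<open>\<rho>\<close> around the initial piece up to the parameter \<open>t\<close>, written as a sum of convex sets.\<close>
  define N where "N t = (\<Union>x\<in>\<gamma> ` {0..t}. \<Union>b\<in>ball 0 \<rho>. {x + b})" for t
  have cg: "convex (\<gamma> ` {0..t})" for t
  proof -
    have "\<gamma> ` {0..t} = (+) y0 ` ((\<lambda>s. s *\<^sub>R (y - y0)) ` {0..t})" by (auto simp: \<gamma>_def)
    moreover have "linear (\<lambda>s. s *\<^sub>R (y - y0))" by (simp add: linear_scaleR_left)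
    ultimately show ?thesis 
      by (metis convex_linear_image convex_real_interval(5) convex_translation)
  qed
  have N: "convex (N t)" "open (N t)" for t
    unfolding N_def using cg by (intro convex_sums open_sums; simp)+
  have mem: "z \<in> N t \<longleftrightarrow> (\<exists>s. 0 \<le> s \<and> s \<le> t \<and> norm (z - \<gamma> s) < \<rho>)" for z t
  proof
    assume "z \<in> N t"
    then show "\<exists>s. 0 \<le> s \<and> s \<le> t \<and> norm (z - \<gamma> s) < \<rho>"
      unfolding N_def by force
  next
    assume "\<exists>s. 0 \<le> s \<and> s \<le> t \<and> norm (z - \<gamma> s) < \<rho>"
    then obtain s where s: "0 \<le> s" "s \<le> t" "norm (z - \<gamma> s) < \<rho>" by blast
    then show "z \<in> N t"
      unfolding N_def by (intro UN_I[of "\<gamma> s"] UN_I[of "z - \<gamma> s"]) auto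
  qed
  have y0N: "y0 \<in> N t" if "t \<ge> 0" for t
    unfolding mem using that \<rho>(1) by (intro exI[of _ 0]) (simp add: \<gamma>_def)
  obtain n :: nat where n: "n > 0" "norm (y - y0) / n < \<rho>"
  proof -
    obtain m :: nat where "norm (y - y0) / \<rho> < m" using reals_Archimedean2 by blast
    then have "norm (y - y0) < \<rho> * Suc m" using \<rho>(1) by (simp add: field_simps)
    then have "norm (y - y0) / real (Suc m) < \<rho>" by (simp add: field_simps del: of_nat_Suc)
    then show ?thesis using that[of "Suc m"] by blast
  qed
  have "R (N (j / n))" if "j \<le> n" for j
    using that
  proof (induction j)
    case 0
    have "z \<in> N 0 \<longleftrightarrow> z \<in> ball y0 \<rho>" for z
    proof -
      have "z \<in> N 0 \<longleftrightarrow> (\<exists>s. s = 0 \<and> norm (z - \<gamma> s) < \<rho>)" unfolding mem by force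
      then show ?thesis by (simp add: \<gamma>_def dist_norm norm_minus_commute)
    qed
    then have "N 0 = ball y0 \<rho>" by blast
    then show ?case using mono[OF init(2)] N[of 0] y0N[of 0] \<rho>(3) by fastforce
  next
    case (Suc j)
    let ?t = "real j / n" and ?t' = "real (Suc j) / n"
    have t01: "0 \<le> ?t" "?t \<le> 1" using Suc.prems by auto
    have gt: "\<gamma> ?t \<in> closed_segment y0 y"
      unfolding closed_segment_def using t01
      by (intro CollectI exI[of _ ?t]) (auto simp: \<gamma>_def algebra_simps)
    then obtain B where B: "B \<in> ?\<G>" "ball (\<gamma> ?t) e \<subseteq> B" using e(2) by blast
    have "\<gamma> ?t \<in> N ?t" unfolding mem using t01 \<rho>(1) by (intro exI[of _ ?t]) auto
    moreover have "\<gamma> ?t \<in> B" using B e(1) by auto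
    ultimately have ne: "N ?t \<inter> B \<noteq> {}" by blast
    have sub: "N ?t' \<subseteq> N ?t \<union> B"
    proof
      fix z assume "z \<in> N ?t'"
      then obtain s where s: "0 \<le> s" "s \<le> ?t'" "norm (z - \<gamma> s) < \<rho>" unfolding mem by blast
      show "z \<in> N ?t \<union> B"
      proof (cases "s \<le> ?t")
        case True
        then show ?thesis using s unfolding Un_iff mem by blast
      next
        case False
        have "\<gamma> s - \<gamma> ?t = (s - ?t) *\<^sub>R (y - y0)" by (simp add: \<gamma>_def algebra_simps)
        then have "norm (\<gamma> s - \<gamma> ?t) = (s - ?t) * norm (y - y0)" using False by simp
        also have "\<dots> \<le> (1 / n) * norm (y - y0)"
          using s(2) by (intro mult_right_mono) (auto simp: add_divide_distrib)
        also have "\<dots> < \<rho>" using n(2) by simp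
        finally have "norm (z - \<gamma> ?t) < e"
          using s(3) \<rho>(2) norm_triangle_ineq[of "z - \<gamma> s" "\<gamma> s - \<gamma> ?t"] by simp
        then show ?thesis using B(2) by (auto simp: dist_norm norm_minus_commute)
      qed
    qed
    have "R (N ?t)" using Suc by simp
    moreover have "G B" "convex B" "open B" using B(1) by auto
    ultimately show ?case
      using step[of "N ?t" B "N ?t'"] N y0N ne sub t01 by (simp del: of_nat_Suc)
  qed
  from this[of n] have "R (N 1)" using n by simp
  moreover have "closed_segment y0 y \<subseteq> N 1"
  proof
    fix z assume "z \<in> closed_segment y0 y"
    then obtain u where "0 \<le> u" "u \<le> 1" "z = (1 - u) *\<^sub>R y0 + u *\<^sub>R y"
      unfolding closed_segment_def by blast
    then show "z \<in> N 1" unfolding mem using \<rho>(1)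
      by (intro exI[of _ u]) (auto simp: \<gamma>_def algebra_simps)
  qed
  ultimately show ?thesis using N by blast
qed

text \<open>
  A sheaf on a convex set whose sections continue locally and uniquely has global sections.  For each point \<open>y\<close>, induction along the segment from \<open>y0\<close> to \<open>y\<close> gives a section
  near this segment.  Two such neighbourhoods meet in a convex set around \<open>y0\<close>, so the sections
  agree there by \<open>ident\<close>, and they glue.  In \<open>ext\<close> agreement on some nonempty open subset suffices,
  since \<open>ident\<close> upgrades it.
\<close>

lemma local_sections_extend:
  fixes V :: "'b::real_normed_vector set" and Sec :: "'b set \<Rightarrow> ('b \<Rightarrow> 'v) \<Rightarrow> bool"
  assumes V: "open V" "convex V" 
    and init: "\<epsilon> > 0" "ball y0 \<epsilon> \<subseteq> V" "Sec (ball y0 \<epsilon>) s0"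
    and mono: "\<And>U U' s. \<lbrakk>Sec U s; open U; U \<subseteq> V; open U'; U' \<subseteq> U\<rbrakk> \<Longrightarrow> Sec U' s"
    and cong: "\<And>U s s'. \<lbrakk>Sec U s; \<And>y. y \<in> U \<Longrightarrow> s y = s' y\<rbrakk> \<Longrightarrow> Sec U s'"
    and glue: "\<And>\<U> s. (\<And>U. U \<in> \<U> \<Longrightarrow> open U \<and> U \<subseteq> V \<and> Sec U s) \<Longrightarrow> Sec (\<Union>\<U>) s"
    and ident: "\<And>U U' s s' y. \<lbrakk>convex U; open U; U \<subseteq> V; open U'; U' \<noteq> {}; U' \<subseteq> U; Sec U s; Sec U s';
                  \<forall>y\<in>U'. s y = s' y; y \<in> U\<rbrakk> \<Longrightarrow> s y = s' y"
    and ext: "\<And>q. q \<in> V \<Longrightarrow> \<exists>\<rho>>0. ball q \<rho> \<subseteq> V \<and>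
                (\<forall>U s. convex U \<longrightarrow> open U \<longrightarrow> U \<noteq> {} \<longrightarrow> U \<subseteq> ball q \<rho> \<longrightarrow> Sec U s \<longrightarrow>
                  (\<exists>s' U'. Sec (ball q \<rho>) s' \<and> open U' \<and> U' \<noteq> {} \<and> U' \<subseteq> U \<and> (\<forall>y\<in>U'. s y = s' y)))"
  shows "\<exists>s. Sec V s \<and> (\<forall>y\<in>ball y0 \<epsilon>. s y = s0 y)"
proof -
  define G where "G B \<longleftrightarrow> B \<subseteq> V \<and> 
    (\<forall>U s. convex U \<longrightarrow> open U \<longrightarrow> U \<noteq> {} \<longrightarrow> U \<subseteq> B \<longrightarrow> Sec U s \<longrightarrow>
       (\<exists>s' U'. Sec B s' \<and> open U' \<and> U' \<noteq> {} \<and> U' \<subseteq> U \<and> (\<forall>y\<in>U'. s y = s' y)))" for B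
  define P where "P C s \<longleftrightarrow> Sec C s \<and> (\<exists>\<delta>>0. \<forall>y\<in>ball y0 \<delta>. s y = s0 y)" for C s
  define R where "R C \<longleftrightarrow> open C \<and> C \<subseteq> V \<and> (\<exists>s. P C s)" for C
  have y0V: "y0 \<in> V" using init by auto
  have "\<exists>C. convex C \<and> open C \<and> closed_segment y0 y \<subseteq> C \<and> R C" if y: "y \<in> V" for y
  proof (rule convex_neighbourhood_induct[where G=G])
    show "\<exists>\<rho>>0. G (ball q \<rho>)" if "q \<in> closed_segment y0 y" for q
    proof -
      have "q \<in> V" using that y y0V V(2) closed_segment_subset by blast
      then show ?thesis unfolding G_def using ext by blast
    qed
    show "\<epsilon> > 0" by fact
    show "R (ball y0 \<epsilon>)" unfolding R_def P_def using init open_ball by blast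
    show "R C'" if "R C" "convex C'" "open C'" "y0 \<in> C'" "C' \<subseteq> C" for C C'
    proof -
      from \<open>R C\<close> obtain s where s: "open C" "C \<subseteq> V" "P C s" unfolding R_def by blast
      have "P C' s" using s mono[of C s C'] that unfolding P_def R_def by blast
      then show ?thesis unfolding R_def using s(2) that(3,5) by blast
    qed
  next
    fix C B C'
    assume C: "R C" "convex C" "open C" "y0 \<in> C" and B: "G B" "convex B" "open B"
      and ne: "C \<inter> B \<noteq> {}" and C': "convex C'" "open C'" "y0 \<in> C'" "C' \<subseteq> C \<union> B"
    obtain s \<delta> where s: "C \<subseteq> V" "Sec C s" "\<delta> > 0" "\<forall>y\<in>ball y0 \<delta>. s y = s0 y"
      using C(1) unfolding R_def P_def by blast
    have BV: "B \<subseteq> V" using B(1) unfolding G_def by blast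
    have CB: "convex (C \<inter> B)" "open (C \<inter> B)" "C \<inter> B \<subseteq> B" using C B by (auto simp: convex_Int)
    have sCB: "Sec (C \<inter> B) s" using mono[OF s(2) C(3) s(1) CB(2)] by blast
    obtain s' U' where s': "Sec B s'" "open U'" "U' \<noteq> {}" "U' \<subseteq> C \<inter> B" "\<forall>y\<in>U'. s y = s' y"
      using B(1) CB ne sCB unfolding G_def by blast
    have sCB': "Sec (C \<inter> B) s'" using mono[OF s'(1) B(3) BV CB(2)] by blast
    have agree: "s y = s' y" if "y \<in> C \<inter> B" for y
      using ident[OF CB(1,2) _ s'(2-4) sCB sCB' s'(5) that] s(1) by blast
    define r where "r y = (if y \<in> C then s y else s' y)" for y
    have "Sec C r" by (rule cong[OF s(2)]) (simp add: r_def)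
    moreover have "Sec B r" by (rule cong[OF s'(1)]) (use agree in \<open>auto simp: r_def\<close>)
    ultimately have "Sec (\<Union>{C, B}) r" using C(3) B(3) s(1) BV by (intro glue) auto
    then have "Sec C' r" by (rule mono) (use C' C(3) B(3) s(1) BV in auto)
    moreover obtain \<delta>' where \<delta>': "\<delta>' > 0" "ball y0 \<delta>' \<subseteq> C" using C(3,4) open_contains_ball by blast
    have "\<forall>y\<in>ball y0 (min \<delta> \<delta>'). r y = s0 y"
    proof
      fix y assume "y \<in> ball y0 (min \<delta> \<delta>')"
      then have "y \<in> ball y0 \<delta>" "y \<in> C" using \<delta>'(2) by auto
      then show "r y = s0 y" using s(4) by (simp add: r_def)
    qed
    then have "\<exists>\<delta>>0. \<forall>y\<in>ball y0 \<delta>. r y = s0 y"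
      using s(3) \<delta>'(1) by (intro exI[of _ "min \<delta> \<delta>'"]) auto
    ultimately show "R C'" unfolding R_def P_def using C'(2,4) s(1) BV by blast
  qed
  then have "\<forall>y\<in>V. \<exists>C s. convex C \<and> open C \<and> closed_segment y0 y \<subseteq> C \<and> C \<subseteq> V \<and> P C s"
    unfolding R_def by blast
  then obtain C s where C: "\<And>y. y \<in> V \<Longrightarrow> convex (C y) \<and> open (C y) \<and> closed_segment y0 y \<subseteq> C y \<and> C y \<subseteq> V \<and> P (C y) (s y)"
    by metis
  have mem: "y \<in> C y" "y0 \<in> C y" if "y \<in> V" for y using C[OF that] by auto
  define r where "r y = s y y" for y
  have agree: "r z = s y z" if "y \<in> V" "z \<in> C y" for y z
  proof -
    have z: "z \<in> V" using that C by blast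
    let ?U = "C y \<inter> C z"
    obtain \<delta>1 where 1: "\<delta>1 > 0" "\<forall>w\<in>ball y0 \<delta>1. s y w = s0 w" using C[OF \<open>y \<in> V\<close>] P_def by blast
    obtain \<delta>2 where 2: "\<delta>2 > 0" "\<forall>w\<in>ball y0 \<delta>2. s z w = s0 w" using C[OF z] P_def by blast
    let ?U' = "ball y0 \<delta>1 \<inter> ball y0 \<delta>2 \<inter> ?U"
    have U: "convex ?U" "open ?U" "?U \<subseteq> V" using C that z by (auto simp: convex_Int)
    have "Sec ?U (s y)" using C[OF that(1)] U unfolding P_def by (intro mono[of "C y" "s y" ?U]) auto
    moreover have "Sec ?U (s z)" using C[OF z] U unfolding P_def by (intro mono[of "C z" "s z" ?U]) auto
    moreover have "open ?U'" "?U' \<subseteq> ?U" using U by auto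
    moreover have "y0 \<in> ?U'" using mem that z 1 2 by auto
    moreover have "\<forall>w\<in>?U'. s y w = s z w" using 1 2 by auto
    moreover have "z \<in> ?U" using that mem z by auto
    ultimately have "s y z = s z z" using ident[OF U, of ?U'] by blast
    then show ?thesis by (simp add: r_def)
  qed
  have "Sec (\<Union>(C ` V)) r"
  proof (rule glue)
    fix U assume "U \<in> C ` V"
    then obtain y where y: "y \<in> V" "U = C y" by auto
    have "Sec (C y) r" by (rule cong[of _ "s y"]) (use C[OF y(1)] agree[OF y(1)] P_def in auto)
    then show "open U \<and> U \<subseteq> V \<and> Sec U r" using C y by auto
  qed
  moreover have UV: "\<Union>(C ` V) = V" using C mem by blast
  moreover have "r y = s0 y" if y: "y \<in> ball y0 \<epsilon>" for y
  proof -
    obtain \<delta> where d: "\<delta> > 0" "\<forall>w\<in>ball y0 \<delta>. s y0 w = s0 w" using C[OF y0V] P_def by blast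
    let ?U' = "ball y0 \<epsilon> \<inter> ball y0 \<delta> \<inter> C y0"
    have "Sec (ball y0 \<epsilon>) r" using calculation init V by (auto intro: mono)
    moreover have "open ?U'" "y0 \<in> ?U'" using C[OF y0V] mem(1)[OF y0V] init d by auto
    moreover have "\<forall>w\<in>?U'. r w = s0 w" using d agree[OF y0V] by auto
    moreover have "?U' \<noteq> {}" "?U' \<subseteq> ball y0 \<epsilon>" using \<open>y0 \<in> ?U'\<close> by blast+
    ultimately show ?thesis
      by (intro ident[of "ball y0 \<epsilon>" ?U' r s0 y] convex_ball open_ball init y)
  qed
  ultimately show ?thesis by auto
qed

section \<open>Lifting across a thin set\<close>

text \<open>
  A thin set does not separate convex open sets, so a lift is determined on such a set, off \<open>Z\<close>, by
  one value.  If near each point of \<open>Z\<close> every point of the covering lies on a local lift (that is,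
  the local monodromy around \<open>Z\<close> is trivial), then local lifts form a sheaf with
  unique continuation and \<open>local_sections_extend\<close> yields a global lift.
\<close>

lemma lift_across_thin_set:
  fixes p :: "'a::topological_space \<Rightarrow> 'c::topological_space" and \<Phi> :: "'b::real_normed_vector \<Rightarrow> 'c"
  assumes cov: "covering_space E p Y" and V: "open V" "convex V"
    and thin: "\<And>U. \<lbrakk>convex U; open U; U \<noteq> {}; U \<subseteq> V\<rbrakk> \<Longrightarrow> connected (U - Z) \<and> U - Z \<noteq> {}"
    and \<Phi>: "continuous_on (V - Z) \<Phi>" "\<Phi> \<in> V - Z \<rightarrow> Y"
    and loc: "\<And>q. q \<in> V \<inter> Z \<Longrightarrow> \<exists>\<rho>>0. ball q \<rho> \<subseteq> V \<and> (\<forall>y\<in>ball q \<rho> - Z. \<forall>e\<in>E. p e = \<Phi> y \<longrightarrow>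
       (\<exists>s. continuous_on (ball q \<rho> - Z) s \<and> s \<in> (ball q \<rho> - Z) \<rightarrow> E \<and>
            (\<forall>w\<in>ball q \<rho> - Z. p (s w) = \<Phi> w) \<and> s y = e))"
    and y0: "y0 \<in> V - Z" "e0 \<in> E" "p e0 = \<Phi> y0"
  shows "\<exists>s. continuous_on (V - Z) s \<and> s \<in> (V - Z) \<rightarrow> E \<and> (\<forall>w\<in>V - Z. p (s w) = \<Phi> w) \<and> s y0 = e0"
proof -
  define Lift where "Lift U s \<longleftrightarrow> continuous_on (U - Z) s \<and> s \<in> (U - Z) \<rightarrow> E \<and>
    (\<forall>w\<in>U - Z. p (s w) = \<Phi> w)" for U s
  define Sec where "Sec U s \<longleftrightarrow> Lift U s \<and> (\<forall>w\<in>U \<inter> Z. s w = undefined)" for U s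
  have Sec_of_Lift: "Sec U (\<lambda>w. if w \<in> Z then undefined else s w)" if "Lift U s" for U s
  proof -
    have "continuous_on (U - Z) (\<lambda>w. if w \<in> Z then undefined else s w)"
      by (rule continuous_on_eq[of _ s]) (use that in \<open>auto simp: Lift_def\<close>)
    then show ?thesis using that unfolding Sec_def Lift_def by auto
  qed
  have loc': "\<exists>\<rho>>0. ball q \<rho> \<subseteq> V \<and> (\<forall>y\<in>ball q \<rho> - Z. \<forall>e\<in>E. p e = \<Phi> y \<longrightarrow>
       (\<exists>s. Sec (ball q \<rho>) s \<and> s y = e))" if q: "q \<in> V" for q
  proof (cases "q \<in> Z")
    case True
    then have qVZ: "q \<in> V \<inter> Z" using q by blast
    have "\<exists>\<rho>>0. ball q \<rho> \<subseteq> V \<and>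
      (\<forall>y\<in>ball q \<rho> - Z. \<forall>e\<in>E. p e = \<Phi> y \<longrightarrow> (\<exists>s. Lift (ball q \<rho>) s \<and> s y = e))"
      using loc[OF qVZ] unfolding Lift_def conj_assoc .
    then obtain \<rho> where \<rho>: "\<rho> > 0" "ball q \<rho> \<subseteq> V"
      "\<forall>y\<in>ball q \<rho> - Z. \<forall>e\<in>E. p e = \<Phi> y \<longrightarrow> (\<exists>s. Lift (ball q \<rho>) s \<and> s y = e)"
      by (elim conjE exE) (rule that; assumption)
    have "\<exists>s. Sec (ball q \<rho>) s \<and> s y = e" if y: "y \<in> ball q \<rho> - Z" "e \<in> E" "p e = \<Phi> y" for y e
    proof -
      obtain s where "Lift (ball q \<rho>) s" "s y = e" using \<rho>(3) y by blast
      then show ?thesis using Sec_of_Lift y(1) by (intro exI[of _ "\<lambda>w. if w \<in> Z then undefined else s w"]) auto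
    qed
    then show ?thesis using \<rho> by blast
  next
    case False
    then have qY: "\<Phi> q \<in> Y" using \<Phi>(2) q by auto
    obtain T \<U> where T: "\<Phi> q \<in> T" "openin (top_of_set Y) T" "\<Union>\<U> = E \<inter> p -` T"
      and \<U>: "\<And>u. u \<in> \<U> \<Longrightarrow> openin (top_of_set E) u" "\<And>u. u \<in> \<U> \<Longrightarrow> \<exists>g. homeomorphism u T p g"
      using covering_space_sheet[OF cov qY] by metis
    have "openin (top_of_set (V - Z)) ((V - Z) \<inter> \<Phi> -` T)"
      by (rule continuous_openin_preimage[OF \<Phi> T(2)])
    then obtain A where A: "open A" "(V - Z) \<inter> \<Phi> -` T = (V - Z) \<inter> A" unfolding openin_open by blast
    have "q \<in> V \<inter> A" using A q False T(1) by blast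
    then obtain \<rho> where \<rho>: "\<rho> > 0" "ball q \<rho> \<subseteq> V \<inter> A"
      using V(1) A(1) open_contains_ball by (metis open_Int)
    have \<Phi>T: "\<Phi> w \<in> T" if "w \<in> ball q \<rho> - Z" for w using that A(2) \<rho>(2) by blast
    have "\<exists>s. Sec (ball q \<rho>) s \<and> s y = e" if y: "y \<in> ball q \<rho> - Z" "e \<in> E" "p e = \<Phi> y" for y e
    proof -
      have "e \<in> \<Union>\<U>" using T(3) \<Phi>T[OF y(1)] y by simp
      then obtain u where u: "u \<in> \<U>" "e \<in> u" by blast
      obtain g where g: "homeomorphism u T p g" using \<U>(2)[OF u(1)] by blast
      have uE: "u \<subseteq> E" using openin_imp_subset[OF \<U>(1)[OF u(1)]] .
      have "continuous_on (ball q \<rho> - Z) (g \<circ> \<Phi>)"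
        by (intro continuous_on_compose continuous_on_subset[OF \<Phi>(1)]
            continuous_on_subset[OF homeomorphism_cont2[OF g]]) (use \<rho> \<Phi>T in auto)
      moreover have "g \<circ> \<Phi> \<in> (ball q \<rho> - Z) \<rightarrow> E"
        using \<Phi>T homeomorphism_image2[OF g] uE by fastforce
      moreover have "\<forall>w\<in>ball q \<rho> - Z. p ((g \<circ> \<Phi>) w) = \<Phi> w"
        using \<Phi>T homeomorphism_apply2[OF g] by auto
      ultimately have "Lift (ball q \<rho>) (g \<circ> \<Phi>)" unfolding Lift_def by blast
      moreover have "g (\<Phi> y) = e" using homeomorphism_apply1[OF g u(2)] y(3) by simp
      ultimately show ?thesis using Sec_of_Lift y(1)
        by (intro exI[of _ "\<lambda>w. if w \<in> Z then undefined else (g \<circ> \<Phi>) w"]) auto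
    qed
    then show ?thesis using \<rho> by blast
  qed
  have uniq: "s y = s' y"
    if U: "convex U" "open U" "U \<subseteq> V" and s: "Sec U s" "Sec U s'" and a: "a \<in> U - Z" "s a = s' a" 
      and y: "y \<in> U" for U s s' a y
  proof (cases "y \<in> Z")
    case True
    then show ?thesis using s y unfolding Sec_def by simp
  next
    case False
    have "connected (U - Z)" using thin U a by blast
    moreover have "p (s x) = p (s' x)" if "x \<in> U - Z" for x
      using that s unfolding Sec_def Lift_def by simp
    moreover have "y \<in> U - Z" using y False by simp
    ultimately show ?thesis
      using covering_space_lifts_agree[OF cov, of "U - Z" s s' a y] s a
      unfolding Sec_def Lift_def by blast
  qed
  obtain \<epsilon> where \<epsilon>: "\<epsilon> > 0" "ball y0 \<epsilon> \<subseteq> V" 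
    "\<forall>y\<in>ball y0 \<epsilon> - Z. \<forall>e\<in>E. p e = \<Phi> y \<longrightarrow> (\<exists>s. Sec (ball y0 \<epsilon>) s \<and> s y = e)"
    using loc'[of y0] y0 by blast
  obtain s0 where s0: "Sec (ball y0 \<epsilon>) s0" "s0 y0 = e0"
    using \<epsilon> y0 by (metis Diff_iff centre_in_ball)
  have "\<exists>s. Sec V s \<and> (\<forall>y\<in>ball y0 \<epsilon>. s y = s0 y)"
  proof (rule local_sections_extend)
    show "open V" "convex V" "\<epsilon> > 0" "ball y0 \<epsilon> \<subseteq> V" "Sec (ball y0 \<epsilon>) s0" by fact+
    show "Sec U' s" if "Sec U s" "open U" "U \<subseteq> V" "open U'" "U' \<subseteq> U" for U U' s
    proof -
      have "continuous_on (U' - Z) s"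
        by (rule continuous_on_subset[of "U - Z"]) (use that in \<open>auto simp: Sec_def Lift_def\<close>)
      then show ?thesis using that unfolding Sec_def Lift_def by blast
    qed
    show "Sec U s'" if "Sec U s" "\<And>y. y \<in> U \<Longrightarrow> s y = s' y" for U s s'
    proof -
      have "continuous_on (U - Z) s'"
        by (rule continuous_on_eq[of _ s]) (use that in \<open>auto simp: Sec_def Lift_def\<close>)
      then show ?thesis using that unfolding Sec_def Lift_def by (auto simp: Pi_iff)
    qed
    show "Sec (\<Union>\<U>) s" if "\<And>U. U \<in> \<U> \<Longrightarrow> open U \<and> U \<subseteq> V \<and> Sec U s" for \<U> s
    proof -
      have "continuous_on (\<Union>\<U> - Z) s"
      proof (rule continuous_on_openin_Union)
        fix x assume "x \<in> \<Union>\<U> - Z"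
        then obtain U where U: "U \<in> \<U>" "x \<in> U - Z" by blast
        have "U - Z = (\<Union>\<U> - Z) \<inter> U" using U by blast
        moreover have "open U" using that U(1) by blast
        ultimately have "openin (top_of_set (\<Union>\<U> - Z)) (U - Z)" by (simp add: openin_open_Int)
        moreover have "continuous_on (U - Z) s" using that U(1) unfolding Sec_def Lift_def by blast
        ultimately show "\<exists>U. openin (top_of_set (\<Union>\<U> - Z)) U \<and> x \<in> U \<and> continuous_on U s"
          using U by blast
      qed
      then show ?thesis using that unfolding Sec_def Lift_def by blast
    qed
    show "s y = s' y" if "convex U" "open U" "U \<subseteq> V" "open U'" "U' \<noteq> {}" "U' \<subseteq> U" "Sec U s" "Sec U s'"
      "\<forall>y\<in>U'. s y = s' y" "y \<in> U" for U U' s s' y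
    proof -
      obtain u where u: "u \<in> U'" using \<open>U' \<noteq> {}\<close> by blast
      then obtain r where r: "r > 0" "ball u r \<subseteq> U'" using \<open>open U'\<close> open_contains_ball by blast
      then have "ball u r - Z \<noteq> {}" using thin[of "ball u r"] that by auto
      then obtain a where "a \<in> U' - Z" using r by blast
      then show ?thesis using uniq[of U s s' a y] that by blast
    qed
    show "\<exists>\<rho>>0. ball q \<rho> \<subseteq> V \<and>
                (\<forall>U s. convex U \<longrightarrow> open U \<longrightarrow> U \<noteq> {} \<longrightarrow> U \<subseteq> ball q \<rho> \<longrightarrow> Sec U s \<longrightarrow>
                  (\<exists>s' U'. Sec (ball q \<rho>) s' \<and> open U' \<and> U' \<noteq> {} \<and> U' \<subseteq> U \<and> (\<forall>y\<in>U'. s y = s' y)))"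
      if q: "q \<in> V" for q
    proof -
      obtain \<rho> where \<rho>: "\<rho> > 0" "ball q \<rho> \<subseteq> V" 
        "\<forall>y\<in>ball q \<rho> - Z. \<forall>e\<in>E. p e = \<Phi> y \<longrightarrow> (\<exists>s. Sec (ball q \<rho>) s \<and> s y = e)"
        using loc'[OF q] by blast
      have "\<exists>s' U'. Sec (ball q \<rho>) s' \<and> open U' \<and> U' \<noteq> {} \<and> U' \<subseteq> U \<and> (\<forall>y\<in>U'. s y = s' y)"
        if U: "convex U" "open U" "U \<noteq> {}" "U \<subseteq> ball q \<rho>" "Sec U s" for U s
      proof -
        obtain a where a: "a \<in> U - Z" using thin[of U] U \<rho>(2) by blast
        have "s a \<in> E" "p (s a) = \<Phi> a" using U(5) a unfolding Sec_def Lift_def by blast+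
        then obtain s' where s': "Sec (ball q \<rho>) s'" "s' a = s a" using \<rho>(3) a U(4) by blast
        have "continuous_on (U - Z) s'"
          by (rule continuous_on_subset[of "ball q \<rho> - Z"]) (use s' U in \<open>auto simp: Sec_def Lift_def\<close>)
        then have "Sec U s'" using s'(1) U(4) unfolding Sec_def Lift_def by blast
        then have "\<forall>y\<in>U. s y = s' y" using uniq[of U s s' a] U \<rho>(2) a s'(2) by auto
        then show ?thesis using s'(1) U by blast
      qed
      then show ?thesis using \<rho> by blast
    qed
  qed
  then show ?thesis using s0 \<epsilon>(1) unfolding Sec_def Lift_def by (metis centre_in_ball)
qed

text \<open>
  A global section through one point coincides with the inverse map by uniqueness of lifts.
\<close>

lemma covering_of_normed_space_injective:
  fixes p :: "'a::topological_space \<Rightarrow> 'b::real_normed_vector"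
  assumes cov: "covering_space E p UNIV" and E: "connected E"
  shows "inj_on p E"
proof (cases "E = {}")
  case False
  then obtain e0 where e0: "e0 \<in> E" by blast
  have "\<exists>s. continuous_on (UNIV - {}) s \<and> s \<in> UNIV - {} \<rightarrow> E \<and> (\<forall>w\<in>UNIV - {}. p (s w) = w) \<and> s (p e0) = e0"
    by (rule lift_across_thin_set[OF cov]) (use e0 in \<open>auto simp: convex_connected\<close>)
  then obtain s where s: "continuous_on UNIV s" "\<And>w. s w \<in> E" "\<And>w. p (s w) = w" "s (p e0) = e0" by auto
  have "s (p e) = e" if e: "e \<in> E" for e
  proof (rule covering_space_lifts_agree[OF cov E, of "\<lambda>e. s (p e)" "\<lambda>e. e" e0])
    show "continuous_on E (\<lambda>e. s (p e))"
      by (rule continuous_on_compose2[OF s(1) covering_space_imp_continuous[OF cov]]) simp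
  qed (use s e e0 in auto)
  then show ?thesis by (metis inj_on_inverseI)
qed auto

text \<open>
  The preimage of a thin set under a local homeomorphism does not separate small neighbourhoods, so
  a splitting of its complement into two open sets decides to which side each of its points belongs.
\<close>

lemma open_split_extends_across_thin_set:
  fixes F :: "'a::topological_space \<Rightarrow> 'b::metric_space"
  assumes loc: "\<And>e. e \<in> M \<Longrightarrow> \<exists>U G. e \<in> U \<and> openin (top_of_set M) U \<and> open (F ` U) \<and> homeomorphism U (F ` U) F G"
    and thin: "\<And>q r. r > 0 \<Longrightarrow> connected (ball q r - Z) \<and> ball q r - Z \<noteq> {}"
    and P: "openin (top_of_set M) P1" "openin (top_of_set M) P2" "P1 \<union> P2 = M - F -` Z" "P1 \<inter> P2 = {}"
  obtains R1 R2 where "openin (top_of_set M) R1" "openin (top_of_set M) R2" "R1 \<union> R2 = M" "R1 \<inter> R2 = {}"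
    "R1 - F -` Z = P1" "R2 - F -` Z = P2"
proof -
  define hat where "hat P = {e \<in> M. \<exists>N. openin (top_of_set M) N \<and> e \<in> N \<and> N - F -` Z \<subseteq> P}" for P
  have o: "openin (top_of_set M) (hat P)" for P
  proof (subst openin_subopen, intro ballI)
    fix e assume "e \<in> hat P"
    then obtain N where N: "openin (top_of_set M) N" "e \<in> N" "N - F -` Z \<subseteq> P" by (auto simp: hat_def)
    then have "N \<subseteq> hat P" using openin_imp_subset[OF N(1)] by (auto simp: hat_def)
    then show "\<exists>T. openin (top_of_set M) T \<and> e \<in> T \<and> T \<subseteq> hat P" using N by blast
  qed
  have small: "\<exists>N. openin (top_of_set M) N \<and> e \<in> N \<and> N \<subseteq> O1 \<and> connected (N - F -` Z) \<and> N - F -` Z \<noteq> {}"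
    if O1: "openin (top_of_set M) O1" "e \<in> O1" for e O1
  proof -
    have eM: "e \<in> M" using O1 openin_imp_subset by blast
    obtain U G where U: "e \<in> U" "openin (top_of_set M) U" "open (F ` U)" "homeomorphism U (F ` U) F G"
      using loc[OF eM] by blast
    have "openin (top_of_set U) (U \<inter> O1)"
      using O1(1) openin_imp_subset[OF U(2)] openin_Int[OF U(2) O1(1)] by (meson inf_le1 openin_subset_trans)
    then have "openin (top_of_set (F ` U)) (F ` (U \<inter> O1))" by (rule homeomorphism_imp_open_map[OF U(4)])
    then have "open (F ` (U \<inter> O1))" using U(3) openin_open_eq by blast
    then obtain r where r: "r > 0" "ball (F e) r \<subseteq> F ` (U \<inter> O1)"
      using O1(2) U(1) open_contains_ball by (metis IntI imageI)
    let ?N = "G ` ball (F e) r"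
    have bU: "ball (F e) r \<subseteq> F ` U" using r by blast
    have "openin (top_of_set (F ` U)) (ball (F e) r)" using bU by (simp add: open_subset)
    then have "openin (top_of_set U) ?N"
      using homeomorphism_imp_open_map[OF U(4)[THEN homeomorphism_sym[THEN iffD1]]] by blast
    then have "openin (top_of_set M) ?N" using U(2) openin_trans by blast
    moreover have "G (F e) = e" using homeomorphism_apply1[OF U(4,1)] .
    then have "e \<in> ?N" using r(1) by (metis centre_in_ball imageI)
    moreover have "?N \<subseteq> O1"
    proof
      fix x assume "x \<in> ?N"
      then obtain w where "w \<in> U \<inter> O1" "x = G (F w)" using r(2) by blast
      then show "x \<in> O1" using homeomorphism_apply1[OF U(4)] by auto
    qed
    moreover have eq: "?N - F -` Z = G ` (ball (F e) r - Z)"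
      using bU homeomorphism_apply2[OF U(4)] by auto
    have "continuous_on (ball (F e) r - Z) G"
      using bU by (intro continuous_on_subset[OF homeomorphism_cont2[OF U(4)]]) auto
    then have "connected (?N - F -` Z)" unfolding eq
      using thin[OF r(1)] connected_continuous_image by blast
    moreover have "?N - F -` Z \<noteq> {}" unfolding eq using thin[OF r(1)] by blast
    ultimately show ?thesis by blast
  qed
  have PM: "P1 \<subseteq> M" "P2 \<subseteq> M" using P by (auto dest: openin_imp_subset)
  have disj: "hat P1 \<inter> hat P2 = {}"
  proof (rule ccontr)
    assume "hat P1 \<inter> hat P2 \<noteq> {}"
    then obtain e N1 N2 where N: "openin (top_of_set M) N1" "e \<in> N1" "N1 - F -` Z \<subseteq> P1"
      "openin (top_of_set M) N2" "e \<in> N2" "N2 - F -` Z \<subseteq> P2" by (auto simp: hat_def)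
    have "openin (top_of_set M) (N1 \<inter> N2)" using N by blast
    then obtain N where "N \<subseteq> N1 \<inter> N2" "N - F -` Z \<noteq> {}" using small[of "N1 \<inter> N2" e] N by blast
    then show False using N P(4) by blast
  qed
  have cover: "hat P1 \<union> hat P2 = M"
  proof
    show "hat P1 \<union> hat P2 \<subseteq> M" by (auto simp: hat_def)
    show "M \<subseteq> hat P1 \<union> hat P2"
    proof
      fix e assume e: "e \<in> M"
      then obtain N where N: "openin (top_of_set M) N" "e \<in> N" "N \<subseteq> M" "connected (N - F -` Z)"
        "N - F -` Z \<noteq> {}" using small[of M e] openin_subtopology_self by blast
      let ?C = "N - F -` Z"
      have CM: "?C \<subseteq> M" "?C \<subseteq> P1 \<union> P2" using N(3) P(3) by blast+
      have "?C \<subseteq> P1 \<or> ?C \<subseteq> P2"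
      proof (cases "?C \<inter> P1 = {}")
        case False
        then show ?thesis using connected_subset_of_open_split[OF N(4) CM(1) P(1,2) CM(2)] P(4) by blast
      qed (use CM in blast)
      then show "e \<in> hat P1 \<union> hat P2" using e N(1,2) unfolding hat_def by blast
    qed
  qed
  have sub: "P1 \<subseteq> hat P1" "P2 \<subseteq> hat P2" using PM P(1,2) unfolding hat_def by blast+
  have "hat P1 - F -` Z = P1" "hat P2 - F -` Z = P2"
    using sub disj cover P(3) by blast+
  then show ?thesis using that[of "hat P1" "hat P2"] o cover disj by blast
qed

lemma connected_minus_thin_preimage:
  fixes F :: "'a::topological_space \<Rightarrow> 'b::metric_space"
  assumes M: "connected M" and Z: "closed Z"
    and loc: "\<And>e. e \<in> M \<Longrightarrow> \<exists>U G. e \<in> U \<and> openin (top_of_set M) U \<and> open (F ` U) \<and> homeomorphism U (F ` U) F G"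
    and thin: "\<And>q r. r > 0 \<Longrightarrow> connected (ball q r - Z) \<and> ball q r - Z \<noteq> {}"
  shows "connected (M - F -` Z)"
proof -
  have cF: "continuous_on M F"
  proof (rule continuous_on_openin_Union)
    fix x assume "x \<in> M"
    then obtain U G where "x \<in> U" "openin (top_of_set M) U" "homeomorphism U (F ` U) F G" using loc by blast
    then show "\<exists>U. openin (top_of_set M) U \<and> x \<in> U \<and> continuous_on U F"
      using homeomorphism_cont1 by blast
  qed
  have "openin (top_of_set M) (M \<inter> F -` (- Z))"
    using Z by (intro continuous_openin_preimage_gen[OF cF]) (simp add: open_Compl)
  moreover have "M \<inter> F -` (- Z) = M - F -` Z" by blast
  ultimately have oM: "openin (top_of_set M) (M - F -` Z)" by simp
  show ?thesis
    unfolding connected_openin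
  proof
    assume "\<exists>P1 P2. openin (top_of_set (M - F -` Z)) P1 \<and> openin (top_of_set (M - F -` Z)) P2 \<and>
       M - F -` Z \<subseteq> P1 \<union> P2 \<and> P1 \<inter> P2 = {} \<and> P1 \<noteq> {} \<and> P2 \<noteq> {}"
    then obtain P1 P2 where P: "openin (top_of_set (M - F -` Z)) P1" "openin (top_of_set (M - F -` Z)) P2"
       "M - F -` Z \<subseteq> P1 \<union> P2" "P1 \<inter> P2 = {}" "P1 \<noteq> {}" "P2 \<noteq> {}" by (elim exE conjE) (rule that; assumption)
    have oP: "openin (top_of_set M) P1" "openin (top_of_set M) P2" using P(1,2) oM openin_trans by blast+
    have PU: "P1 \<union> P2 = M - F -` Z" using P(3) openin_imp_subset[OF P(1)] openin_imp_subset[OF P(2)] by blast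
    obtain R1 R2 where R: "openin (top_of_set M) R1" "openin (top_of_set M) R2" "R1 \<union> R2 = M" "R1 \<inter> R2 = {}"
      "R1 - F -` Z = P1" "R2 - F -` Z = P2"
      by (rule open_split_extends_across_thin_set[OF loc thin oP PU P(4)])
    then have "M \<subseteq> R1"
      using connected_subset_of_open_split[OF M order.refl R(1,2)] P(5) by blast
    then show False using R P(6) by blast
  qed
qed

section \<open>Lifting families of paths\<close>

text \<open>
  Lifting along a segment with a parameter: finitely many evenly covered boxes suffice along the
  segment, and each step shrinks the parameter neighbourhood \<open>N\<close> once, because the lift found so
  far enters one and the same sheet over the next box only for parameters close to \<open>x0\<close>.
\<close>

lemma covering_space_tube:
  fixes p :: "'a::topological_space \<Rightarrow> 'c::topological_space"
    and \<Phi> :: "'b::real_normed_vector \<times> 'x::topological_space \<Rightarrow> 'c"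
  assumes cov: "covering_space E p Y" and V: "open V" "convex V"
    and \<Phi>: "continuous_on (V \<times> Fib) \<Phi>" "\<Phi> \<in> V \<times> Fib \<rightarrow> Y"
    and z: "z0 \<in> V" "z1 \<in> V" and x0: "x0 \<in> Fib" and e0: "e0 \<in> E" "p e0 = \<Phi> (z0, x0)"
  shows "\<exists>C. convex C \<and> open C \<and> closed_segment z0 z1 \<subseteq> C \<and> C \<subseteq> V \<and>
    (\<exists>N s. openin (top_of_set Fib) N \<and> x0 \<in> N \<and> continuous_on (C \<times> N) s \<and> s \<in> C \<times> N \<rightarrow> E \<and>
      (\<forall>w\<in>C \<times> N. p (s w) = \<Phi> w) \<and> s (z0, x0) = e0)"
proof -
  define G where "G B \<longleftrightarrow> B \<subseteq> V \<and> (\<exists>N T \<U>. openin (top_of_set Fib) N \<and> x0 \<in> N \<and>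
     (\<forall>w\<in>B \<times> N. \<Phi> w \<in> T) \<and> \<Union>\<U> = E \<inter> p -` T \<and> (\<forall>u\<in>\<U>. openin (top_of_set E) u) \<and>
     (\<forall>u\<in>\<U>. \<exists>g. homeomorphism u T p g))" for B
  define R where "R C \<longleftrightarrow> C \<subseteq> V \<and> (\<exists>N s. openin (top_of_set Fib) N \<and> x0 \<in> N \<and>
      continuous_on (C \<times> N) s \<and> s \<in> C \<times> N \<rightarrow> E \<and> (\<forall>w\<in>C \<times> N. p (s w) = \<Phi> w) \<and> s (z0, x0) = e0)" for C
  have good: "\<exists>\<rho>>0. G (ball q \<rho>)" if q: "q \<in> V" for q
  proof -
    have "\<Phi> (q, x0) \<in> Y" using \<Phi>(2) q x0 by auto
    then obtain T \<U> where T: "\<Phi> (q, x0) \<in> T" "openin (top_of_set Y) T" "\<Union>\<U> = E \<inter> p -` T"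
      and \<U>: "\<And>u. u \<in> \<U> \<Longrightarrow> openin (top_of_set E) u" "\<And>u. u \<in> \<U> \<Longrightarrow> \<exists>g. homeomorphism u T p g"
      using covering_space_sheet[OF cov] by metis
    have "openin (top_of_set (V \<times> Fib)) ((V \<times> Fib) \<inter> \<Phi> -` T)"
      by (rule continuous_openin_preimage[OF \<Phi> T(2)])
    then obtain A where A: "open A" "(V \<times> Fib) \<inter> \<Phi> -` T = (V \<times> Fib) \<inter> A" unfolding openin_open by blast
    have "(q, x0) \<in> A" using A q x0 T(1) by blast
    then obtain A1 A2 where A12: "open A1" "open A2" "(q, x0) \<in> A1 \<times> A2" "A1 \<times> A2 \<subseteq> A"
      using open_prod_elim[OF A(1)] by metis
    then have A12': "q \<in> A1" "x0 \<in> A2" by auto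
    obtain \<rho> where \<rho>: "\<rho> > 0" "ball q \<rho> \<subseteq> V \<inter> A1"
      using V(1) A12(1) A12'(1) q open_contains_ball by (metis IntI open_Int)
    have "\<forall>w\<in>ball q \<rho> \<times> (Fib \<inter> A2). \<Phi> w \<in> T"
    proof
      fix w assume "w \<in> ball q \<rho> \<times> (Fib \<inter> A2)"
      then have "w \<in> (V \<times> Fib) \<inter> A" using \<rho>(2) A12(4) by auto
      then show "\<Phi> w \<in> T" using A(2) by blast
    qed
    moreover have "openin (top_of_set Fib) (Fib \<inter> A2)" "x0 \<in> Fib \<inter> A2" using A12(2) A12'(2) x0 by (simp_all add: openin_open_Int)
    ultimately have "G (ball q \<rho>)" unfolding G_def using T(3) \<U> \<rho>(2)
      by (intro conjI exI[of _ "Fib \<inter> A2"] exI[of _ T] exI[of _ \<U>]) auto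
    then show ?thesis using \<rho>(1) by blast
  qed
  obtain \<epsilon> where \<epsilon>: "\<epsilon> > 0" "G (ball z0 \<epsilon>)" using good z by blast
  have init: "R (ball z0 \<epsilon>)"
  proof -
    obtain N T \<U> where N: "openin (top_of_set Fib) N" "x0 \<in> N" "\<forall>w\<in>ball z0 \<epsilon> \<times> N. \<Phi> w \<in> T"
      and \<U>: "\<Union>\<U> = E \<inter> p -` T" "\<forall>u\<in>\<U>. openin (top_of_set E) u" "\<forall>u\<in>\<U>. \<exists>g. homeomorphism u T p g"
      and bV: "ball z0 \<epsilon> \<subseteq> V"
      using \<epsilon>(2) unfolding G_def by (elim conjE exE) (rule that; assumption)
    have NF: "N \<subseteq> Fib" using openin_imp_subset[OF N(1)] .
    have "\<Phi> (z0, x0) \<in> T" using N \<epsilon>(1) by auto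
    then have "e0 \<in> \<Union>\<U>" using \<U>(1) e0 by simp
    then obtain u where u: "u \<in> \<U>" "e0 \<in> u" by blast
    then obtain g where g: "homeomorphism u T p g" using \<U>(3) by blast
    have uE: "u \<subseteq> E" using \<U>(2) u(1) openin_imp_subset by blast
    have "continuous_on (ball z0 \<epsilon> \<times> N) (g \<circ> \<Phi>)"
      by (intro continuous_on_compose continuous_on_subset[OF \<Phi>(1)]
          continuous_on_subset[OF homeomorphism_cont2[OF g]]) (use bV NF N(3) in auto)
    moreover have "g \<circ> \<Phi> \<in> ball z0 \<epsilon> \<times> N \<rightarrow> E"
      using N(3) homeomorphism_image2[OF g] uE by fastforce
    moreover have "\<forall>w\<in>ball z0 \<epsilon> \<times> N. p ((g \<circ> \<Phi>) w) = \<Phi> w"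
      using N(3) homeomorphism_apply2[OF g] by simp
    moreover have "(g \<circ> \<Phi>) (z0, x0) = e0" using homeomorphism_apply1[OF g u(2)] e0(2) by simp
    ultimately show ?thesis unfolding R_def using bV N(1,2) by blast
  qed
  have "\<exists>C. convex C \<and> open C \<and> closed_segment z0 z1 \<subseteq> C \<and> R C"
  proof (rule convex_neighbourhood_induct[where G=G and R=R and \<epsilon>=\<epsilon>])
    show "\<exists>\<rho>>0. G (ball q \<rho>)" if "q \<in> closed_segment z0 z1" for q
      using good that z V(2) closed_segment_subset by blast
    show "\<epsilon> > 0" "R (ball z0 \<epsilon>)" by fact+
  next
    fix C C' assume C: "R C" "C' \<subseteq> C"
    obtain N s where s: "C \<subseteq> V" "openin (top_of_set Fib) N" "x0 \<in> N"
      "continuous_on (C \<times> N) s" "s \<in> C \<times> N \<rightarrow> E" "\<forall>w\<in>C \<times> N. p (s w) = \<Phi> w" "s (z0, x0) = e0"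
      using C(1) unfolding R_def by (elim conjE exE) (rule that; assumption)
    have "C' \<times> N \<subseteq> C \<times> N" using C(2) by blast
    then have "continuous_on (C' \<times> N) s" "s \<in> C' \<times> N \<rightarrow> E" "\<forall>w\<in>C' \<times> N. p (s w) = \<Phi> w"
      using s continuous_on_subset by blast+
    then show "R C'" unfolding R_def using s C(2) by blast
  next
    fix C B C'
    assume C: "R C" "convex C" "open C" "z0 \<in> C" and B: "G B" "convex B" "open B"
      and ne: "C \<inter> B \<noteq> {}" and C': "z0 \<in> C'" "C' \<subseteq> C \<union> B"
    obtain N s where s: "C \<subseteq> V" "openin (top_of_set Fib) N" "x0 \<in> N"
      "continuous_on (C \<times> N) s" "s \<in> C \<times> N \<rightarrow> E" "\<forall>w\<in>C \<times> N. p (s w) = \<Phi> w" "s (z0, x0) = e0"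
      using C(1) unfolding R_def by (elim conjE exE) (rule that; assumption)
    obtain N' T \<U> where N': "openin (top_of_set Fib) N'" "x0 \<in> N'" "\<forall>w\<in>B \<times> N'. \<Phi> w \<in> T"
      and \<U>: "\<Union>\<U> = E \<inter> p -` T" "\<forall>u\<in>\<U>. openin (top_of_set E) u" "\<forall>u\<in>\<U>. \<exists>g. homeomorphism u T p g"
      and BV: "B \<subseteq> V"
      using B(1) unfolding G_def by (elim conjE exE) (rule that; assumption)
    obtain w where w: "w \<in> C" "w \<in> B" using ne by blast
    have "s (w, x0) \<in> E" "p (s (w, x0)) \<in> T" using s(3,5,6) w N' by auto
    then have "s (w, x0) \<in> \<Union>\<U>" using \<U>(1) by simp
    then obtain u where u: "u \<in> \<U>" "s (w, x0) \<in> u" by blast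
    then obtain g where g: "homeomorphism u T p g" using \<U>(3) by blast
    have ou: "openin (top_of_set E) u" using \<U>(2) u(1) by blast
    have uE: "u \<subseteq> E" using ou openin_imp_subset by blast
    have sw: "continuous_on N (\<lambda>x. s (w, x))"
      using w by (intro continuous_on_compose2[OF s(4)] continuous_intros) auto
    have swE: "(\<lambda>x. s (w, x)) \<in> N \<rightarrow> E" using s(5) w by auto
    let ?N = "(N \<inter> (\<lambda>x. s (w, x)) -` u) \<inter> (N \<inter> N')"
    have "openin (top_of_set N) (N \<inter> (\<lambda>x. s (w, x)) -` u)"
      using continuous_openin_preimage[OF sw swE ou] .
    then have oN: "openin (top_of_set Fib) ?N"
      using s(2) N'(1) openin_trans by blast
    have NF: "?N \<subseteq> Fib" using openin_imp_subset[OF oN] .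
    have xN: "x0 \<in> ?N" using s(3) N'(2) u(2) by auto
    have g\<Phi>: "continuous_on (B \<times> ?N) (g \<circ> \<Phi>)"
      by (intro continuous_on_compose continuous_on_subset[OF \<Phi>(1)]
          continuous_on_subset[OF homeomorphism_cont2[OF g]]) (use BV NF N'(3) in auto)
    have g\<Phi>E: "(g \<circ> \<Phi>) v \<in> E" "p ((g \<circ> \<Phi>) v) = \<Phi> v" if "v \<in> B \<times> ?N" for v
    proof -
      have vT: "\<Phi> v \<in> T" using that N'(3) by auto
      then show "(g \<circ> \<Phi>) v \<in> E" using homeomorphism_image2[OF g] uE by auto
      show "p ((g \<circ> \<Phi>) v) = \<Phi> v" using homeomorphism_apply2[OF g vT] by simp
    qed
    have agree: "s (z, x) = (g \<circ> \<Phi>) (z, x)" if z: "z \<in> C \<inter> B" and x: "x \<in> ?N" for z x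
    proof (rule covering_space_lifts_agree[OF cov, of "C \<inter> B" "\<lambda>z. s (z, x)" "\<lambda>z. (g \<circ> \<Phi>) (z, x)" w])
      show "connected (C \<inter> B)" using C B by (simp add: convex_Int convex_connected)
      show "continuous_on (C \<inter> B) (\<lambda>z. s (z, x))"
        using x by (intro continuous_on_compose2[OF s(4)] continuous_intros) auto
      show "continuous_on (C \<inter> B) (\<lambda>z. (g \<circ> \<Phi>) (z, x))"
        using x by (intro continuous_on_compose2[OF g\<Phi>] continuous_intros) auto
      show "(\<lambda>z. s (z, x)) \<in> C \<inter> B \<rightarrow> E" using x s(5) by auto
      show "(\<lambda>z. (g \<circ> \<Phi>) (z, x)) \<in> C \<inter> B \<rightarrow> E" using g\<Phi>E(1) x by blast
      show "p (s (z, x)) = p ((g \<circ> \<Phi>) (z, x))" if "z \<in> C \<inter> B" for z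
        using g\<Phi>E(2)[of "(z, x)"] s(6) that x by auto
      show "w \<in> C \<inter> B" using w by simp
      have "p (s (w, x)) = \<Phi> (w, x)" using s(6) w x by auto
      moreover have "g (p (s (w, x))) = s (w, x)" using x by (intro homeomorphism_apply1[OF g]) auto
      ultimately show "s (w, x) = (g \<circ> \<Phi>) (w, x)" by simp
      show "z \<in> C \<inter> B" by (rule z)
    qed
    define r where "r v = (if fst v \<in> C then s v else (g \<circ> \<Phi>) v)" for v
    have rB: "r v = (g \<circ> \<Phi>) v" if "v \<in> B \<times> ?N" for v
    proof -
      have "v = (fst v, snd v)" "fst v \<in> B" "snd v \<in> ?N" using that by auto
      then show ?thesis using agree[of "fst v" "snd v"] unfolding r_def by auto
    qed
    have rC: "r v = s v" if "v \<in> C \<times> N" for v using that unfolding r_def by auto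
    have contr: "continuous_on (C' \<times> ?N) r"
    proof (rule continuous_on_openin_Union)
      fix v assume v: "v \<in> C' \<times> ?N"
      have o: "openin (top_of_set (C' \<times> ?N)) ((C' \<times> ?N) \<inter> (D \<times> UNIV))" if "open D" for D
        by (intro openin_open_Int open_Times that) auto
      have C1: "continuous_on ((C' \<times> ?N) \<inter> (C \<times> UNIV)) r"
        by (rule continuous_on_eq[of _ s]) (use rC in \<open>auto intro: continuous_on_subset[OF s(4)]\<close>)
      have B1: "continuous_on ((C' \<times> ?N) \<inter> (B \<times> UNIV)) r"
        by (rule continuous_on_eq[of _ "g \<circ> \<Phi>"])
           (use rB in \<open>auto intro: continuous_on_subset[OF g\<Phi>] simp del: o_apply\<close>)
      have "v \<in> (C' \<times> ?N) \<inter> (C \<times> UNIV) \<or> v \<in> (C' \<times> ?N) \<inter> (B \<times> UNIV)" using v C'(2) by auto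
      then show "\<exists>U. openin (top_of_set (C' \<times> ?N)) U \<and> v \<in> U \<and> continuous_on U r"
        using o[OF C(3)] o[OF B(3)] C1 B1 by blast
    qed
    have rE: "r v \<in> E \<and> p (r v) = \<Phi> v" if "v \<in> C' \<times> ?N" for v
    proof (cases "fst v \<in> C")
      case True
      then have "v \<in> C \<times> N" using that by auto
      then show ?thesis using rC s(5,6) by fastforce
    next
      case False
      then have "v \<in> B \<times> ?N" using that C'(2) by auto
      then show ?thesis using rB g\<Phi>E by metis
    qed
    have "r (z0, x0) = e0" using C(4) s(7) by (simp add: r_def)
    then show "R C'" unfolding R_def
      using contr rE oN xN C'(2) s(1) BV by blast
  qed
  then show ?thesis unfolding R_def by blast
qed

text \<open>
  Parallel transport: \<open>L z x e w\<close> is the point reached from \<open>e\<close>, which lies over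
  \<open>\<Phi> (z, x)\<close>, by lifting the motion of the first coordinate from \<open>z\<close> to \<open>w\<close>.  Joint
  continuity comes from the tubes, on which the transport is given by a continuous section.
\<close>

lemma covering_family_lift:
  fixes p :: "'a::topological_space \<Rightarrow> 'c::topological_space"
    and \<Phi> :: "'b::real_normed_vector \<times> 'x::topological_space \<Rightarrow> 'c"
  assumes cov: "covering_space E p Y" and V: "open V" "convex V"
    and \<Phi>: "continuous_on (V \<times> Fib) \<Phi>" "\<Phi> \<in> V \<times> Fib \<rightarrow> Y"
  obtains L where
    "\<And>z x e. \<lbrakk>z \<in> V; x \<in> Fib; e \<in> E; p e = \<Phi> (z, x)\<rbrakk> \<Longrightarrow> L z x e z = e"
    "\<And>z x e w. \<lbrakk>z \<in> V; x \<in> Fib; e \<in> E; p e = \<Phi> (z, x); w \<in> V\<rbrakk> \<Longrightarrow> L z x e w \<in> E"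
    "\<And>z x e w. \<lbrakk>z \<in> V; x \<in> Fib; e \<in> E; p e = \<Phi> (z, x); w \<in> V\<rbrakk> \<Longrightarrow> p (L z x e w) = \<Phi> (w, x)"
    "continuous_on {(z, x, e, w). z \<in> V \<and> x \<in> Fib \<and> e \<in> E \<and> p e = \<Phi> (z, x) \<and> w \<in> V}
       (\<lambda>(z, x, e, w). L z x e w)"
proof -
  have ex: "\<exists>s. continuous_on V s \<and> s \<in> V \<rightarrow> E \<and> (\<forall>w\<in>V. p (s w) = \<Phi> (w, x)) \<and> s z = e"
    if z: "z \<in> V" and x: "x \<in> Fib" and e: "e \<in> E" "p e = \<Phi> (z, x)" for z x e
  proof -
    have cx: "continuous_on (V - {}) (\<lambda>w. \<Phi> (w, x))"
      using x by (intro continuous_on_compose2[OF \<Phi>(1)] continuous_intros) auto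
    have xY: "(\<lambda>w. \<Phi> (w, x)) \<in> V - {} \<rightarrow> Y" using \<Phi>(2) x by auto
    have "\<exists>s. continuous_on (V - {}) s \<and> s \<in> V - {} \<rightarrow> E \<and> (\<forall>w\<in>V - {}. p (s w) = \<Phi> (w, x)) \<and> s z = e"
      by (rule lift_across_thin_set[OF cov V _ cx xY]) (use z e in \<open>auto simp: convex_connected\<close>)
    then show ?thesis by simp
  qed
  define L where "L z x e = (SOME s. continuous_on V s \<and> s \<in> V \<rightarrow> E \<and> (\<forall>w\<in>V. p (s w) = \<Phi> (w, x)) \<and> s z = e)"
    for z x e
  have L: "continuous_on V (L z x e) \<and> L z x e \<in> V \<rightarrow> E \<and> (\<forall>w\<in>V. p (L z x e w) = \<Phi> (w, x)) \<and> L z x e z = e"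
    if "z \<in> V" "x \<in> Fib" "e \<in> E" "p e = \<Phi> (z, x)" for z x e
    unfolding L_def by (rule someI_ex[OF ex[OF that]])
  let ?D = "{(z, x, e, w). z \<in> V \<and> x \<in> Fib \<and> e \<in> E \<and> p e = \<Phi> (z, x) \<and> w \<in> V}"
  have "continuous_on ?D (\<lambda>(z, x, e, w). L z x e w)"
  proof (rule continuous_on_openin_Union)
    fix v assume v: "v \<in> ?D"
    obtain z0 x0 e0 w0 where v0: "v = (z0, x0, e0, w0)" by (metis prod.collapse)
    have z0: "z0 \<in> V" "x0 \<in> Fib" "e0 \<in> E" "p e0 = \<Phi> (z0, x0)" "w0 \<in> V" using v v0 by auto
    obtain C N s where C: "convex C" "open C" "closed_segment z0 w0 \<subseteq> C" "C \<subseteq> V"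
      and N: "openin (top_of_set Fib) N" "x0 \<in> N"
      and s: "continuous_on (C \<times> N) s" "s \<in> C \<times> N \<rightarrow> E" "\<forall>w\<in>C \<times> N. p (s w) = \<Phi> w" "s (z0, x0) = e0"
      using covering_space_tube[OF cov V \<Phi> z0(1,5,2,3,4)] by (elim conjE exE) (rule that; assumption)
    obtain u T q where u: "e0 \<in> u" "openin (top_of_set E) u" and q: "homeomorphism u T p q"
      using covering_space_local_homeomorphism[OF cov z0(3)] by metis
    let ?z = "\<lambda>v::'b \<times> 'x \<times> 'a \<times> 'b. fst v" and ?x = "\<lambda>v::'b \<times> 'x \<times> 'a \<times> 'b. fst (snd v)"
      and ?e = "\<lambda>v::'b \<times> 'x \<times> 'a \<times> 'b. fst (snd (snd v))" and ?w = "\<lambda>v::'b \<times> 'x \<times> 'a \<times> 'b. snd (snd (snd v))"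
    have co: "continuous_on ?D ?z" "continuous_on ?D ?x" "continuous_on ?D ?e" "continuous_on ?D ?w"
      by (intro continuous_intros)+
    have im: "?x \<in> ?D \<rightarrow> Fib" "?e \<in> ?D \<rightarrow> E" by auto
    define D1 where "D1 = ((?D \<inter> ?z -` C) \<inter> (?D \<inter> ?w -` C)) \<inter> ((?D \<inter> ?x -` N) \<inter> (?D \<inter> ?e -` u))"
    have oD1: "openin (top_of_set ?D) D1" unfolding D1_def
      by (intro openin_Int continuous_openin_preimage_gen co C(2)
            continuous_openin_preimage[OF co(2) im(1) N(1)] continuous_openin_preimage[OF co(3) im(2) u(2)])
    have D1D: "D1 \<subseteq> ?D" by (auto simp: D1_def)
    have D1: "?z v \<in> C" "?w v \<in> C" "?x v \<in> N" "?e v \<in> u" if "v \<in> D1" for v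
      using that by (simp_all add: D1_def)
    have cs: "continuous_on D1 (\<lambda>v. s (?z v, ?x v))"
      by (intro continuous_on_compose2[OF s(1)] continuous_intros) (use D1 in auto)
    have cs': "continuous_on D1 (\<lambda>v. s (?w v, ?x v))"
      by (intro continuous_on_compose2[OF s(1)] continuous_intros) (use D1 in auto)
    have sE: "(\<lambda>v. s (?z v, ?x v)) \<in> D1 \<rightarrow> E"
    proof
      fix v assume "v \<in> D1"
      then have "(?z v, ?x v) \<in> C \<times> N" using D1 by blast
      then show "s (?z v, ?x v) \<in> E" using s(2) by blast
    qed
    \<comment> \<open>On \<open>D2\<close> the points \<open>e\<close> and \<open>s (z, x)\<close> have the same image and lie in the same sheet, so they are equal.\<close>
    define D2 where "D2 = D1 \<inter> (\<lambda>v. s (?z v, ?x v)) -` u"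
    have oD2: "openin (top_of_set ?D) D2"
      unfolding D2_def using continuous_openin_preimage[OF cs sE u(2)] oD1 openin_trans by blast
    have "z0 \<in> C" "w0 \<in> C" using C(3) by auto
    then have vD2: "v \<in> D2" using v N(2) u(1) s(4) by (simp add: D2_def D1_def v0)
    have eq: "(\<lambda>(z, x, e, w). L z x e w) v = s (?w v, ?x v)" if vv: "v \<in> D2" for v
    proof -
      obtain z x e w where v': "v = (z, x, e, w)" by (metis prod.collapse)
      have D: "z \<in> V" "x \<in> Fib" "e \<in> E" "p e = \<Phi> (z, x)" "w \<in> V"
        using vv D1D unfolding D2_def v' by auto
      have m: "z \<in> C" "w \<in> C" "x \<in> N" "e \<in> u" "s (z, x) \<in> u"
        using vv D1[of v] unfolding D2_def v' by auto
      have "p (s (z, x)) = p e" using s(3) m D by auto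
      then have "s (z, x) = e" using homeomorphism_apply1[OF q] m by metis
      have "L z x e w = s (w, x)"
      proof (rule covering_space_lifts_agree[OF cov, of C "L z x e" "\<lambda>w. s (w, x)" z])
        show "connected C" using C by (simp add: convex_connected)
        show "continuous_on C (L z x e)" using L[OF D(1-4)] C(4) continuous_on_subset by blast
        show "L z x e \<in> C \<rightarrow> E" using L[OF D(1-4)] C(4) by blast
        show "continuous_on C (\<lambda>w. s (w, x))"
          using m by (intro continuous_on_compose2[OF s(1)] continuous_intros) auto
        show "(\<lambda>w. s (w, x)) \<in> C \<rightarrow> E" using s(2) m(3) by auto
        show "p (L z x e w) = p (s (w, x))" if "w \<in> C" for w
          using that L[OF D(1-4)] C(4) s(3) m(3) by auto
        show "z \<in> C" "w \<in> C" by fact+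
        show "L z x e z = s (z, x)" using L[OF D(1-4)] \<open>s (z, x) = e\<close> by simp
      qed
      then show ?thesis by (simp add: v')
    qed
    have "continuous_on D2 (\<lambda>v. s (?w v, ?x v))"
      using cs' by (rule continuous_on_subset) (auto simp: D2_def)
    then have "continuous_on D2 (\<lambda>(z, x, e, w). L z x e w)"
      by (rule continuous_on_eq) (simp add: eq)
    then show "\<exists>U. openin (top_of_set ?D) U \<and> v \<in> U \<and> continuous_on U (\<lambda>(z, x, e, w). L z x e w)"
      using oD2 vD2 by blast
  qed
  then show ?thesis using L by (intro that[of L]) blast+
qed

section \<open>Polynomial fibrations of affine space\<close>

text \<open>
  Of a polynomial only its continuity and its behaviour on complex lines matter; the fibre over
  \<open>0\<close> plays the part of the hypersurface.
\<close>

locale affine_fibration =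
  fixes f :: "complex ^ 'n \<Rightarrow> complex" and B :: "complex set"
  assumes cont: "continuous_on UNIV f"
    and polynomial_on_lines: "\<And>y v. \<exists>p. \<forall>s. f (y + s *s v) = poly p s"
    and nonconst: "\<exists>y z. f y \<noteq> f z"
    and finite_B: "finite B" and zero_notin_B: "0 \<notin> B"
    and triv: "\<And>c. c \<notin> B \<Longrightarrow> \<exists>W (Fib :: (complex ^ 'n) set) h k. c \<in> W \<and> open W \<and>
                 homeomorphism (f -` W) (W \<times> Fib) h k \<and> (\<forall>x\<in>f -` W. fst (h x) = f x)"
    and zero_fibre_connected: "connected (f -` {0})"
begin

lemma cont_on: "continuous_on S f"
  using cont continuous_on_subset by blast

lemma open_preimage: "open W \<Longrightarrow> open (f -` W)"
  using cont open_vimage by blast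

lemma line_poly:
  assumes "f y \<noteq> f z"
  obtains p where "\<And>s. f (y + s *s (z - y)) = poly p s" "\<And>a. [:a:] \<noteq> p"
proof -
  obtain p where p: "\<forall>s. f (y + s *s (z - y)) = poly p s" using polynomial_on_lines by blast
  have "poly p 0 = f y" using p[rule_format, of 0] by simp
  moreover have "poly p 1 = f z" using p[rule_format, of 1] by simp
  ultimately have "[:a:] \<noteq> p" for a using assms by auto
  then show ?thesis using p that by blast
qed

lemma finite_line:
  assumes "f y \<notin> A" "finite A"
  shows "finite {s. f (y + s *s v) \<in> A}"
proof -
  obtain p where p: "\<And>s. f (y + s *s v) = poly p s" using polynomial_on_lines by blast
  have "finite {s. poly p s = a}" if "a \<in> A" for a
  proof -
    have "poly p 0 = f y" using p[of 0] by simp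
    then have "poly (p - [:a:]) 0 \<noteq> 0" using that assms(1) by auto
    then have "p - [:a:] \<noteq> 0" by force
    moreover have "{s. poly p s = a} = {s. poly (p - [:a:]) s = 0}" by auto
    ultimately show ?thesis using poly_roots_finite by metis
  qed
  moreover have "{s. f (y + s *s v) \<in> A} = (\<Union>a\<in>A. {s. poly p s = a})" using p by auto
  ultimately show ?thesis using assms(2) by simp
qed

lemma continuous_line: "continuous_on S (\<lambda>s. y + s *s (v :: complex ^ 'n))"
proof -
  have "(\<lambda>s. y + s *s v) = (\<lambda>s. \<chi> i. y $ i + s * v $ i)" by (auto simp: vec_eq_iff)
  moreover have "continuous_on S (\<lambda>s. \<chi> i. y $ i + s * v $ i)"
    by (intro continuous_intros)
  ultimately show ?thesis by metis
qed

lemma surjective: "\<exists>y. f y = c"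
proof -
  obtain y z where yz: "f y \<noteq> f z" using nonconst by blast
  obtain p where p: "\<And>s. f (y + s *s (z - y)) = poly p s" "\<And>a. [:a:] \<noteq> p"
    using line_poly[OF yz] by blast
  let ?q = "p - [:c:]"
  have "degree ?q \<noteq> 0"
  proof
    assume "degree ?q = 0"
    then obtain a where "?q = [:a:]" using degree_eq_zeroE by blast
    then have "p = [:a + c:]" by (metis add.right_neutral add_pCons diff_add_cancel)
    then show False using p(2) by blast
  qed
  then have "degree ?q \<in> {1..degree ?q}" "coeff ?q (degree ?q) \<noteq> 0"
    by (simp, metis degree_0 leading_coeff_0_iff)
  then obtain s where "(\<Sum>i\<le>degree ?q. coeff ?q i * s ^ i) = 0"
    using fundamental_theorem_of_algebra[of "coeff ?q" "degree ?q"] by blast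
  then have "poly ?q s = 0" by (simp add: poly_altdef)
  then show ?thesis using p(1)[of s] by (intro exI[of _ "y + s *s (z - y)"]) simp
qed

text \<open>
  Two points off the fibres over \<open>A\<close> are joined inside a complex line, which meets
  these fibres in finitely many points; a convex open subset of the line minus a finite set
  is connected.
\<close>

lemma thin:
  assumes A: "finite A" and U: "convex U" "open U" "U \<noteq> {}"
  shows "connected (U - f -` A) \<and> U - f -` A \<noteq> {}"
proof
  have line_conv: "convex {s. y + s *s v \<in> U}" "open {s. y + s *s v \<in> U}" for y v
  proof -
    show "convex {s. y + s *s v \<in> U}"
    proof (rule convexI)
      fix a b :: complex and u w :: real
      assume ab: "a \<in> {s. y + s *s v \<in> U}" "b \<in> {s. y + s *s v \<in> U}" and uw: "0 \<le> u" "0 \<le> w" "u + w = 1"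
      have w: "w = 1 - u" using uw(3) by simp
      have "y + (u *\<^sub>R a + w *\<^sub>R b) *s v = u *\<^sub>R (y + a *s v) + w *\<^sub>R (y + b *s v)"
        unfolding w by (simp add: vec_eq_iff scaleR_conv_of_real[where 'a=complex] algebra_simps)
      then show "u *\<^sub>R a + w *\<^sub>R b \<in> {s. y + s *s v \<in> U}"
        using U(1) ab uw by (simp add: convex_def)
    qed
    have "open ((\<lambda>s. y + s *s v) -` U)" using open_vimage[OF U(2) continuous_line[of UNIV]] by blast
    then show "open {s. y + s *s v \<in> U}" by (simp add: vimage_def)
  qed
  show "connected (U - f -` A)"
  proof (rule connected_iff_connected_component[THEN iffD2], intro ballI)
    fix y z assume yz: "y \<in> U - f -` A" "z \<in> U - f -` A"
    let ?S = "{s. y + s *s (z - y) \<in> U}"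
    let ?K = "{s. f (y + s *s (z - y)) \<in> A}"
    have "connected (?S - ?K)"
      using line_conv[of y "z - y"] finite_line[of y A "z - y"] yz A
      by (intro connected_open_delete_finite convex_connected) (simp_all only: Diff_iff vimage_eq DIM_complex not_False_eq_True)
    then have "connected ((\<lambda>s. y + s *s (z - y)) ` (?S - ?K))"
      using continuous_line connected_continuous_image by blast
    moreover have "(\<lambda>s. y + s *s (z - y)) ` (?S - ?K) \<subseteq> U - f -` A" by auto
    moreover have "y \<in> (\<lambda>s. y + s *s (z - y)) ` (?S - ?K)" "z \<in> (\<lambda>s. y + s *s (z - y)) ` (?S - ?K)"
      using yz by (auto intro: image_eqI[of _ _ 0] image_eqI[of _ _ 1])
    ultimately show "connected_component (U - f -` A) y z" unfolding connected_component_def by blast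
  qed
  show "U - f -` A \<noteq> {}"
  proof -
    obtain u where u: "u \<in> U" using U(3) by blast
    obtain c where c: "c \<notin> A" using ex_new_if_finite[OF infinite_UNIV_char_0 A] by blast
    obtain z where z: "f z = c" using surjective by blast
    let ?S = "{s. z + s *s (u - z) \<in> U}"
    have "1 \<in> ?S" using u by simp
    then have "infinite ?S" using line_conv(2)[of z "u - z"] finite_imp_not_open by blast
    moreover have "finite {s. f (z + s *s (u - z)) \<in> A}" using finite_line[of z A] z c A by blast
    ultimately have "infinite (?S - {s. f (z + s *s (u - z)) \<in> A})" by simp
    then have "?S - {s. f (z + s *s (u - z)) \<in> A} \<noteq> {}" by (metis finite.emptyI)
    then show ?thesis by blast
  qed
qed

text \<open>
  A local trivialization over \<open>W\<close>, given by the model fibre coordinate \<open>\<xi>\<close> of the homeomorphism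
  with the product and by its inverse \<open>k\<close>; the base coordinate is \<open>f\<close> itself.
\<close>

definition product_chart ::
    "complex set \<Rightarrow> (complex ^ 'n) set \<Rightarrow> (complex ^ 'n \<Rightarrow> complex ^ 'n) \<Rightarrow>
     (complex \<times> (complex ^ 'n) \<Rightarrow> complex ^ 'n) \<Rightarrow> bool" where
  "product_chart W Fib \<xi> k \<longleftrightarrow> open W \<and> continuous_on (f -` W) \<xi> \<and> continuous_on (W \<times> Fib) k \<and>
     (\<forall>y\<in>f -` W. \<xi> y \<in> Fib \<and> k (f y, \<xi> y) = y) \<and> (\<forall>c\<in>W. \<forall>x\<in>Fib. f (k (c, x)) = c \<and> \<xi> (k (c, x)) = x)"

lemma product_chartD:
  assumes "product_chart W Fib \<xi> k"
  shows "open W" "continuous_on (f -` W) \<xi>" "continuous_on (W \<times> Fib) k"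
    "\<And>y. f y \<in> W \<Longrightarrow> \<xi> y \<in> Fib" "\<And>y. f y \<in> W \<Longrightarrow> k (f y, \<xi> y) = y"
    "\<And>c x. \<lbrakk>c \<in> W; x \<in> Fib\<rbrakk> \<Longrightarrow> f (k (c, x)) = c" "\<And>c x. \<lbrakk>c \<in> W; x \<in> Fib\<rbrakk> \<Longrightarrow> \<xi> (k (c, x)) = x"
  using assms by (simp_all add: product_chart_def)

lemma product_chart_exists:
  assumes "c \<notin> B"
  obtains W Fib \<xi> k where "c \<in> W" "product_chart W Fib \<xi> k"
proof -
  obtain W and Fib :: "(complex ^ 'n) set" and h k where W: "c \<in> W" "open W"
    "homeomorphism (f -` W) (W \<times> Fib) h k" "\<forall>x\<in>f -` W. fst (h x) = f x"
    using triv[OF assms] by blast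
  have hF: "h y \<in> W \<times> Fib" "k (h y) = y" "h y = (f y, snd (h y))" if "f y \<in> W" for y
    using that homeomorphism_image1[OF W(3)] homeomorphism_apply1[OF W(3), of y] W(4)
    by (auto simp: prod_eq_iff)
  have k: "k (c', x) \<in> f -` W" "h (k (c', x)) = (c', x)" if "c' \<in> W" "x \<in> Fib" for c' x
    using that homeomorphism_image2[OF W(3)] homeomorphism_apply2[OF W(3)] by blast+
  have "continuous_on (f -` W) (snd \<circ> h)"
    by (intro continuous_on_compose continuous_intros homeomorphism_cont1[OF W(3)])
  moreover have "(snd \<circ> h) y \<in> Fib" "k (f y, (snd \<circ> h) y) = y" if "f y \<in> W" for y
    using hF[OF that] by (metis comp_apply mem_Sigma_iff)+
  moreover have "f (k (c, x)) = c" "(snd \<circ> h) (k (c, x)) = x" if "c \<in> W" "x \<in> Fib" for c x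
    using k[OF that] W(4) by (auto dest: bspec)
  ultimately have "product_chart W Fib (snd \<circ> h) k"
    using W(2) homeomorphism_cont2[OF W(3)] by (simp add: product_chart_def)
  then show ?thesis using that W(1) by blast
qed

text \<open>
  Connectedness of the fibres is locally constant on the connected complement of \<open>B\<close>, and it holds
  over \<open>0\<close>.
\<close>

lemma fibre_connected:
  assumes "c \<notin> B"
  shows "connected (f -` {c})"
proof (rule connected_induction_simple[of "- B" 0 c])
  show "connected (- B)"
    using connected_open_delete_finite[of "UNIV::complex set" B] finite_B by (simp add: Compl_eq_Diff_UNIV connected_UNIV)
  fix c assume "c \<in> - B"
  then have "c \<notin> B" by simp
  then obtain W Fib \<xi> k where W: "c \<in> W" and chart: "product_chart W Fib \<xi> k"
    using product_chart_exists by metis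
  note h = product_chartD[OF chart]
  have fib: "connected (f -` {c'}) \<longleftrightarrow> connected Fib" if c': "c' \<in> W" for c'
  proof
    assume *: "connected (f -` {c'})"
    have "\<xi> ` (f -` {c'}) = Fib" 
    proof
      show "Fib \<subseteq> \<xi> ` (f -` {c'})"
      proof
        fix x assume "x \<in> Fib"
        then show "x \<in> \<xi> ` (f -` {c'})"
          using h(6,7)[OF c', of x] by (intro image_eqI[of _ _ "k (c', x)"]) auto
      qed
    qed (use h(4) c' in auto)
    moreover have "continuous_on (f -` {c'}) \<xi>" using c' by (intro continuous_on_subset[OF h(2)]) auto
    ultimately show "connected Fib" using connected_continuous_image[OF _ *] by metis
  next
    assume *: "connected Fib"
    have "(\<lambda>x. k (c', x)) ` Fib = f -` {c'}"
    proof
      show "f -` {c'} \<subseteq> (\<lambda>x. k (c', x)) ` Fib"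
      proof
        fix y assume "y \<in> f -` {c'}"
        then show "y \<in> (\<lambda>x. k (c', x)) ` Fib"
          using h(4,5)[of y] c' by (intro image_eqI[of _ _ "\<xi> y"]) auto
      qed
    qed (use h(6)[OF c'] in auto)
    moreover have "continuous_on Fib (\<lambda>x. k (c', x))"
      using c' by (intro continuous_on_compose2[OF h(3)] continuous_intros) auto
    ultimately show "connected (f -` {c'})" using connected_continuous_image[OF _ *] by metis
  qed
  show "\<exists>T. openin (top_of_set (- B)) T \<and> c \<in> T \<and> (\<forall>x\<in>T. \<forall>y\<in>T. connected (f -` {x}) \<longrightarrow> connected (f -` {y}))"
    using fib W \<open>c \<in> - B\<close> h(1) by (intro exI[of _ "- B \<inter> W"]) (simp add: openin_open_Int)
qed (use assms zero_notin_B zero_fibre_connected in auto)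

text \<open>
  Away from \<open>B\<close> a splitting of the preimage would induce a splitting of the base, since each
  fibre is connected.  The fibres over \<open>B\<close> have dense complement.
\<close>

lemma preimage_connected:
  assumes W': "open W'" "connected W'"
  shows "connected (f -` W')"
proof -
  have reg: "connected (f -` W)" if W: "open W" "connected W" "W \<inter> B = {}" for W
  proof (rule connectedI)
    fix A C assume A: "open A" "A \<inter> f -` W \<noteq> {}" and C: "open C" "C \<inter> f -` W \<noteq> {}"
      and dis: "A \<inter> C \<inter> f -` W = {}" and sub: "f -` W \<subseteq> A \<union> C"
    have dich: "f -` {c} \<inter> A = {} \<or> f -` {c} \<inter> C = {}" if "c \<in> W" for c
    proof -
      have fc: "connected (f -` {c})" using fibre_connected W(3) that by blast
      have "A \<inter> C \<inter> f -` {c} = {}" "f -` {c} \<subseteq> A \<union> C" using dis sub that by blast+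
      then show ?thesis using connectedD[OF fc A(1) C(1)] by blast
    qed
    \<comment> \<open>A point of a fibre can be moved to the nearby fibres, so locally all fibres lie on the same side.\<close>
    have op: "\<exists>T. openin (top_of_set W) T \<and> c \<in> T \<and> (\<forall>x\<in>T. f -` {x} \<inter> A' \<noteq> {})"
      if c: "c \<in> W" and A': "open A'" "f -` {c} \<inter> A' \<noteq> {}" for c A'
    proof -
      have "c \<notin> B" using c W(3) by blast
      then obtain V Fib \<xi> k where V: "c \<in> V" and chart: "product_chart V Fib \<xi> k"
        using product_chart_exists by metis
      note h = product_chartD[OF chart]
      obtain y where y: "f y = c" "y \<in> A'" using A'(2) by blast
      then have x: "\<xi> y \<in> Fib" "k (c, \<xi> y) = y" using h(4,5) V by auto
      have "continuous_on V (\<lambda>c'. k (c', \<xi> y))"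
        using x by (intro continuous_on_compose2[OF h(3)] continuous_intros) auto
      then have "open (V \<inter> (\<lambda>c'. k (c', \<xi> y)) -` A')" using h(1) A'(1) by (simp add: continuous_open_preimage)
      then have "openin (top_of_set W) (W \<inter> (V \<inter> (\<lambda>c'. k (c', \<xi> y)) -` A'))" by (rule openin_open_Int)
      moreover have "c \<in> W \<inter> (V \<inter> (\<lambda>c'. k (c', \<xi> y)) -` A')" using c V x(2) y(2) by simp
      moreover have "f -` {v} \<inter> A' \<noteq> {}" if v: "v \<in> W \<inter> (V \<inter> (\<lambda>c'. k (c', \<xi> y)) -` A')" for v
      proof -
        have "k (v, \<xi> y) \<in> f -` {v} \<inter> A'" using v h(6)[of v "\<xi> y"] x(1) by simp
        then show ?thesis by blast
      qed
      ultimately show ?thesis by blast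
    qed
    obtain a where a: "a \<in> A" "f a \<in> W" using A(2) by blast
    obtain z where z: "z \<in> C" "f z \<in> W" using C(2) by blast
    have "f -` {f z} \<inter> A \<noteq> {}"
    proof (rule connected_induction_simple[OF W(2) a(2) z(2), of "\<lambda>c. f -` {c} \<inter> A \<noteq> {}"])
      show "\<exists>T. openin (top_of_set W) T \<and> c \<in> T \<and> (\<forall>x\<in>T. \<forall>y\<in>T. f -` {x} \<inter> A \<noteq> {} \<longrightarrow> f -` {y} \<inter> A \<noteq> {})"
        if c: "c \<in> W" for c
      proof (cases "f -` {c} \<inter> A = {}")
        case True
        obtain y where "f y = c" using surjective by blast
        then have "f -` {c} \<inter> C \<noteq> {}" using True sub c by blast
        then obtain T where T: "openin (top_of_set W) T" "c \<in> T" "\<forall>x\<in>T. f -` {x} \<inter> C \<noteq> {}"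
          using op[OF c C(1)] by blast
        then have "T \<subseteq> W" using openin_imp_subset by blast
        then have "f -` {x} \<inter> A = {}" if "x \<in> T" for x using dich[of x] T(3) that by blast
        then show ?thesis using T(1,2) by (intro exI[of _ T] conjI ballI impI) simp_all
      qed (use op[OF c A(1)] in blast)
    qed (use a in auto)
    then show False using dich[OF z(2)] z(1) by blast
  qed
  have "open (W' - B)" using W'(1) finite_B by (simp add: finite_imp_closed open_Diff)
  moreover have "connected (W' - B)" using W' finite_B by (intro connected_open_delete_finite) auto
  ultimately have "connected (f -` (W' - B))" using reg by blast
  then show ?thesis
  proof (rule connected_intermediate_closure)
    show "f -` W' \<subseteq> closure (f -` (W' - B))"
    proof
      fix y assume y: "y \<in> f -` W'"
      show "y \<in> closure (f -` (W' - B))"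
        unfolding closure_iff_nhds_not_empty
      proof (intro allI impI)
        fix A V assume AV: "V \<subseteq> A" "open V" "y \<in> V"
        have "open (V \<inter> f -` W')" using AV(2) open_preimage[OF W'(1)] by blast
        then obtain r where "r > 0" "ball y r \<subseteq> V \<inter> f -` W'"
          using AV(3) y open_contains_ball by (metis IntI)
        then have "ball y r - f -` B \<noteq> {}" using thin[OF finite_B, of "ball y r"] by auto
        then show "f -` (W' - B) \<inter> A \<noteq> {}" using \<open>ball y r \<subseteq> V \<inter> f -` W'\<close> AV(1) by blast
      qed
    qed
  qed auto
qed

text \<open>
  Local \<open>k\<close>-th roots of \<open>f - b\<close> glue to a global one, \<open>G\<close>, because affine space is simply
  connected.  On the connected fibre over a general \<open>c\<close> the continuous function \<open>G\<close> has finitely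
  many possible values, hence takes only one of the \<open>k\<close> roots of \<open>c - b\<close>, and omits another one,
  \<open>u1\<close>, everywhere.  On a complex line where \<open>f\<close> is not constant, \<open>G\<close> is entire and tends to
  infinity, so \<open>1 / (G - u1)\<close> contradicts Liouville's theorem.
\<close>

lemma no_local_roots:
  fixes k :: nat
  assumes k: "k \<ge> 2"
    and loc: "\<And>q. f q = b \<Longrightarrow> \<exists>\<rho>>0. \<exists>u. continuous_on (ball q \<rho> - f -` {b}) u \<and>
                (\<forall>w\<in>ball q \<rho> - f -` {b}. u w ^ k = f w - b)"
  shows False
proof -
  have k0: "k > 0" using k by simp
  have cov: "covering_space (- {0}) (\<lambda>z::complex. z ^ k) (- {0})"
    using covering_space_power_punctured_plane k0 by blast
  let ?Z = "f -` {b}"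
  obtain y0 where y0: "f y0 \<noteq> b" using nonconst by metis
  have "f y0 - b \<in> (\<lambda>z. z ^ k) ` (- {0})" using covering_space_imp_surjective[OF cov] y0 by simp
  then obtain e0 where "f y0 - b = e0 ^ k" "e0 \<in> - {0}" by (rule imageE)
  then have e0: "e0 \<noteq> 0" "e0 ^ k = f y0 - b" by simp_all
  have "\<exists>s. continuous_on (UNIV - ?Z) s \<and> s \<in> (UNIV - ?Z) \<rightarrow> - {0} \<and> (\<forall>w\<in>UNIV - ?Z. s w ^ k = f w - b) \<and> s y0 = e0"
  proof (rule lift_across_thin_set[OF cov])
    show "connected (U - ?Z) \<and> U - ?Z \<noteq> {}" if "convex U" "open U" "U \<noteq> {}" for U
      using thin[of "{b}" U] that by simp
    show "continuous_on (UNIV - ?Z) (\<lambda>w. f w - b)" by (intro continuous_intros cont_on)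
    show "(\<lambda>w. f w - b) \<in> UNIV - ?Z \<rightarrow> - {0}" by auto
    fix q assume "q \<in> UNIV \<inter> ?Z"
    then obtain \<rho> u where u: "\<rho> > 0" "continuous_on (ball q \<rho> - ?Z) u"
      "\<forall>w\<in>ball q \<rho> - ?Z. u w ^ k = f w - b" using loc[of q] by auto
    have u0: "u w \<noteq> 0" if "w \<in> ball q \<rho> - ?Z" for w
    proof
      assume "u w = 0"
      then have "f w - b = 0" using u(3) that k0 by (metis power_0_left less_irrefl)
      then show False using that by simp
    qed
    have "\<exists>s. continuous_on (ball q \<rho> - ?Z) s \<and> s \<in> ball q \<rho> - ?Z \<rightarrow> - {0} \<and>
            (\<forall>w\<in>ball q \<rho> - ?Z. s w ^ k = f w - b) \<and> s y = e"
      if y: "y \<in> ball q \<rho> - ?Z" and e: "e \<in> - {0}" "e ^ k = f y - b" for y e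
    proof (intro exI[of _ "\<lambda>w. u w * (e / u y)"] conjI ballI)
      show "continuous_on (ball q \<rho> - ?Z) (\<lambda>w. u w * (e / u y))" by (intro continuous_intros u(2))
      show "(\<lambda>w. u w * (e / u y)) \<in> ball q \<rho> - ?Z \<rightarrow> - {0}" using u0 e y by auto
      show "u y * (e / u y) = e" using u0[OF y] by simp
      fix w assume w: "w \<in> ball q \<rho> - ?Z"
      have "u y ^ k = f y - b" "f y - b \<noteq> 0" using u(3) y by auto
      then show "(u w * (e / u y)) ^ k = f w - b" using u(3) w e(2)
        by (simp add: power_mult_distrib power_divide)
    qed
    then show "\<exists>\<rho>>0. ball q \<rho> \<subseteq> UNIV \<and> (\<forall>y\<in>ball q \<rho> - ?Z. \<forall>e\<in>- {0}. e ^ k = f y - b \<longrightarrow>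
       (\<exists>s. continuous_on (ball q \<rho> - ?Z) s \<and> s \<in> ball q \<rho> - ?Z \<rightarrow> - {0} \<and>
            (\<forall>w\<in>ball q \<rho> - ?Z. s w ^ k = f w - b) \<and> s y = e))"
      using u(1) by (intro exI[of _ \<rho>]) auto
  qed (use y0 e0 in auto)
  then obtain g where g: "continuous_on (UNIV - ?Z) g" "\<And>w. f w \<noteq> b \<Longrightarrow> g w \<noteq> 0"
    "\<And>w. f w \<noteq> b \<Longrightarrow> g w ^ k = f w - b" by fastforce
  \<comment> \<open>The root is continued by \<open>0\<close>, continuously because its norm is a root of \<open>norm (f w - b)\<close>.\<close>
  define G where "G w = (if f w = b then 0 else g w)" for w
  have Gk: "G w ^ k = f w - b" for w using g(3) k0 by (simp add: G_def)
  have contG: "continuous_on UNIV G"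
    unfolding continuous_on_eq_continuous_at[OF open_UNIV]
  proof
    fix w
    show "isCont G w"
    proof (cases "f w = b")
      case True
      have nG: "norm (G v) = root k (norm (f v - b))" for v
        unfolding Gk[symmetric] norm_power using k0 by (simp add: real_root_power_cancel)
      have "isCont f w" using cont by (simp add: continuous_on_eq_continuous_at)
      then have "((\<lambda>v. root k (norm (f v - b))) \<longlongrightarrow> root k (norm (f w - b))) (at w)"
        unfolding isCont_def by (intro tendsto_intros)
      then have "((\<lambda>v. norm (G v)) \<longlongrightarrow> 0) (at w)" unfolding nG using True by simp
      then have "(G \<longlongrightarrow> 0) (at w)" by (rule tendsto_norm_zero_cancel)
      moreover have "G w = 0" using True by (simp add: G_def)
      ultimately show ?thesis unfolding isCont_def by simp
    next
      case False
      have oZ: "open (UNIV - ?Z)"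
        using open_preimage[of "-{b}"] by (simp add: vimage_Compl Compl_eq_Diff_UNIV vimage_Diff open_delete)
      have "continuous_on (UNIV - ?Z) G"
        by (rule continuous_on_eq[OF g(1)]) (auto simp: G_def)
      then show ?thesis using oZ False by (simp add: continuous_on_eq_continuous_at)
    qed
  qed
  obtain c where c: "c \<notin> insert b B" using ex_new_if_finite[OF infinite_UNIV_char_0, of "insert b B"] finite_B by blast
  have "G ` (f -` {c}) \<subseteq> {u. u ^ k = c - b}" using Gk by auto
  moreover have "finite {u::complex. u ^ k = c - b}" 
    using finite_nth_roots[of k "c - b"] k0 by simp
  ultimately have "finite (G ` (f -` {c}))" using finite_subset by blast
  then have "G constant_on (f -` {c})"
    using c by (intro continuous_finite_range_constant fibre_connected continuous_on_subset[OF contG]) auto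
  then obtain u0 where u0: "\<And>w. f w = c \<Longrightarrow> G w = u0" unfolding constant_on_def by auto
  obtain w0 where w0: "f w0 = c" using surjective by blast
  have u0k: "u0 ^ k = c - b" using Gk[of w0] u0[OF w0] w0 by simp
  have u00: "u0 \<noteq> 0"
  proof
    assume "u0 = 0"
    then have "c - b = 0" using u0k k0 by (metis power_0_left less_irrefl)
    then show False using c by simp
  qed
  define \<zeta> where "\<zeta> = cis (2 * pi / k)"
  have \<zeta>k: "\<zeta> ^ k = 1" unfolding \<zeta>_def Complex.DeMoivre using k0 by simp
  have \<zeta>1: "\<zeta> \<noteq> 1"
  proof
    assume "\<zeta> = 1"
    then have "exp (\<i> * of_real (2 * pi / k)) = 1" by (simp add: \<zeta>_def cis_conv_exp)
    then obtain n :: int where "2 * pi / k = of_int (2 * n) * pi" unfolding exp_eq_1 by auto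
    then have "2 * pi * 1 = 2 * pi * (of_int n * real k)" using k0 by (simp add: field_simps)
    then have "1 = of_int n * real k" by (metis mult_cancel_left pi_neq_zero zero_neq_numeral mult_eq_0_iff)
    then have "1 = n * int k" by (metis of_int_1 of_int_eq_iff of_int_mult of_int_of_nat_eq)
    then have "int k dvd 1" by (metis dvd_triv_right)
    then show False using k by simp
  qed
  define u1 where "u1 = u0 * \<zeta>"
  have u1: "u1 ^ k = c - b" "u1 \<noteq> u0" using u0k u00 \<zeta>k \<zeta>1 by (auto simp: u1_def power_mult_distrib)
  have Gu1: "G w \<noteq> u1" for w
  proof
    assume "G w = u1"
    then have "f w = c" using Gk[of w] u1(1) by simp
    then show False using u0 u1(2) \<open>G w = u1\<close> by simp
  qed
  obtain z where z: "f y0 \<noteq> f z" using nonconst by metis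
  obtain p where p: "\<And>s. f (y0 + s *s (z - y0)) = poly p s" "\<And>a. [:a:] \<noteq> p"
    using line_poly[OF z] by blast
  let ?\<gamma> = "\<lambda>s. y0 + s *s (z - y0)"
  define H where "H s = G (?\<gamma> s)" for s
  have Hk: "H s ^ k = poly p s - b" for s using Gk p by (simp add: H_def)
  have contH: "continuous_on UNIV H" unfolding H_def
    by (rule continuous_on_compose2[OF contG continuous_line]) auto
  have finK: "finite {s. f (?\<gamma> s) \<in> {b}}" using y0 by (intro finite_line) auto
  have holH: "H holomorphic_on UNIV"
  proof (rule no_isolated_singularity[OF contH _ open_UNIV finK])
    show "H holomorphic_on UNIV - {s. f (?\<gamma> s) \<in> {b}}"
    proof (rule covering_space_lift_is_holomorphic[OF cov])
      show "(\<lambda>s. poly p s - b) holomorphic_on UNIV - {s. f (?\<gamma> s) \<in> {b}}"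
        by (intro holomorphic_intros)
      show "(\<lambda>s. poly p s - b) \<in> UNIV - {s. f (?\<gamma> s) \<in> {b}} \<rightarrow> - {0}" using p by auto
      show "H \<in> UNIV - {s. f (?\<gamma> s) \<in> {b}} \<rightarrow> - {0}" using g(2) by (auto simp: H_def G_def)
      show "continuous_on (UNIV - {s. f (?\<gamma> s) \<in> {b}}) H" using contH continuous_on_subset by blast
    qed (use Hk in \<open>auto intro!: holomorphic_intros\<close>)
  qed
  have Hinf: "filterlim H at_infinity at_infinity"
  proof -
    have "degree (p - [:b:]) > 0"
    proof (rule ccontr)
      assume "\<not> degree (p - [:b:]) > 0"
      then obtain a where "p - [:b:] = [:a:]" using degree_eq_zeroE by blast
      then have "p = [:a + b:]" by (metis add.right_neutral add_pCons diff_add_cancel)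
      then show False using p(2) by blast
    qed
    then have "filterlim (poly (p - [:b:])) at_infinity at_infinity" by (rule filterlim_poly_at_infinity)
    moreover have "poly (p - [:b:]) = (\<lambda>s. H s ^ k)" using Hk by (simp add: fun_eq_iff)
    ultimately have "filterlim (\<lambda>s. H s ^ k) at_infinity at_infinity" by simp
    then have "filterlim (\<lambda>s. norm (H s) ^ k) at_top at_infinity"
      unfolding filterlim_at_infinity_conv_norm_at_top norm_power .
    then have "\<forall>\<^sub>F s in at_infinity. max Z 0 ^ k \<le> norm (H s) ^ k" for Z
      unfolding filterlim_at_top by blast
    then have "\<forall>\<^sub>F s in at_infinity. max Z 0 \<le> norm (H s)" for Z
      using k0 by (simp add: power_mono_iff)
    then have "\<forall>\<^sub>F s in at_infinity. Z \<le> norm (H s)" for Z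
      by (rule eventually_mono[of _ _ "\<lambda>s. Z \<le> norm (H s)"]) auto
    then have "filterlim (\<lambda>s. norm (H s)) at_top at_infinity"
      unfolding filterlim_at_top by blast
    then show ?thesis unfolding filterlim_at_infinity_conv_norm_at_top .
  qed
  have "((\<lambda>s. inverse (H s - u1)) \<longlongrightarrow> 0) at_infinity"
  proof (rule filterlim_compose[OF tendsto_inverse_0])
    show "filterlim (\<lambda>s. H s - u1) at_infinity at_infinity"
      using tendsto_add_filterlim_at_infinity'[OF Hinf tendsto_const[of "- u1"]] by simp
  qed
  moreover have "(\<lambda>s. inverse (H s - u1)) holomorphic_on UNIV"
    using Gu1 by (intro holomorphic_intros holH) (simp add: H_def)
  ultimately have "inverse (H 0 - u1) = 0" using Liouville_weak by blast
  then show False using Gu1 by (simp add: H_def)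
qed

end

section \<open>Clopen families over a logarithm\<close>

definition period :: "int \<Rightarrow> complex" where "period j = \<i> * (of_int j * (of_real pi * 2))"

lemma exp_add_period: "exp (z + period j) = exp z"
  by (simp add: period_def exp_plus_2pin)

lemma exp_eq_period: "exp w = exp z \<Longrightarrow> \<exists>j. w = z + period j"
  unfolding exp_eq period_def by (auto simp: algebra_simps)

lemma period_add: "period (i + j) = period i + period j"
  by (simp add: period_def algebra_simps)

lemma period_invariant:
  assumes "\<And>j. P (z + period j) \<longleftrightarrow> P (z + period j + period 1)"
  shows "P z \<longleftrightarrow> P (z + period j)"
proof (induction j rule: int_induct[of _ 0])
  case base
  show ?case by (simp add: period_def)
next
  case (step1 i)
  then show ?case using assms[of i] by (simp add: period_add add.assoc)
next
  case (step2 i)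
  have *: "z + period (i - 1) + period 1 = z + period i" using period_add[of "i - 1" 1] by (simp add: add.assoc)
  show ?case using assms[of "i - 1"] step2(2) unfolding * by simp
qed

lemma Re_period: "Re (period j) = 0"
  by (simp add: period_def)

locale covered_fibration = affine_fibration f B
  for f :: "complex ^ 'n \<Rightarrow> complex" and B +
  fixes E :: "'a::topological_space set" and F :: "'a \<Rightarrow> complex ^ 'n"
  assumes cov: "covering_space E F (- (f -` {0}))"
begin

lemma contF: "continuous_on E F"
  using cov covering_space_imp_continuous by blast

lemma cont_fF: "continuous_on E (\<lambda>e. f (F e))"
  using continuous_on_compose2[OF cont contF] by auto

lemma fF_nonzero: "e \<in> E \<Longrightarrow> f (F e) \<noteq> 0"
  using covering_space_imp_surjective[OF cov] by auto

lemma open_base: "open (- (f -` {0}))"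
  using open_preimage[of "-{0}"] by (simp add: vimage_Compl open_Compl)

lemma locally_connected_E: "locally connected E"
  by (rule covering_space_total_locally_connected[OF cov])
     (simp add: open_base open_imp_locally_connected)

text \<open>
  The covering of a part of \<open>E\<close> on which a logarithm \<open>z\<close> of \<open>f \<circ> F - a\<close>, with
  values in \<open>V\<close>, has been chosen.  It is used for \<open>a = 0\<close>, over the complement of the hypersurface,
  and for \<open>a \<in> B\<close>, over a punctured disc around \<open>a\<close>.
\<close>

definition log_cover :: "complex \<Rightarrow> complex set \<Rightarrow> (complex \<times> 'a) set" where
  "log_cover a V = {(z, e). z \<in> V \<and> e \<in> E \<and> f (F e) = a + exp z}"

lemma log_cover_iff: "(z, e) \<in> log_cover a V \<longleftrightarrow> z \<in> V \<and> e \<in> E \<and> f (F e) = a + exp z"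
  by (simp add: log_cover_def)

lemma log_cover_covering_over:
  assumes "a \<notin> W"
  shows "covering_space (log_cover a {z. a + exp z \<in> W}) snd {e \<in> E. f (F e) \<in> W}"
proof -
  let ?Z = "{e \<in> E. f (F e) \<in> W}"
  have "covering_space {(c, z). c \<in> UNIV \<and> z \<in> ?Z \<and> exp c = f (F z) - a} snd ?Z"
  proof (rule covering_space_pullback[OF covering_space_exp_punctured_plane])
    show "continuous_on ?Z (\<lambda>z. f (F z) - a)"
      by (intro continuous_intros continuous_on_subset[OF cont_fF]) auto
  qed (use assms in auto)
  moreover have "{(c, z). c \<in> UNIV \<and> z \<in> ?Z \<and> exp c = f (F z) - a} = log_cover a {z. a + exp z \<in> W}"
    by (auto simp: log_cover_def algebra_simps)
  ultimately show ?thesis by simp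
qed

lemma log_cover_covering: "covering_space (log_cover a UNIV) snd {e \<in> E. f (F e) \<noteq> a}"
  using log_cover_covering_over[of a "-{a}"] by simp

lemma openin_preimage: "openin (top_of_set E) {e \<in> E. f (F e) \<in> W}" if "open W"
  using continuous_openin_preimage_gen[OF cont_fF that] by (simp add: vimage_def Int_def)

lemma locally_connected_log_cover: "locally connected (log_cover a UNIV)"
proof (rule covering_space_total_locally_connected[OF log_cover_covering])
  have "openin (top_of_set E) {e \<in> E. f (F e) \<noteq> a}" using openin_preimage[of "-{a}"] by (simp add: open_Compl)
  then show "locally connected {e \<in> E. f (F e) \<noteq> a}"
    using locally_connected_E locally_open_subset by blast
qed

lemma openin_log_cover: "open V \<Longrightarrow> openin (top_of_set (log_cover a UNIV)) (log_cover a V)"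
proof -
  assume V: "open V"
  have "log_cover a V = log_cover a UNIV \<inter> (V \<times> UNIV)" by (auto simp: log_cover_def)
  then show ?thesis using V by (simp add: openin_open_Int open_Times)
qed

lemma open_image_log_cover:
  assumes "openin (top_of_set (log_cover a UNIV)) Q"
  shows "openin (top_of_set E) (snd ` Q)" "open (F ` snd ` Q)"
proof -
  have "openin (top_of_set {e \<in> E. f (F e) \<noteq> a}) (snd ` Q)"
    by (rule covering_space_image_open[OF log_cover_covering assms])
  moreover have "openin (top_of_set E) {e \<in> E. f (F e) \<noteq> a}" using openin_preimage[of "-{a}"] by (simp add: open_Compl)
  ultimately show *: "openin (top_of_set E) (snd ` Q)" using openin_trans by blast
  show "open (F ` snd ` Q)"
    using covering_space_image_open[OF cov *] open_base openin_open_eq by blast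
qed

text \<open>
  Projecting to affine space is an open map, and the fibres of \<open>f\<close> over \<open>B\<close> contain no open set.
\<close>

lemma log_cover_dense:
  assumes "openin (top_of_set (log_cover a UNIV)) Q" "Q \<noteq> {}"
  obtains z e where "(z, e) \<in> Q" "a + exp z \<notin> B"
proof -
  obtain y where "y \<in> F ` snd ` Q" using assms(2) by blast
  then obtain r where r: "r > 0" "ball y r \<subseteq> F ` snd ` Q"
    using open_image_log_cover(2)[OF assms(1)] open_contains_ball by blast
  then have "ball y r - f -` B \<noteq> {}" using thin[OF finite_B, of "ball y r"] by auto
  then obtain y' where y': "y' \<in> ball y r" "f y' \<notin> B" by blast
  then obtain v where "v \<in> Q" "y' = F (snd v)" using r(2) by blast
  then obtain z e where ze: "(z, e) \<in> Q" "f (F e) \<notin> B" using y'(2) by (metis prod.collapse)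
  moreover have "(z, e) \<in> log_cover a UNIV" using ze(1) openin_imp_subset[OF assms(1)] by blast
  ultimately show ?thesis using that by (auto simp: log_cover_iff)
qed

text \<open>
  Where \<open>f\<close> is a product, a point of the covering can be moved along with the logarithm of
  \<open>f \<circ> F - a\<close> while the model fibre coordinate of its image stays fixed.
\<close>

lemma transport:
  assumes V: "open V" "convex V" and W: "\<And>z. z \<in> V \<Longrightarrow> a + exp z \<in> W" "\<And>z. z \<in> V \<Longrightarrow> a + exp z \<noteq> 0"
    and chart: "product_chart W Fib \<xi> k"
  obtains L where
    "\<And>z e w. \<lbrakk>(z, e) \<in> log_cover a V; w \<in> V\<rbrakk> \<Longrightarrow> (w, L z e w) \<in> log_cover a V"
    "\<And>z e w. \<lbrakk>(z, e) \<in> log_cover a V; w \<in> V\<rbrakk> \<Longrightarrow> F (L z e w) = k (a + exp w, \<xi> (F e))"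
    "\<And>z e. (z, e) \<in> log_cover a V \<Longrightarrow> L z e z = e"
    "continuous_on {(z, e, w). (z, e) \<in> log_cover a V \<and> w \<in> V} (\<lambda>(z, e, w). L z e w)"
proof -
  note \<xi> = product_chartD(2)[OF chart] and k = product_chartD(3)[OF chart] and \<xi>F = product_chartD(4)[OF chart]
    and k\<xi> = product_chartD(5)[OF chart] and fk = product_chartD(6)[OF chart]
  let ?\<Phi> = "\<lambda>(z, x). k (a + exp z, x)"
  have c\<Phi>: "continuous_on (V \<times> Fib) ?\<Phi>"
    unfolding split_beta
    by (intro continuous_on_compose2[OF k] continuous_intros) (use W in auto)
  have \<Phi>Y: "?\<Phi> \<in> V \<times> Fib \<rightarrow> - (f -` {0})" using fk W by fastforce
  obtain M where M:
    "\<And>z x e. \<lbrakk>z \<in> V; x \<in> Fib; e \<in> E; F e = ?\<Phi> (z, x)\<rbrakk> \<Longrightarrow> M z x e z = e"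
    "\<And>z x e w. \<lbrakk>z \<in> V; x \<in> Fib; e \<in> E; F e = ?\<Phi> (z, x); w \<in> V\<rbrakk> \<Longrightarrow> M z x e w \<in> E"
    "\<And>z x e w. \<lbrakk>z \<in> V; x \<in> Fib; e \<in> E; F e = ?\<Phi> (z, x); w \<in> V\<rbrakk> \<Longrightarrow> F (M z x e w) = ?\<Phi> (w, x)"
    "continuous_on {(z, x, e, w). z \<in> V \<and> x \<in> Fib \<and> e \<in> E \<and> F e = ?\<Phi> (z, x) \<and> w \<in> V}
       (\<lambda>(z, x, e, w). M z x e w)"
    by (rule covering_family_lift[OF cov V c\<Phi> \<Phi>Y]) (rule that; assumption)
  have D: "z \<in> V" "\<xi> (F e) \<in> Fib" "e \<in> E" "F e = ?\<Phi> (z, \<xi> (F e))" "f (F e) \<in> W" if "(z, e) \<in> log_cover a V" for z e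
    using that W(1) \<xi>F[of "F e"] k\<xi>[of "F e"] by (auto simp: log_cover_iff)
  show ?thesis
  proof (rule that[of "\<lambda>z e w. M z (\<xi> (F e)) e w"])
    show "M z (\<xi> (F e)) e z = e" if "(z, e) \<in> log_cover a V" for z e
      by (rule M(1)[OF D(1-4)[OF that]])
    show *: "F (M z (\<xi> (F e)) e w) = k (a + exp w, \<xi> (F e))" if "(z, e) \<in> log_cover a V" "w \<in> V" for z e w
      using M(3)[OF D(1-4)[OF that(1)] that(2)] by simp
    show "(w, M z (\<xi> (F e)) e w) \<in> log_cover a V" if "(z, e) \<in> log_cover a V" "w \<in> V" for z e w
      using M(2)[OF D(1-4)[OF that(1)] that(2)] *[OF that] fk[of "a + exp w" "\<xi> (F e)"] W(1)[OF that(2)]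
        D(2)[OF that(1)] that(2) by (simp add: log_cover_iff)
    let ?S = "{(z, e, w). (z, e) \<in> log_cover a V \<and> w \<in> V}"
    have cF: "continuous_on ?S (\<lambda>v. F (fst (snd v)))"
      by (intro continuous_on_compose2[OF contF] continuous_intros) (auto simp: log_cover_iff)
    have c\<xi>: "continuous_on ?S (\<lambda>v. \<xi> (F (fst (snd v))))"
      by (rule continuous_on_compose2[OF \<xi> cF]) (use D(5) in auto)
    have "continuous_on ?S (\<lambda>v. (\<lambda>(z, x, e, w). M z x e w) (fst v, \<xi> (F (fst (snd v))), fst (snd v), snd (snd v)))"
      by (rule continuous_on_compose2[OF M(4)], intro continuous_intros c\<xi>) (use D in auto)
    then show "continuous_on ?S (\<lambda>(z, e, w). M z (\<xi> (F e)) e w)"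
      by (simp add: split_beta)
  qed
qed

definition graph_of_family :: "complex set \<Rightarrow> (complex \<Rightarrow> 'a set) \<Rightarrow> (complex \<times> 'a) set" where
  "graph_of_family U A = {(z, e). z \<in> U \<and> e \<in> A z}"

text \<open>
  A family of subsets of the fibres of \<open>f \<circ> F\<close> whose union is clopen over \<open>U\<close>.  Openness is
  taken relative to the whole space of logarithms, so that families over open sets glue by
  taking unions.
\<close>

definition clopen_family :: "complex \<Rightarrow> complex set \<Rightarrow> (complex \<Rightarrow> 'a set) \<Rightarrow> bool" where
  "clopen_family a U A \<longleftrightarrow> graph_of_family U A \<subseteq> log_cover a U \<and> openin (top_of_set (log_cover a UNIV)) (graph_of_family U A) \<and>
     openin (top_of_set (log_cover a UNIV)) (log_cover a U - graph_of_family U A)"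

lemma clopen_family_mono:
  assumes "clopen_family a U A" "open U'" "U' \<subseteq> U"
  shows "clopen_family a U' A"
proof -
  have "graph_of_family U' A = graph_of_family U A \<inter> log_cover a U'" "log_cover a U' - graph_of_family U' A = (log_cover a U - graph_of_family U A) \<inter> log_cover a U'"
    using assms unfolding clopen_family_def graph_of_family_def log_cover_def by auto
  then show ?thesis using assms openin_log_cover[OF assms(2)] unfolding clopen_family_def
    by (metis inf_le2 openin_Int)
qed

lemma clopen_family_cong:
  assumes "clopen_family a U A" "\<And>z. z \<in> U \<Longrightarrow> A z = A' z"
  shows "clopen_family a U A'"
proof -
  have "graph_of_family U A = graph_of_family U A'" using assms(2) by (auto simp: graph_of_family_def)
  then show ?thesis using assms(1) by (simp add: clopen_family_def)
qed

lemma clopen_family_Union: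
  assumes "\<And>U. U \<in> \<U> \<Longrightarrow> clopen_family a U A"
  shows "clopen_family a (\<Union>\<U>) A"
proof -
  have "graph_of_family (\<Union>\<U>) A = (\<Union>U\<in>\<U>. graph_of_family U A)" "log_cover a (\<Union>\<U>) = (\<Union>U\<in>\<U>. log_cover a U)"
    by (auto simp: graph_of_family_def log_cover_def)
  moreover have "log_cover a (\<Union>\<U>) - graph_of_family (\<Union>\<U>) A = (\<Union>U\<in>\<U>. log_cover a U - graph_of_family U A)"
    by (auto simp: graph_of_family_def log_cover_def)
  moreover have "openin (top_of_set (log_cover a UNIV)) (\<Union>U\<in>\<U>. graph_of_family U A)"
    using assms unfolding clopen_family_def by (intro openin_Union) blast
  moreover have "openin (top_of_set (log_cover a UNIV)) (\<Union>U\<in>\<U>. log_cover a U - graph_of_family U A)"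
    using assms unfolding clopen_family_def by (intro openin_Union) blast
  moreover have "(\<Union>U\<in>\<U>. graph_of_family U A) \<subseteq> (\<Union>U\<in>\<U>. log_cover a U)"
    using assms unfolding clopen_family_def by (intro UN_mono) auto
  ultimately show ?thesis unfolding clopen_family_def by simp
qed

lemma clopen_family_preimage:
  fixes T :: "complex \<times> 'a \<Rightarrow> 'b::topological_space"
  assumes U: "open U" and T: "continuous_on (log_cover a U) T"
    and P: "openin (top_of_set M) P1" "openin (top_of_set M) P2" "P1 \<inter> P2 = {}"
    and im: "\<And>v. v \<in> log_cover a U \<Longrightarrow> T v \<in> P1 \<union> P2"
    and A: "\<And>z e. z \<in> U \<Longrightarrow> e \<in> A z \<longleftrightarrow> (z, e) \<in> log_cover a U \<and> T (z, e) \<in> P1"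
  shows "clopen_family a U A"
proof -
  have "T \<in> log_cover a U \<rightarrow> M" using im openin_imp_subset[OF P(1)] openin_imp_subset[OF P(2)] by blast
  then have o: "openin (top_of_set (log_cover a UNIV)) (log_cover a U \<inter> T -` P)" if "openin (top_of_set M) P" for P
    using continuous_openin_preimage[OF T _ that] openin_log_cover[OF U] openin_trans by blast
  have graph_of_family: "graph_of_family U A = log_cover a U \<inter> T -` P1" using A by (auto simp: graph_of_family_def log_cover_iff)
  then have "log_cover a U - graph_of_family U A = log_cover a U \<inter> T -` P2" using im P(3) by blast
  then show ?thesis unfolding clopen_family_def using o[OF P(1)] o[OF P(2)] graph_of_family by auto
qed

lemma countable_singular: "countable {z. a + exp z \<in> B}"
proof -
  have "countable {z. exp z = c}" for c :: complex
  proof (cases "c = 0")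
    case False
    have "{z. exp z = c} \<subseteq> range (\<lambda>n::int. Ln c + of_int (2 * n) * of_real pi * \<i>)"
    proof
      fix z assume "z \<in> {z. exp z = c}"
      then have "exp z = exp (Ln c)" using False by simp
      then show "z \<in> range (\<lambda>n::int. Ln c + of_int (2 * n) * of_real pi * \<i>)"
        unfolding exp_eq by auto
    qed
    then show ?thesis by (rule countable_subset) simp
  qed simp
  then have "countable (\<Union>b\<in>B. {z. exp z = b - a})" using finite_B by (intro countable_UN) (auto intro: countable_finite)
  moreover have "{z. a + exp z \<in> B} \<subseteq> (\<Union>b\<in>B. {z. exp z = b - a})" by (auto simp: algebra_simps)
  ultimately show ?thesis using countable_subset by blast
qed

lemma open_regular: "open {z. a + exp z \<notin> B}"
proof -
  have "open ((\<lambda>z. a + exp z) -` (-B))"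
    using finite_B by (intro open_vimage continuous_intros) (simp add: finite_imp_closed open_Compl)
  then show ?thesis by (simp add: vimage_def)
qed

lemma local_transport:
  assumes V: "open V" "\<And>z. z \<in> V \<Longrightarrow> a + exp z \<noteq> 0" and q: "q \<in> V" "a + exp q \<notin> B"
  obtains \<rho> L where "\<rho> > 0" "ball q \<rho> \<subseteq> V" "\<And>z. z \<in> ball q \<rho> \<Longrightarrow> a + exp z \<notin> B"
    "\<And>z e w. \<lbrakk>(z, e) \<in> log_cover a (ball q \<rho>); w \<in> ball q \<rho>\<rbrakk> \<Longrightarrow> (w, L z e w) \<in> log_cover a (ball q \<rho>)"
    "\<And>z e. (z, e) \<in> log_cover a (ball q \<rho>) \<Longrightarrow> L z e z = e"
    "continuous_on {(z, e, w). (z, e) \<in> log_cover a (ball q \<rho>) \<and> w \<in> ball q \<rho>} (\<lambda>(z, e, w). L z e w)"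
proof -
  obtain W Fib \<xi> k where W: "a + exp q \<in> W" and chart: "product_chart W Fib \<xi> k"
    using product_chart_exists[OF q(2)] by metis
  have "open ((\<lambda>z. a + exp z) -` W)" by (intro open_vimage product_chartD(1)[OF chart] continuous_intros)
  then have "open (((\<lambda>z. a + exp z) -` W) \<inter> V \<inter> {z. a + exp z \<notin> B})"
    using V(1) open_regular by blast
  then obtain \<rho> where \<rho>: "\<rho> > 0" "ball q \<rho> \<subseteq> ((\<lambda>z. a + exp z) -` W) \<inter> V \<inter> {z. a + exp z \<notin> B}"
    unfolding open_contains_ball using q W by blast
  have *: "a + exp z \<in> W" "a + exp z \<noteq> 0" if "z \<in> ball q \<rho>" for z using that \<rho>(2) V(2) by auto
  obtain L where "\<And>z e w. \<lbrakk>(z, e) \<in> log_cover a (ball q \<rho>); w \<in> ball q \<rho>\<rbrakk> \<Longrightarrow> (w, L z e w) \<in> log_cover a (ball q \<rho>)"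
    "\<And>z e. (z, e) \<in> log_cover a (ball q \<rho>) \<Longrightarrow> L z e z = e"
    "continuous_on {(z, e, w). (z, e) \<in> log_cover a (ball q \<rho>) \<and> w \<in> ball q \<rho>} (\<lambda>(z, e, w). L z e w)"
    by (rule transport[OF open_ball convex_ball * chart]) (assumption | rule that; assumption)+
  then show ?thesis using that[of \<rho> L] \<rho> by blast
qed

text \<open>
  The transports of a point form a connected set, which a clopen set contains as soon as it
  meets it.
\<close>

lemma transport_stays:
  assumes Q: "openin (top_of_set (log_cover a UNIV)) Q" "openin (top_of_set (log_cover a UNIV)) (log_cover a U - Q)"
    and V: "connected V" "V \<subseteq> U"
    and L: "\<And>w. w \<in> V \<Longrightarrow> (w, L z e w) \<in> log_cover a V" "(z, e) \<in> log_cover a V" "L z e z = e"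
       "continuous_on {(z, e, w). (z, e) \<in> log_cover a V \<and> w \<in> V} (\<lambda>(z, e, w). L z e w)"
    and w: "w \<in> V" and w': "w' \<in> V" and wQ: "(w, L z e w) \<in> Q"
  shows "(w', L z e w') \<in> Q"
proof -
  let ?C = "(\<lambda>w. (w, L z e w)) ` V"
  have "continuous_on V (\<lambda>w. (\<lambda>(z, e, w). L z e w) (z, e, w))"
    by (rule continuous_on_compose2[OF L(4)], intro continuous_intros) (use L(2) in auto)
  then have "continuous_on V (\<lambda>w. (w, L z e w))" by (intro continuous_intros) simp
  then have "connected ?C" using V(1) connected_continuous_image by blast
  moreover have CU: "?C \<subseteq> log_cover a U" using L(1) V(2) by (auto simp: log_cover_iff)
  moreover have "?C \<subseteq> log_cover a UNIV" using CU by (auto simp: log_cover_iff)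
  moreover have "?C \<inter> Q \<noteq> {}" using w wQ by blast
  ultimately have "?C \<subseteq> Q"
    using connected_subset_of_open_split[of ?C "log_cover a UNIV" Q "log_cover a U - Q"] Q by blast
  then show ?thesis using w' by blast
qed

text \<open>
  Let \<open>Q\<close> be the clopen set where the families differ.  By transport, the values of the logarithm
  over which \<open>Q\<close> is nonempty are locally all or none away from the countable set over \<open>B\<close>,
  whose complement is connected.  Hence \<open>Q\<close> is empty there, and by density everywhere.
\<close>

lemma clopen_families_agree:
  assumes U: "convex U" "open U" "\<And>z. z \<in> U \<Longrightarrow> a + exp z \<noteq> 0" and U': "open U'" "U' \<noteq> {}" "U' \<subseteq> U"
    and A: "clopen_family a U A" "clopen_family a U A'" and eq: "\<forall>z\<in>U'. A z = A' z" and z: "z \<in> U"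
  shows "A z = A' z"
proof -
  define Q where "Q = (graph_of_family U A - graph_of_family U A') \<union> (graph_of_family U A' - graph_of_family U A)"
  have sub: "graph_of_family U A \<subseteq> log_cover a U" "graph_of_family U A' \<subseteq> log_cover a U" using A by (auto simp: clopen_family_def)
  have "Q = (graph_of_family U A \<inter> (log_cover a U - graph_of_family U A')) \<union> (graph_of_family U A' \<inter> (log_cover a U - graph_of_family U A))"
    using sub by (auto simp: Q_def)
  then have Q: "openin (top_of_set (log_cover a UNIV)) Q"
    using A unfolding clopen_family_def by (auto intro!: openin_Un openin_Int)
  have "log_cover a U - Q = (graph_of_family U A \<inter> graph_of_family U A') \<union> ((log_cover a U - graph_of_family U A) \<inter> (log_cover a U - graph_of_family U A'))"
    using sub by (auto simp: Q_def)
  then have Q': "openin (top_of_set (log_cover a UNIV)) (log_cover a U - Q)"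
    using A unfolding clopen_family_def by (auto intro!: openin_Un openin_Int)
  let ?S = "{z. a + exp z \<in> B}"
  have loc: "\<exists>\<rho>>0. ball q \<rho> \<subseteq> U - ?S \<and> (\<forall>w\<in>ball q \<rho>. (\<exists>e. (w, e) \<in> Q) \<longleftrightarrow> (\<exists>e. (q, e) \<in> Q))"
    if q: "q \<in> U - ?S" for q
  proof -
    obtain \<rho> L where \<rho>: "\<rho> > 0" "ball q \<rho> \<subseteq> U" "\<And>z. z \<in> ball q \<rho> \<Longrightarrow> a + exp z \<notin> B"
      and L: "\<And>z e w. \<lbrakk>(z, e) \<in> log_cover a (ball q \<rho>); w \<in> ball q \<rho>\<rbrakk> \<Longrightarrow> (w, L z e w) \<in> log_cover a (ball q \<rho>)"
      "\<And>z e. (z, e) \<in> log_cover a (ball q \<rho>) \<Longrightarrow> L z e z = e"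
      "continuous_on {(z, e, w). (z, e) \<in> log_cover a (ball q \<rho>) \<and> w \<in> ball q \<rho>} (\<lambda>(z, e, w). L z e w)"
      using local_transport[OF U(2,3), of q] q by auto
    have move: "\<exists>e. (w', e) \<in> Q" if w: "w \<in> ball q \<rho>" "w' \<in> ball q \<rho>" and e: "(w, e) \<in> Q" for w w' e
    proof -
      have "(w, e) \<in> log_cover a U" using e sub by (auto simp: Q_def)
      then have E1: "(w, e) \<in> log_cover a (ball q \<rho>)" using w(1) by (simp add: log_cover_iff)
      have "(w', L w e w') \<in> Q"
      proof (rule transport_stays[OF Q Q' convex_connected[OF convex_ball] \<rho>(2) _ E1 L(2)[OF E1] L(3) w])
        show "(v, L w e v) \<in> log_cover a (ball q \<rho>)" if "v \<in> ball q \<rho>" for v by (rule L(1)[OF E1 that])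
        show "(w, L w e w) \<in> Q" using L(2)[OF E1] e by simp
      qed
      then show ?thesis by blast
    qed
    have "\<forall>w\<in>ball q \<rho>. (\<exists>e. (w, e) \<in> Q) \<longleftrightarrow> (\<exists>e. (q, e) \<in> Q)"
      using move \<rho>(1) by (metis centre_in_ball)
    moreover have "ball q \<rho> \<subseteq> U - ?S" using \<rho> by blast
    ultimately show ?thesis using \<rho>(1) by blast
  qed
  have conn: "connected (U - ?S)"
    using U countable_singular by (intro connected_open_diff_countable) (auto simp: convex_connected)
  obtain u r where "r > 0" "ball u r \<subseteq> U'" using U'(1,2) open_contains_ball by blast
  then have "uncountable U'" using uncountable_ball countable_subset by blast
  then have "\<not> U' \<subseteq> ?S" using countable_singular countable_subset by blast
  then obtain z1 where z1: "z1 \<in> U'" "z1 \<notin> ?S" by blast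
  then have z1U: "z1 \<in> U - ?S" "\<not> (\<exists>e. (z1, e) \<in> Q)" using U'(3) eq by (auto simp: Q_def graph_of_family_def)
  have emp: "\<not> (\<exists>e. (z, e) \<in> Q)" if "z \<in> U - ?S" for z
  proof (rule connected_induction_simple[OF conn z1U(1) that, of "\<lambda>z. \<not> (\<exists>e. (z, e) \<in> Q)"])
    fix q assume "q \<in> U - ?S"
    then obtain \<rho> where \<rho>: "\<rho> > 0" "ball q \<rho> \<subseteq> U - ?S" "\<forall>w\<in>ball q \<rho>. (\<exists>e. (w, e) \<in> Q) \<longleftrightarrow> (\<exists>e. (q, e) \<in> Q)"
      using loc[of q] by blast
    have "openin (top_of_set (U - ?S)) (ball q \<rho>)" by (rule open_subset[OF \<rho>(2) open_ball])
    moreover have "q \<in> ball q \<rho>" using \<rho>(1) by simp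
    moreover have "\<forall>x\<in>ball q \<rho>. \<forall>y\<in>ball q \<rho>. \<not> (\<exists>e. (x, e) \<in> Q) \<longrightarrow> \<not> (\<exists>e. (y, e) \<in> Q)"
      using \<rho>(3) by metis
    ultimately show "\<exists>T. openin (top_of_set (U - ?S)) T \<and> q \<in> T \<and>
        (\<forall>x\<in>T. \<forall>y\<in>T. \<not> (\<exists>e. (x, e) \<in> Q) \<longrightarrow> \<not> (\<exists>e. (y, e) \<in> Q))"
      by (intro exI[of _ "ball q \<rho>"] conjI)
  qed (rule z1U(2))
  have QU: "Q \<subseteq> log_cover a U" using sub by (auto simp: Q_def)
  have "Q = {}"
  proof (rule ccontr)
    assume "Q \<noteq> {}"
    then obtain z' e' where "(z', e') \<in> Q" "a + exp z' \<notin> B" using log_cover_dense[OF Q] by blast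
    moreover from this have "z' \<in> U" using QU by (auto simp: log_cover_iff)
    ultimately show False using emp by blast
  qed
  then have "(z, e) \<in> graph_of_family U A \<longleftrightarrow> (z, e) \<in> graph_of_family U A'" for e by (auto simp: Q_def)
  then show ?thesis using z by (auto simp: graph_of_family_def)
qed

text \<open>
  Continuation of clopen families near \<open>q\<close>, in the form required by
  \<open>local_sections_extend\<close>.
\<close>

definition extends_at :: "complex \<Rightarrow> complex set \<Rightarrow> complex \<Rightarrow> bool" where
  "extends_at a V q \<longleftrightarrow> (\<exists>\<rho>>0. ball q \<rho> \<subseteq> V \<and>
     (\<forall>U A. convex U \<longrightarrow> open U \<longrightarrow> U \<noteq> {} \<longrightarrow> U \<subseteq> ball q \<rho> \<longrightarrow> clopen_family a U A \<longrightarrow>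
        (\<exists>A' U'. clopen_family a (ball q \<rho>) A' \<and> open U' \<and> U' \<noteq> {} \<and> U' \<subseteq> U \<and> (\<forall>z\<in>U'. A z = A' z))))"

lemma clopen_family_extends:
  assumes V: "open V" "convex V" "\<And>z. z \<in> V \<Longrightarrow> a + exp z \<noteq> 0"
    and ext: "\<And>q. q \<in> V \<Longrightarrow> extends_at a V q"
    and A0: "\<epsilon> > 0" "ball z0 \<epsilon> \<subseteq> V" "clopen_family a (ball z0 \<epsilon>) A0"
  shows "\<exists>A. clopen_family a V A \<and> (\<forall>z\<in>ball z0 \<epsilon>. A z = A0 z)"
proof (rule local_sections_extend[where Sec="clopen_family a", OF V(1,2) A0])
  show "clopen_family a U' s" if "clopen_family a U s" "open U" "U \<subseteq> V" "open U'" "U' \<subseteq> U" for U U' s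
    using clopen_family_mono that by blast
  show "clopen_family a U s'" if "clopen_family a U s" "\<And>y. y \<in> U \<Longrightarrow> s y = s' y" for U s s'
    using clopen_family_cong that by blast
  show "clopen_family a (\<Union>\<U>) s" if "\<And>U. U \<in> \<U> \<Longrightarrow> open U \<and> U \<subseteq> V \<and> clopen_family a U s" for \<U> s
    using clopen_family_Union that by blast
  show "s y = s' y" if "convex U" "open U" "U \<subseteq> V" "open U'" "U' \<noteq> {}" "U' \<subseteq> U" "clopen_family a U s" "clopen_family a U s'"
      "\<forall>y\<in>U'. s y = s' y" "y \<in> U" for U U' s s' y
    using clopen_families_agree[OF that(1,2) _ that(4-10)] V(3) that(3) by blast
  fix q assume "q \<in> V"
  from ext[OF this] show "\<exists>\<rho>>0. ball q \<rho> \<subseteq> V \<and>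
     (\<forall>U s. convex U \<longrightarrow> open U \<longrightarrow> U \<noteq> {} \<longrightarrow> U \<subseteq> ball q \<rho> \<longrightarrow> clopen_family a U s \<longrightarrow>
        (\<exists>s' U'. clopen_family a (ball q \<rho>) s' \<and> open U' \<and> U' \<noteq> {} \<and> U' \<subseteq> U \<and> (\<forall>y\<in>U'. s y = s' y)))"
    unfolding extends_at_def .
qed

text \<open>
  Take the preimage of one member of the family under the transport to its logarithm.
\<close>

lemma extends_at_regular:
  assumes V: "open V" "\<And>z. z \<in> V \<Longrightarrow> a + exp z \<noteq> 0" and q: "q \<in> V" "a + exp q \<notin> B"
  shows "extends_at a V q"
proof -
  obtain \<rho> L where \<rho>: "\<rho> > 0" "ball q \<rho> \<subseteq> V"
    and L: "\<And>z e w. \<lbrakk>(z, e) \<in> log_cover a (ball q \<rho>); w \<in> ball q \<rho>\<rbrakk> \<Longrightarrow> (w, L z e w) \<in> log_cover a (ball q \<rho>)"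
    "\<And>z e. (z, e) \<in> log_cover a (ball q \<rho>) \<Longrightarrow> L z e z = e"
    "continuous_on {(z, e, w). (z, e) \<in> log_cover a (ball q \<rho>) \<and> w \<in> ball q \<rho>} (\<lambda>(z, e, w). L z e w)"
    by (rule local_transport[OF V(1) _ q]) (assumption | rule V(2), assumption | rule that; assumption)+
  let ?V = "ball q \<rho>"
  have "\<exists>A' U'. clopen_family a ?V A' \<and> open U' \<and> U' \<noteq> {} \<and> U' \<subseteq> U \<and> (\<forall>z\<in>U'. A z = A' z)"
    if U: "convex U" "open U" "U \<noteq> {}" "U \<subseteq> ?V" and A: "clopen_family a U A" for U A
  proof -
    have grU: "graph_of_family U A \<subseteq> log_cover a U" "openin (top_of_set (log_cover a UNIV)) (graph_of_family U A)"
      "openin (top_of_set (log_cover a UNIV)) (log_cover a U - graph_of_family U A)"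
      using A by (auto simp: clopen_family_def)
    obtain z1 where z1: "z1 \<in> U" using U(3) by blast
    have z1V: "z1 \<in> ?V" using z1 U(4) by blast
    define A' where "A' z = {e. (z, e) \<in> log_cover a ?V \<and> L z e z1 \<in> A z1}" for z
    let ?T = "\<lambda>v. (z1, L (fst v) (snd v) z1)"
    have "continuous_on (log_cover a ?V) (\<lambda>v. (\<lambda>(z, e, w). L z e w) (fst v, snd v, z1))"
      by (rule continuous_on_compose2[OF L(3)], intro continuous_intros) (use z1V in auto)
    then have cT: "continuous_on (log_cover a ?V) ?T" by (intro continuous_intros) simp
    have TE: "?T v \<in> log_cover a U" if "v \<in> log_cover a ?V" for v
      using L(1)[of "fst v" "snd v" z1] that z1 z1V by (auto simp: log_cover_iff)
    have "clopen_family a ?V A'"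
    proof (rule clopen_family_preimage[OF open_ball cT grU(2,3)])
      show "?T v \<in> graph_of_family U A \<union> (log_cover a U - graph_of_family U A)" if "v \<in> log_cover a ?V" for v using TE[OF that] by blast
      show "e \<in> A' z \<longleftrightarrow> (z, e) \<in> log_cover a ?V \<and> ?T (z, e) \<in> graph_of_family U A" if "z \<in> ?V" for z e
        using z1 by (simp add: A'_def graph_of_family_def)
    qed auto
    moreover have "A z = A' z" if z: "z \<in> U" for z
    proof -
      have zV: "z \<in> ?V" using z U(4) by blast
      have "e \<in> A z \<longleftrightarrow> e \<in> A' z" if e: "(z, e) \<in> log_cover a U" for e
      proof -
        have eV: "(z, e) \<in> log_cover a ?V" using e zV by (simp add: log_cover_iff)
        have cL: "continuous_on {(z, e, w). (z, e) \<in> log_cover a U \<and> w \<in> U} (\<lambda>(z, e, w). L z e w)"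
          by (rule continuous_on_subset[OF L(3)]) (use U(4) in \<open>auto simp: log_cover_iff\<close>)
        have LU: "(w, L z e w) \<in> log_cover a U" if "w \<in> U" for w
          using L(1)[OF eV, of w] that U(4) by (auto simp: log_cover_iff)
        have iff: "(w, L z e w) \<in> graph_of_family U A \<Longrightarrow> (w', L z e w') \<in> graph_of_family U A" if "w \<in> U" "w' \<in> U" for w w'
          by (rule transport_stays[OF grU(2,3) convex_connected[OF U(1)] order.refl LU e L(2)[OF eV] cL that])
        have "e \<in> A z \<longleftrightarrow> (z, L z e z) \<in> graph_of_family U A" using L(2)[OF eV] z by (simp add: graph_of_family_def)
        also have "\<dots> \<longleftrightarrow> (z1, L z e z1) \<in> graph_of_family U A" using iff z z1 by blast
        also have "\<dots> \<longleftrightarrow> e \<in> A' z" using z1 eV by (simp add: graph_of_family_def A'_def)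
        finally show ?thesis .
      qed
      moreover have "(z, e) \<in> log_cover a U" if "e \<in> A z" for e using that z grU(1) by (auto simp: graph_of_family_def)
      moreover have "(z, e) \<in> log_cover a U" if "e \<in> A' z" for e using that z by (auto simp: A'_def log_cover_iff)
      ultimately show ?thesis by blast
    qed
    ultimately show ?thesis using U by blast
  qed
  then show ?thesis unfolding extends_at_def using \<rho> by blast
qed

end

section \<open>Clopen families extend across bifurcation values\<close>

text \<open>
  Subgroups of the integers are cyclic; the trivial subgroup is contained in the even numbers.
\<close>

lemma int_subgroup_multiples:
  fixes S :: "int set"
  assumes add: "\<And>i j. i \<in> S \<Longrightarrow> j \<in> S \<Longrightarrow> i + j \<in> S" and neg: "\<And>i. i \<in> S \<Longrightarrow> - i \<in> S" and one: "1 \<notin> S"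
  obtains k :: nat where "k \<ge> 2" "\<And>j. j \<in> S \<Longrightarrow> int k dvd j"
proof (cases "S \<subseteq> {0}")
  case True
  then show ?thesis using that[of 2] by auto
next
  case False
  then obtain j where j: "j \<in> S" "j \<noteq> 0" by blast
  have "\<exists>n::nat. n > 0 \<and> int n \<in> S"
  proof (cases "j > 0")
    case True
    then show ?thesis using j by (intro exI[of _ "nat j"]) auto
  next
    case False
    then show ?thesis using j neg[OF j(1)] by (intro exI[of _ "nat (- j)"]) auto
  qed
  define k where "k = (LEAST n::nat. n > 0 \<and> int n \<in> S)"
  have k: "k > 0" "int k \<in> S" using LeastI_ex[OF \<open>\<exists>n::nat. n > 0 \<and> int n \<in> S\<close>] by (auto simp: k_def)
  have least: "k \<le> n" if "n > 0" "int n \<in> S" for n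
    unfolding k_def using that by (intro Least_le) auto
  have mult: "m * int k \<in> S" for m
  proof (induction m rule: int_induct[of _ 0])
    case base
    show ?case using add[OF k(2) neg[OF k(2)]] by simp
  next
    case (step1 i)
    then show ?case using add[OF step1(2) k(2)] by (simp add: algebra_simps)
  next
    case (step2 i)
    then show ?case using add[OF step2(2) neg[OF k(2)]] by (simp add: algebra_simps)
  qed
  have "k \<noteq> 1" using k(2) one by auto
  then have "k \<ge> 2" using k(1) by simp
  moreover have "int k dvd i" if i: "i \<in> S" for i
  proof -
    have "i mod int k = i + - (i div int k * int k)" by (simp add: minus_div_mult_eq_mod)
    then have m: "i mod int k \<in> S" using add[OF i neg[OF mult]] by simp
    have "0 \<le> i mod int k" "i mod int k < int k" using k(1) by auto
    then have "i mod int k = 0" using least[of "nat (i mod int k)"] m by (cases "i mod int k = 0") auto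
    then show ?thesis by auto
  qed
  ultimately show ?thesis using that by blast
qed

context covered_fibration
begin

lemma log_cover_shift: "(z, e) \<in> log_cover a V \<Longrightarrow> z + period j \<in> V \<Longrightarrow> (z + period j, e) \<in> log_cover a V"
  by (simp add: log_cover_iff exp_add_period)

text \<open>
  The punctured disc of radius \<open>r\<close> around \<open>a\<close> is the image of this half plane under
  \<open>\<lambda>z. a + exp z\<close>.
\<close>

lemma half_plane_iff: "r > 0 \<Longrightarrow> z \<in> {z. Re z < ln r} \<longleftrightarrow> norm (exp z) < r"
  by (simp add: norm_exp_eq_Re flip: ln_less_cancel_iff)

lemma half_plane: "open {z. Re z < ln r}" "convex {z. Re z < ln r}"
  by (simp_all add: open_halfspace_Re_lt convex_halfspace_Re_lt)

text \<open>
  A loop around \<open>b\<close> maps every component of a general fibre of \<open>f \<circ> F\<close> to itself.  Let \<open>K\<close> be a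
  component of the space of logarithms over the punctured disc.  The integers \<open>j\<close> for which the
  shift by \<open>period j\<close> maps \<open>K\<close> to itself form a subgroup; if it were proper, it would consist of
  multiples of some \<open>k \<ge> 2\<close>.  As \<open>K\<close> projects onto the connected preimage of the punctured disc, at
  any point over \<open>b\<close> there is a local section of the covering whose values, with a suitable
  logarithm \<open>c\<close> of \<open>f - b\<close>, lie in \<open>K\<close>.  This logarithm is determined up to multiples of
  \<open>period k\<close>, so \<open>exp (c / k)\<close> is a well-defined local \<open>k\<close>-th root of \<open>f - b\<close>, which is excluded by
  \<open>no_local_roots\<close>.
\<close>

lemma meridian_connected:
  assumes b: "b \<noteq> 0" and r: "r > 0" "\<And>c. c \<in> ball b r \<Longrightarrow> c \<noteq> 0"
    and ze: "(z0, e0) \<in> log_cover b {z. Re z < ln r}"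
  shows "connected_component (log_cover b {z. Re z < ln r}) (z0, e0) (z0 + period 1, e0)"
proof (rule ccontr)
  let ?V = "{z. Re z < ln r}"
  let ?X = "log_cover b ?V"
  assume no: "\<not> connected_component ?X (z0, e0) (z0 + period 1, e0)"
  define W where "W = ball b r - {b}"
  have VW: "?V = {z. b + exp z \<in> W}"
    using half_plane_iff[OF r(1)] by (auto simp: W_def dist_norm)
  have lcX: "locally connected ?X"
    using locally_connected_log_cover openin_log_cover[OF half_plane(1)] locally_open_subset by blast
  define K where "K = connected_component_set ?X (z0, e0)"
  have K: "openin (top_of_set ?X) K" "openin (top_of_set ?X) (?X - K)"
    unfolding K_def by (rule connected_component_open_split[OF lcX])+
  have KX: "K \<subseteq> ?X" unfolding K_def by (rule connected_component_subset)
  have K0: "(z0, e0) \<in> K" unfolding K_def using ze by (simp add: connected_component_refl)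
  have cK: "connected K" unfolding K_def by simp
  \<comment> \<open>The deck transformations of the logarithm.\<close>
  define \<tau> where "\<tau> j v = (fst v + period j, snd v)" for j and v :: "complex \<times> 'a"
  have \<tau>X: "\<tau> j v \<in> ?X" if "v \<in> ?X" for j v
    using that log_cover_shift[of "fst v" "snd v" b ?V j] by (cases v) (auto simp: \<tau>_def log_cover_iff Re_period)
  have \<tau>\<tau>: "\<tau> i (\<tau> j v) = \<tau> (i + j) v" for i j v by (simp add: \<tau>_def period_add algebra_simps)
  have \<tau>0: "\<tau> 0 v = v" for v by (simp add: \<tau>_def period_def)
  have \<tau>K: "\<tau> j ` K \<subseteq> K" if "v \<in> K" "\<tau> j v \<in> K" for j v
  proof -
    have "continuous_on K (\<tau> j)" unfolding \<tau>_def by (intro continuous_intros)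
    then have "connected (\<tau> j ` K)" using cK connected_continuous_image by blast
    moreover have "\<tau> j ` K \<subseteq> ?X" using KX \<tau>X by blast
    ultimately have "\<tau> j ` K \<subseteq> connected_component_set ?X (\<tau> j v)"
      using that(1) by (intro connected_component_maximal) auto
    moreover have "connected_component_set ?X (\<tau> j v) = K"
      using that(2) unfolding K_def by (simp add: connected_component_eq)
    ultimately show ?thesis by simp
  qed
  define stab where "stab = {j. \<tau> j (z0, e0) \<in> K}"
  have stabI: "j \<in> stab" if "v \<in> K" "\<tau> j v \<in> K" for j v
    using \<tau>K[OF that] K0 by (auto simp: stab_def)
  obtain k :: nat where k: "k \<ge> 2" "\<And>j. j \<in> stab \<Longrightarrow> int k dvd j"
  proof (rule int_subgroup_multiples[of stab])
    show "i + j \<in> stab" if ij: "i \<in> stab" "j \<in> stab" for i j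
    proof -
      have "\<tau> i ` K \<subseteq> K" using \<tau>K[OF K0] ij(1) by (simp add: stab_def)
      then have "\<tau> i (\<tau> j (z0, e0)) \<in> K" using ij(2) by (auto simp: stab_def)
      then show ?thesis by (simp add: stab_def \<tau>\<tau>)
    qed
    show "- i \<in> stab" if i: "i \<in> stab" for i
    proof -
      have "\<tau> (- i) (\<tau> i (z0, e0)) = (z0, e0)" by (simp add: \<tau>\<tau> \<tau>0)
      then show ?thesis using stabI[of "\<tau> i (z0, e0)" "- i"] i K0 by (simp add: stab_def)
    qed
    show "1 \<notin> stab" using no by (simp add: stab_def K_def \<tau>_def)
  qed blast
  have E': "{e \<in> E. f (F e) \<in> W} = E \<inter> F -` (f -` W)" by auto
  have W0: "0 \<notin> W" using r(2)[of 0] unfolding W_def by blast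
  have oW: "open W" by (simp add: W_def open_delete)
  have cW: "connected W" unfolding W_def by (rule connected_open_delete) auto
  have covX: "covering_space ?X snd (E \<inter> F -` (f -` W))"
    using log_cover_covering_over[of b W] unfolding VW E' by (simp add: W_def)
  have covW: "covering_space (E \<inter> F -` (f -` W)) F (f -` W)"
    by (rule covering_space_restrict[OF cov]) (use W0 in auto)
  have lcE': "locally connected (E \<inter> F -` (f -` W))"
    using locally_connected_E openin_preimage[OF oW] locally_open_subset unfolding E' by blast
  let ?E' = "E \<inter> F -` (f -` W)"
  have 1: "openin (top_of_set ?E') (snd ` K)" "openin (top_of_set ?E') (?E' - snd ` K)"
    by (rule covering_space_image_open[OF covX K(1)], rule covering_space_clopen_image[OF covX lcE' K])
  have ofW: "open (f -` W)" by (rule open_preimage[OF oW])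
  have 2: "openin (top_of_set (f -` W)) (F ` snd ` K)" "openin (top_of_set (f -` W)) (f -` W - F ` snd ` K)"
    by (rule covering_space_image_open[OF covW 1(1)],
        rule covering_space_clopen_image[OF covW open_imp_locally_connected[OF ofW] 1])
  have surjK: "f -` W \<subseteq> F ` snd ` K"
  proof (rule connected_subset_of_open_split[OF _ order.refl 2])
    show "connected (f -` W)" by (rule preimage_connected[OF oW cW])
    show "f -` W \<inter> F ` snd ` K \<noteq> {}" using K0 openin_imp_subset[OF 2(1)] by blast
  qed auto
  show False
  proof (rule no_local_roots[OF k(1), of b])
    fix q assume q: "f q = b"
    have "q \<in> - (f -` {0})" using q b by simp
    then obtain T \<U> where T: "q \<in> T" "openin (top_of_set (- (f -` {0}))) T" "\<Union>\<U> = E \<inter> F -` T"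
      and \<U>: "\<And>u. u \<in> \<U> \<Longrightarrow> openin (top_of_set E) u" "\<And>u. u \<in> \<U> \<Longrightarrow> \<exists>g. homeomorphism u T F g"
      using covering_space_sheet[OF cov] by metis
    have "open T" using T(2) open_base openin_open_eq by blast
    then have "open (T \<inter> f -` ball b r)" using open_preimage[of "ball b r"] by blast
    moreover have "q \<in> T \<inter> f -` ball b r" using T(1) q r(1) by simp
    ultimately obtain \<rho> where \<rho>: "\<rho> > 0" "ball q \<rho> \<subseteq> T \<inter> f -` ball b r"
      using open_contains_ball by blast
    define U where "U = ball q \<rho> - f -` {b}"
    have U: "connected U" "U \<noteq> {}" using thin[of "{b}" "ball q \<rho>"] \<rho>(1) by (auto simp: U_def)
    have oU: "open U" unfolding U_def Diff_eq
      using open_preimage[of "-{b}"] by (intro open_Int) (simp_all add: vimage_Compl open_Compl)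
    have UW: "U \<subseteq> f -` W" using \<rho>(2) by (auto simp: U_def W_def)
    obtain y where y: "y \<in> U" using U(2) by blast
    then obtain v where v: "v \<in> K" "F (snd v) = y" using surjK UW by blast
    have vX: "(fst v, snd v) \<in> ?X" using v(1) KX by auto
    then have vE: "snd v \<in> E" unfolding log_cover_iff by blast
    have "snd v \<in> \<Union>\<U>" using T(3) vE v(2) y \<rho>(2) by (auto simp: U_def)
    then obtain u where u: "u \<in> \<U>" "snd v \<in> u" by blast
    obtain s where s: "homeomorphism u T F s" using \<U>(2)[OF u(1)] by blast
    have uE: "u \<subseteq> E" using openin_imp_subset[OF \<U>(1)[OF u(1)]] .
    have UT: "U \<subseteq> T" using \<rho>(2) by (auto simp: U_def)
    have Fs: "F (s w) = w" "s w \<in> E" if "w \<in> U" for w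
      using that UT homeomorphism_apply2[OF s] homeomorphism_image2[OF s] uE by blast+
    have sy: "s y = snd v" using homeomorphism_apply1[OF s u(2)] v(2) by simp
    have cs: "continuous_on U s" using continuous_on_subset[OF homeomorphism_cont2[OF s] UT] .
    \<comment> \<open>The logarithms of \<open>f - b\<close> near \<open>q\<close>; \<open>K'\<close> consists of those which lie in \<open>K\<close> together with the section.\<close>
    let ?P = "{(c, z). c \<in> UNIV \<and> z \<in> U \<and> exp c = f z - b}"
    have covP: "covering_space ?P snd U"
    proof (rule covering_space_pullback[OF covering_space_exp_punctured_plane])
      show "continuous_on U (\<lambda>z. f z - b)" by (intro continuous_intros cont_on)
    qed (auto simp: U_def)
    let ?\<sigma> = "\<lambda>v. (fst v, s (snd v))"
    have c\<sigma>: "continuous_on ?P ?\<sigma>"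
      by (intro continuous_intros continuous_on_compose2[OF cs]) auto
    have \<sigma>X: "?\<sigma> \<in> ?P \<rightarrow> ?X"
    proof
      fix w assume w: "w \<in> ?P"
      then have "b + exp (fst w) = f (snd w)" "snd w \<in> U" by auto
      moreover from this have "fst w \<in> ?V" using UW unfolding VW by auto
      ultimately show "?\<sigma> w \<in> ?X" using Fs by (simp add: log_cover_iff)
    qed
    define K' where "K' = ?P \<inter> ?\<sigma> -` K"
    have K'1: "openin (top_of_set ?P) K'" unfolding K'_def by (rule continuous_openin_preimage[OF c\<sigma> \<sigma>X K(1)])
    have "?P - K' = ?P \<inter> ?\<sigma> -` (?X - K)" using \<sigma>X unfolding K'_def by blast
    then have K'2: "openin (top_of_set ?P) (?P - K')"
      using continuous_openin_preimage[OF c\<sigma> \<sigma>X K(2)] by simp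
    have lcU: "locally connected U" using oU open_imp_locally_connected by blast
    have "U \<subseteq> snd ` K'"
    proof (rule connected_subset_of_open_split[OF U(1) order.refl covering_space_image_open[OF covP K'1]
           covering_space_clopen_image[OF covP lcU K'1 K'2]])
      have "f y = b + exp (fst v)" using vX v(2) unfolding log_cover_iff by simp
      then have "(fst v, y) \<in> K'" using y v(1) sy by (simp add: K'_def)
      then show "U \<inter> snd ` K' \<noteq> {}" using y by force
    qed auto
    then have ex: "\<exists>c. (c, z) \<in> K'" if "z \<in> U" for z using that by force
    define g where "g z = exp ((SOME c. (c, z) \<in> K') / of_nat k)" for z
    have g: "g z = exp (c / of_nat k)" if c: "(c, z) \<in> K'" for c z
    proof -
      define c' where "c' = (SOME c. (c, z) \<in> K')"
      have c': "(c', z) \<in> K'" unfolding c'_def by (rule someI[of _ c]) (rule c)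
      have "exp c' = exp c" using c c' by (auto simp: K'_def)
      then obtain j where j: "c' = c + period j" using exp_eq_period by blast
      have "j \<in> stab" using stabI[of "(c, s z)" j] c c' by (simp add: K'_def \<tau>_def j)
      then obtain m where m: "j = int k * m" using k(2)[OF \<open>j \<in> stab\<close>] by (elim dvdE)
      have "period j = of_nat k * period m" by (simp add: period_def m algebra_simps)
      then have "c' / of_nat k = c / of_nat k + period m" using k(1) by (simp add: j add_divide_distrib)
      then show ?thesis unfolding g_def c'_def[symmetric] by (simp add: exp_add_period)
    qed
    have "continuous_on U g"
      unfolding continuous_openin_preimage_eq
    proof (intro allI impI)
      fix A :: "complex set" assume A: "open A"
      have "U \<inter> g -` A = snd ` (K' \<inter> (\<lambda>v. exp (fst v / of_nat k)) -` A)"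
      proof
        show "U \<inter> g -` A \<subseteq> snd ` (K' \<inter> (\<lambda>v. exp (fst v / of_nat k)) -` A)"
        proof
          fix z assume z: "z \<in> U \<inter> g -` A"
          then obtain c where "(c, z) \<in> K'" using ex by blast
          then show "z \<in> snd ` (K' \<inter> (\<lambda>v. exp (fst v / of_nat k)) -` A)"
            using g z by (intro image_eqI[of _ _ "(c, z)"]) auto
        qed
        show "snd ` (K' \<inter> (\<lambda>v. exp (fst v / of_nat k)) -` A) \<subseteq> U \<inter> g -` A"
          using g by (auto simp: K'_def)
      qed
      moreover have "openin (top_of_set ?P) (K' \<inter> (\<lambda>v. exp (fst v / of_nat k)) -` A)"
      proof -
        have "continuous_on K' (\<lambda>v. exp (fst v / of_nat k))" 
          using k(1) by (intro continuous_intros) auto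
        then have "openin (top_of_set K') (K' \<inter> (\<lambda>v. exp (fst v / of_nat k)) -` A)"
          using A by (rule continuous_openin_preimage_gen)
        then show ?thesis using K'1 openin_trans by blast
      qed
      ultimately show "openin (top_of_set U) (U \<inter> g -` A)"
        using covering_space_image_open[OF covP, of "K' \<inter> (\<lambda>v. exp (fst v / of_nat k)) -` A"] by (simp only:)
    qed
    moreover have "g w ^ k = f w - b" if w: "w \<in> U" for w
    proof -
      obtain c where c: "(c, w) \<in> K'" using ex[OF w] by blast
      have "g w ^ k = exp (of_nat k * (c / of_nat k))" unfolding g[OF c] by (simp only: exp_of_nat_mult)
      also have "\<dots> = exp c" using k(1) by simp
      also have "\<dots> = f w - b" using c by (simp add: K'_def)
      finally show ?thesis .
    qed
    ultimately show "\<exists>\<rho>>0. \<exists>u. continuous_on (ball q \<rho> - f -` {b}) u \<and> (\<forall>w\<in>ball q \<rho> - f -` {b}. u w ^ k = f w - b)"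
      using \<rho>(1) unfolding U_def by blast
  qed
qed

lemma local_homeomorphism_over:
  assumes e: "e \<in> E" "f (F e) \<in> W" and W: "open W"
  shows "\<exists>U G. e \<in> U \<and> openin (top_of_set {e \<in> E. f (F e) \<in> W}) U \<and> open (F ` U) \<and> homeomorphism U (F ` U) F G"
proof -
  let ?M = "{e \<in> E. f (F e) \<in> W}"
  have M: "?M = E \<inter> F -` (f -` W)" by auto
  obtain u T q where u: "e \<in> u" "openin (top_of_set E) u" "F e \<in> T" "openin (top_of_set (- (f -` {0}))) T"
    "homeomorphism u T F q"
    using covering_space_local_homeomorphism[OF cov e(1)] by metis
  have "open T" using u(4) open_base openin_open_eq by blast
  have im: "F ` (u \<inter> F -` (f -` W)) = T \<inter> f -` W" using homeomorphism_image1[OF u(5)] by blast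
  have uE: "u \<subseteq> E" using openin_imp_subset[OF u(2)] .
  show "\<exists>U G. e \<in> U \<and> openin (top_of_set ?M) U \<and> open (F ` U) \<and> homeomorphism U (F ` U) F G"
  proof (intro exI[of _ "u \<inter> F -` (f -` W)"] exI[of _ q] conjI)
    show "e \<in> u \<inter> F -` (f -` W)" using u(1) e by simp
    obtain A where "open A" "u = E \<inter> A" using u(2) unfolding openin_open by blast
    then have "u \<inter> F -` (f -` W) = ?M \<inter> A" unfolding M by blast
    then show "openin (top_of_set ?M) (u \<inter> F -` (f -` W))" using \<open>open A\<close> by (simp add: openin_open_Int)
    show "open (F ` (u \<inter> F -` (f -` W)))" unfolding im using \<open>open T\<close> open_preimage[OF W] by blast
    show "homeomorphism (u \<inter> F -` (f -` W)) (F ` (u \<inter> F -` (f -` W))) F q"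
      by (rule homeomorphism_of_subsets[OF u(5)]) (use im in auto)
  qed
qed

text \<open>
  A clopen family contains with a point its whole component.
\<close>

lemma clopen_family_periodic:
  assumes b: "b \<noteq> 0" and r: "r > 0" "\<And>c. c \<in> ball b r \<Longrightarrow> c \<noteq> 0"
    and A: "clopen_family b {z. Re z < ln r} A" and ze: "(z, e) \<in> log_cover b {z. Re z < ln r}"
  shows "e \<in> A z \<longleftrightarrow> e \<in> A (z + period j)"
proof -
  let ?V = "{z. Re z < ln r}"
  let ?X = "log_cover b ?V"
  have grX: "graph_of_family ?V A \<subseteq> ?X" "openin (top_of_set (log_cover b UNIV)) (graph_of_family ?V A)"
    "openin (top_of_set (log_cover b UNIV)) (?X - graph_of_family ?V A)"
    using A by (auto simp: clopen_family_def)
  have shift: "(z + period j, e) \<in> ?X" for j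
    using log_cover_shift[OF ze, of j] ze by (simp add: log_cover_iff Re_period)
  have one: "e \<in> A w \<longleftrightarrow> e \<in> A (w + period 1)" if we: "(w, e) \<in> ?X" for w
  proof -
    obtain C where C: "connected C" "C \<subseteq> ?X" "(w, e) \<in> C" "(w + period 1, e) \<in> C"
      using meridian_connected[OF b r we] unfolding connected_component_def by blast
    have CU: "C \<subseteq> log_cover b UNIV" using C(2) by (auto simp: log_cover_iff)
    have cov: "C \<subseteq> graph_of_family ?V A \<union> (?X - graph_of_family ?V A)" using C(2) by blast
    have "(w, e) \<in> graph_of_family ?V A \<longleftrightarrow> (w + period 1, e) \<in> graph_of_family ?V A"
      using connected_subset_of_open_split[OF C(1) CU grX(2,3) cov] C(3,4) by blast
    moreover have "w \<in> ?V" "w + period 1 \<in> ?V" using we by (auto simp: log_cover_iff Re_period)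
    ultimately show ?thesis unfolding graph_of_family_def by blast
  qed
  show ?thesis using period_invariant[of "\<lambda>w. e \<in> A w" z j] one[OF shift] by blast
qed

text \<open>
  A clopen family given near a point \<open>\<zeta>\<close> close to \<open>q\<close>, with \<open>exp \<zeta> \<noteq> b\<close>, is rewritten in terms of a
  logarithm of \<open>f \<circ> F - b\<close> and extended over the half plane of all these logarithms.  There it is
  periodic, so it descends to a clopen subset of \<open>E\<close> over the punctured disc around \<open>b\<close>.  This
  extends over the fibre at \<open>b\<close>, which does not separate \<open>E\<close> locally, and is
  rewritten back in terms of a logarithm of \<open>f \<circ> F\<close>.
\<close>

lemma extends_at_singular:
  assumes bB: "b \<in> B" and q: "exp q = b"
  shows "extends_at 0 UNIV q"
proof -
  have b0: "b \<noteq> 0" using q by auto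
  obtain r where r: "r > 0" "\<forall>x\<in>insert 0 B. x \<noteq> b \<longrightarrow> r \<le> dist b x"
    using finite_set_avoid[of "insert 0 B" b] finite_B by blast
  have rB: "c \<notin> B" if "c \<in> ball b r" "c \<noteq> b" for c using r(2) that by force
  have r0: "c \<noteq> 0" if "c \<in> ball b r" for c using r(2) that b0 by force
  let ?V = "{z. Re z < ln r}"
  let ?X = "log_cover b ?V"
  have V: "b + exp z \<in> ball b r" "b + exp z \<noteq> b" if "z \<in> ?V" for z
    using that half_plane_iff[OF r(1), of z] by (auto simp: dist_norm)
  have "open (exp -` ball b r)" by (intro open_vimage continuous_intros) auto
  moreover have "q \<in> exp -` ball b r" using q r(1) by simp
  ultimately obtain \<rho> where \<rho>: "\<rho> > 0" "ball q \<rho> \<subseteq> exp -` ball b r" using open_contains_ball by blast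
  have "\<exists>A' U'. clopen_family 0 (ball q \<rho>) A' \<and> open U' \<and> U' \<noteq> {} \<and> U' \<subseteq> U \<and> (\<forall>z\<in>U'. A z = A' z)"
    if U: "convex U" "open U" "U \<noteq> {}" "U \<subseteq> ball q \<rho>" and A: "clopen_family 0 U A" for U A
  proof -
    have grU: "graph_of_family U A \<subseteq> log_cover 0 U" "openin (top_of_set (log_cover 0 UNIV)) (graph_of_family U A)"
      "openin (top_of_set (log_cover 0 UNIV)) (log_cover 0 U - graph_of_family U A)"
      using A by (auto simp: clopen_family_def)
    obtain \<zeta> where \<zeta>: "\<zeta> \<in> U" "exp \<zeta> \<noteq> b"
    proof -
      obtain u s where "s > 0" "ball u s \<subseteq> U" using U(2,3) open_contains_ball by blast
      then have "uncountable U" using uncountable_ball countable_subset by blast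
      then have "\<not> U \<subseteq> {z. 0 + exp z \<in> B}" using countable_singular countable_subset by blast
      then show ?thesis using that bB by auto
    qed
    define c where "c = exp \<zeta>"
    have c: "c \<noteq> b" "c \<noteq> 0" "c \<in> ball b r" using \<zeta> U(4) \<rho>(2) by (auto simp: c_def)
    define \<omega>1 where "\<omega>1 = Ln (c - b)"
    have e\<omega>1: "b + exp \<omega>1 = c" using c(1) by (simp add: \<omega>1_def)
    have \<omega>1V: "\<omega>1 \<in> ?V" unfolding half_plane_iff[OF r(1)]
      using c e\<omega>1 by (simp add: \<omega>1_def dist_norm norm_minus_commute)
    \<comment> \<open>Change of logarithm: \<open>lam\<close> turns a logarithm of \<open>w - b\<close> into one of \<open>w\<close>, for \<open>w\<close> near \<open>c\<close>.\<close>
    define lam where "lam w = \<zeta> + Ln ((b + exp w) / c)" for w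
    have exp_lam: "exp (lam w) = b + exp w" if "w \<in> ?V" for w
      using r0[OF V(1)[OF that]] c(2) by (simp add: lam_def exp_add c_def[symmetric])
    define O1 where "O1 = ?V \<inter> {w. Re ((b + exp w) / c) > 0}"
    have oO1: "open O1" unfolding O1_def
      by (intro open_Int half_plane(1) open_Collect_less continuous_intros) (use c in auto)
    have clam: "continuous_on O1 lam" unfolding lam_def
      by (intro continuous_intros) (use c in \<open>auto simp: O1_def complex_nonpos_Reals_iff\<close>)
    have "open (O1 \<inter> lam -` (U \<inter> ball \<zeta> 1))"
      by (rule continuous_open_preimage[OF clam oO1 open_Int[OF U(2) open_ball]])
    moreover have "\<omega>1 \<in> O1 \<inter> lam -` (U \<inter> ball \<zeta> 1)"
      using \<omega>1V e\<omega>1 c(2) \<zeta>(1) by (simp add: O1_def lam_def)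
    ultimately obtain \<epsilon> where \<epsilon>: "\<epsilon> > 0" "ball \<omega>1 \<epsilon> \<subseteq> O1 \<inter> lam -` (U \<inter> ball \<zeta> 1)"
      using open_contains_ball by blast
    have \<epsilon>V: "ball \<omega>1 \<epsilon> \<subseteq> ?V" using \<epsilon>(2) by (auto simp: O1_def)
    let ?D = "ball \<omega>1 \<epsilon>"
    let ?\<Lambda> = "\<lambda>v. (lam (fst v), snd v)"
    have c\<Lambda>: "continuous_on (log_cover b ?D) ?\<Lambda>"
      by (intro continuous_intros continuous_on_compose2[OF clam]) (use \<epsilon>(2) in \<open>auto simp: log_cover_iff\<close>)
    have \<Lambda>U: "?\<Lambda> v \<in> log_cover 0 U" if "v \<in> log_cover b ?D" for v
    proof -
      have "(fst v, snd v) \<in> log_cover b ?D" using that by simp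
      then have "fst v \<in> ?D" "snd v \<in> E" "f (F (snd v)) = b + exp (fst v)"
        unfolding log_cover_iff by blast+
      moreover from this have "lam (fst v) \<in> U" "fst v \<in> ?V" using \<epsilon>(2) \<epsilon>V by auto
      ultimately show ?thesis using exp_lam by (simp add: log_cover_iff)
    qed
    define A1 where "A1 w = {e. (w, e) \<in> log_cover b ?D \<and> e \<in> A (lam w)}" for w
    have A1: "clopen_family b ?D A1"
    proof (rule clopen_family_preimage[OF open_ball c\<Lambda> grU(2,3)])
      show "?\<Lambda> v \<in> graph_of_family U A \<union> (log_cover 0 U - graph_of_family U A)" if "v \<in> log_cover b ?D" for v using \<Lambda>U[OF that] by blast
      show "e \<in> A1 z \<longleftrightarrow> (z, e) \<in> log_cover b ?D \<and> ?\<Lambda> (z, e) \<in> graph_of_family U A" if "z \<in> ?D" for z e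
        using \<epsilon>(2) that by (auto simp: A1_def graph_of_family_def)
    qed auto
    have "\<exists>A2. clopen_family b ?V A2 \<and> (\<forall>z\<in>?D. A2 z = A1 z)"
    proof (rule clopen_family_extends[OF half_plane])
      show "b + exp z \<noteq> 0" if "z \<in> ?V" for z using V[OF that] r0 by blast
      show "extends_at b ?V z" if "z \<in> ?V" for z
        using V r0 rB that by (intro extends_at_regular half_plane) blast+
      show "\<epsilon> > 0" "ball \<omega>1 \<epsilon> \<subseteq> ?V" "clopen_family b ?D A1" by fact+
    qed
    then obtain A2 where A2: "clopen_family b ?V A2" "\<And>z. z \<in> ?D \<Longrightarrow> A2 z = A1 z" by blast
    have gr2: "graph_of_family ?V A2 \<subseteq> ?X" "openin (top_of_set (log_cover b UNIV)) (graph_of_family ?V A2)"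
      "openin (top_of_set (log_cover b UNIV)) (?X - graph_of_family ?V A2)"
      using A2(1) by (auto simp: clopen_family_def)
    \<comment> \<open>By periodicity the images in \<open>E\<close> of the family and of its complement are disjoint.\<close>
    define P1 P2 where "P1 = snd ` graph_of_family ?V A2" and "P2 = snd ` (?X - graph_of_family ?V A2)"
    let ?M = "{e \<in> E. f (F e) \<in> ball b r}"
    have oP: "openin (top_of_set E) P1" "openin (top_of_set E) P2"
      unfolding P1_def P2_def by (rule open_image_log_cover(1)[OF gr2(2)], rule open_image_log_cover(1)[OF gr2(3)])
    have inP: "e \<in> P1 \<longleftrightarrow> e \<in> A2 z" if ze: "(z, e) \<in> ?X" for z e
    proof
      assume "e \<in> A2 z"
      then have "(z, e) \<in> graph_of_family ?V A2" using ze by (simp add: graph_of_family_def log_cover_iff)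
      then show "e \<in> P1" unfolding P1_def by force
    next
      assume "e \<in> P1"
      then obtain z' where z': "(z', e) \<in> graph_of_family ?V A2" by (auto simp: P1_def)
      then have z'X: "(z', e) \<in> ?X" using gr2(1) by blast
      then have "exp z = exp z'" using ze by (simp add: log_cover_iff)
      then obtain j where "z = z' + period j" using exp_eq_period by blast
      then show "e \<in> A2 z"
        using clopen_family_periodic[OF b0 r(1) r0 A2(1) z'X, of j] z' by (simp add: graph_of_family_def)
    qed
    have inP2: "e \<in> P2 \<longleftrightarrow> e \<notin> A2 z" if ze: "(z, e) \<in> ?X" for z e
    proof
      assume "e \<notin> A2 z"
      then have "(z, e) \<in> ?X - graph_of_family ?V A2" using ze by (simp add: graph_of_family_def)
      then show "e \<in> P2" unfolding P2_def by force
    next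
      assume "e \<in> P2"
      then obtain z' where z': "(z', e) \<in> ?X" "(z', e) \<notin> graph_of_family ?V A2" by (auto simp: P2_def)
      then have "exp z = exp z'" using ze by (simp add: log_cover_iff)
      then obtain j where "z = z' + period j" using exp_eq_period by blast
      moreover have "e \<notin> A2 z'" using z' by (simp add: graph_of_family_def log_cover_iff)
      ultimately show "e \<notin> A2 z"
        using clopen_family_periodic[OF b0 r(1) r0 A2(1) z'(1), of j] by simp
    qed
    have lift: "(Ln (f (F e) - b), e) \<in> ?X" if "e \<in> E" "f (F e) \<in> ball b r" "f (F e) \<noteq> b" for e
    proof -
      have "exp (Ln (f (F e) - b)) = f (F e) - b" using that(3) by simp
      then show ?thesis using that half_plane_iff[OF r(1), of "Ln (f (F e) - b)"]
        by (simp add: log_cover_iff dist_norm norm_minus_commute)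
    qed
    have PX: "e \<in> E \<and> f (F e) \<in> ball b r \<and> f (F e) \<noteq> b" if "e \<in> P1 \<union> P2" for e
    proof -
      have "e \<in> snd ` ?X" using \<open>e \<in> P1 \<union> P2\<close> gr2(1) unfolding P1_def P2_def by blast
      then obtain z where z: "(z, e) \<in> ?X" by auto
      then have "z \<in> ?V" "e \<in> E" "f (F e) = b + exp z" by (auto simp: log_cover_iff)
      then show ?thesis using V[of z] by simp
    qed
    have union: "P1 \<union> P2 = ?M - F -` (f -` {b})"
    proof
      show "P1 \<union> P2 \<subseteq> ?M - F -` (f -` {b})" using PX by auto
      show "?M - F -` (f -` {b}) \<subseteq> P1 \<union> P2"
      proof
        fix e assume e: "e \<in> ?M - F -` (f -` {b})"
        then have X: "(Ln (f (F e) - b), e) \<in> ?X" using lift by auto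
        show "e \<in> P1 \<union> P2" using inP[OF X] inP2[OF X] by blast
      qed
    qed
    have disj: "P1 \<inter> P2 = {}"
    proof (rule ccontr)
      assume "P1 \<inter> P2 \<noteq> {}"
      then obtain e where e: "e \<in> P1" "e \<in> P2" by blast
      then have X: "(Ln (f (F e) - b), e) \<in> ?X" using lift PX by blast
      show False using inP[OF X] inP2[OF X] e by blast
    qed
    have oM: "openin (top_of_set E) ?M" by (rule openin_preimage) simp
    have PM': "P1 \<subseteq> ?M" "P2 \<subseteq> ?M" "?M \<subseteq> E" using union by blast+
    have PM: "openin (top_of_set ?M) P1" "openin (top_of_set ?M) P2"
      by (rule openin_subset_trans[OF oP(1) PM'(1,3)], rule openin_subset_trans[OF oP(2) PM'(2,3)])
    obtain R1 R2 where R: "openin (top_of_set ?M) R1" "openin (top_of_set ?M) R2" "R1 \<union> R2 = ?M" "R1 \<inter> R2 = {}"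
      "R1 - F -` (f -` {b}) = P1" "R2 - F -` (f -` {b}) = P2"
    proof (rule open_split_extends_across_thin_set[of ?M F "f -` {b}" P1 P2])
      show "\<exists>U G. e \<in> U \<and> openin (top_of_set ?M) U \<and> open (F ` U) \<and> homeomorphism U (F ` U) F G" if "e \<in> ?M" for e
        using local_homeomorphism_over[of e "ball b r"] that by simp
      show "connected (ball q r - f -` {b}) \<and> ball q r - f -` {b} \<noteq> {}" if "r > 0" for q r
        using thin[of "{b}" "ball q r"] that by simp
    qed (use PM union disj in auto)
    have oR: "openin (top_of_set E) R1" "openin (top_of_set E) R2" using R(1,2) oM openin_trans by blast+
    let ?Q = "ball q \<rho>"
    define A3 where "A3 z = {e. (z, e) \<in> log_cover 0 ?Q \<and> e \<in> R1}" for z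
    have QM: "e \<in> ?M" if "(z, e) \<in> log_cover 0 ?Q" for z e using that \<rho>(2) by (auto simp: log_cover_iff)
    have A3: "clopen_family 0 ?Q A3"
    proof (rule clopen_family_preimage[of _ _ snd, OF open_ball _ oR R(4)])
      show "continuous_on (log_cover 0 ?Q) snd" by (intro continuous_intros)
      show "snd v \<in> R1 \<union> R2" if "v \<in> log_cover 0 ?Q" for v using QM[of "fst v" "snd v"] that R(3) by simp
    qed (simp add: A3_def)
    \<comment> \<open>The inverse change of logarithm near \<open>\<zeta>\<close>, which shows that the new family continues the old one.\<close>
    define om where "om z = \<omega>1 + Ln ((exp z - b) / (c - b))" for z
    define O2 where "O2 = {z. Re ((exp z - b) / (c - b)) > 0}"
    have oO2: "open O2" unfolding O2_def
      by (intro open_Collect_less continuous_intros) (use c in auto)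
    have com: "continuous_on O2 om" unfolding om_def
      by (intro continuous_intros) (use c in \<open>auto simp: O2_def complex_nonpos_Reals_iff\<close>)
    define U' where "U' = (U \<inter> ball \<zeta> 1) \<inter> (O2 \<inter> om -` ?D)"
    have "open U'" unfolding U'_def using continuous_open_preimage[OF com oO2, of ?D] U(2) by blast
    moreover have "\<zeta> \<in> U'"
    proof -
      have "exp \<zeta> - b = c - b" "c - b \<noteq> 0" using c by (auto simp: c_def)
      then show ?thesis using \<zeta>(1) \<epsilon>(1) by (simp add: U'_def O2_def om_def)
    qed
    moreover have "A z = A3 z" if z: "z \<in> U'" for z
    proof -
      have zU: "z \<in> U" "z \<in> ball \<zeta> 1" "om z \<in> ?D" "(exp z - b) / (c - b) \<noteq> 0"
        using z by (auto simp: U'_def O2_def)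
      have omV: "om z \<in> ?V" using zU(3) \<epsilon>V by blast
      have "exp (om z) = (c - b) * ((exp z - b) / (c - b))"
        using zU(4) c(1) unfolding om_def exp_add \<omega>1_def by (simp only: exp_Ln right_minus_eq not_False_eq_True)
      then have eom: "b + exp (om z) = exp z" using c(1) by simp
      have "exp (lam (om z)) = exp z" using exp_lam[OF omV] eom by simp
      moreover have "\<bar>Im (lam (om z)) - Im z\<bar> < 2 * pi"
      proof -
        have "lam (om z) \<in> ball \<zeta> 1" using zU(3) \<epsilon>(2) by blast
        then have "dist (lam (om z)) z < 2" using zU(2) dist_triangle2[of "lam (om z)" z \<zeta>] by (simp add: dist_commute)
        moreover have "\<bar>Im (lam (om z) - z)\<bar> \<le> dist (lam (om z)) z" unfolding dist_norm by (rule abs_Im_le_cmod)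
        ultimately show ?thesis using pi_gt3 by simp
      qed
      ultimately have lo: "lam (om z) = z" using exp_complex_eqI by blast
      have eq: "e \<in> A z \<longleftrightarrow> e \<in> A3 z" if e: "e \<in> E" "f (F e) = exp z" for e
      proof -
        have X: "(om z, e) \<in> ?X" "(om z, e) \<in> log_cover b ?D" using omV zU(3) e eom by (simp_all add: log_cover_iff)
        have "f (F e) \<noteq> b" using e(2) eom by (metis add_cancel_left_right exp_not_eq_zero)
        then have "e \<in> R1 \<longleftrightarrow> e \<in> P1" using R(5) by auto
        then have "e \<in> A3 z \<longleftrightarrow> e \<in> P1" using e zU(1) U(4) by (auto simp: A3_def log_cover_iff)
        also have "\<dots> \<longleftrightarrow> e \<in> A2 (om z)" by (rule inP[OF X(1)])
        also have "\<dots> \<longleftrightarrow> e \<in> A z" using A2(2)[OF zU(3)] X(2) lo by (simp add: A1_def)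
        finally show ?thesis by blast
      qed
      moreover have "e \<in> E \<and> f (F e) = exp z" if "e \<in> A z" for e
        using that zU(1) grU(1) by (auto simp: graph_of_family_def log_cover_iff)
      moreover have "e \<in> E \<and> f (F e) = exp z" if "e \<in> A3 z" for e
        using that by (simp add: A3_def log_cover_iff)
      ultimately show ?thesis by blast
    qed
    moreover have "U' \<subseteq> U" by (auto simp: U'_def)
    ultimately show ?thesis using A3 by blast
  qed
  then show ?thesis unfolding extends_at_def using \<rho>(1) by blast
qed

lemma clopen_family_extends_everywhere:
  assumes "\<epsilon> > 0" "clopen_family 0 (ball z0 \<epsilon>) A0"
  obtains A where "clopen_family 0 UNIV A" "\<And>z. z \<in> ball z0 \<epsilon> \<Longrightarrow> A z = A0 z"
proof -
  have "extends_at 0 UNIV q" for q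
  proof (cases "exp q \<in> B")
    case True
    then show ?thesis using extends_at_singular by blast
  next
    case False
    then show ?thesis using extends_at_regular[of UNIV 0 q] by simp
  qed
  then have "\<exists>A. clopen_family 0 UNIV A \<and> (\<forall>z\<in>ball z0 \<epsilon>. A z = A0 z)"
    using assms by (intro clopen_family_extends) auto
  then show ?thesis using that by blast
qed

section \<open>A meridian that closes up\<close>

text \<open>
  The section \<open>G\<close> lifts a small meridian to a closed path at \<open>e0\<close>.  So the component of \<open>e0\<close> in the
  space of logarithms is invariant under all periods, and this space is connected because \<open>E\<close> is.
  By the extension of clopen families, already the part over a half plane of logarithms near \<open>D\<close> is
  connected.  On that part, moving once around the meridian is a lift of the identity which fixes
  \<open>e0\<close>, hence is the identity: every small meridian around \<open>D\<close> has trivial monodromy.  Therefore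
  the covering has local sections at every point of \<open>D\<close>, and a global section, by
  \<open>lift_across_thin_set\<close>.
\<close>

lemma injective_of_local_section:
  assumes connE: "connected E" and q: "f q = 0"
    and U: "open U" "q \<in> U"
    and G: "continuous_on (U - f -` {0}) G" "\<And>y. y \<in> U - f -` {0} \<Longrightarrow> G y \<in> E"
      "\<And>y. y \<in> U - f -` {0} \<Longrightarrow> F (G y) = y"
  shows "inj_on F E"
proof -
  obtain W Fib \<xi> k where W0: "0 \<in> W" and chart: "product_chart W Fib \<xi> k"
    using product_chart_exists[OF zero_notin_B] by metis
  note W = W0 product_chartD(1)[OF chart] and h = product_chartD(2-6)[OF chart] and \<xi>k = product_chartD(7)[OF chart]
  obtain \<delta> where \<delta>: "\<delta> > 0" "ball 0 \<delta> \<subseteq> W" using W open_contains_ball by blast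
  let ?V = "{z. Re z < ln \<delta>}"
  have V: "0 + exp z \<in> W" "0 + exp z \<noteq> 0" "exp z \<in> W" if "z \<in> ?V" for z
    using that half_plane_iff[OF \<delta>(1), of z] \<delta>(2) by (auto simp: dist_norm subset_iff)
  obtain L where LE: "\<And>z e w. \<lbrakk>(z, e) \<in> log_cover 0 ?V; w \<in> ?V\<rbrakk> \<Longrightarrow> (w, L z e w) \<in> log_cover 0 ?V"
    and LF: "\<And>z e w. \<lbrakk>(z, e) \<in> log_cover 0 ?V; w \<in> ?V\<rbrakk> \<Longrightarrow> F (L z e w) = k (0 + exp w, \<xi> (F e))"
    and L0: "\<And>z e. (z, e) \<in> log_cover 0 ?V \<Longrightarrow> L z e z = e"
    and cL: "continuous_on {(z, e, w). (z, e) \<in> log_cover 0 ?V \<and> w \<in> ?V} (\<lambda>(z, e, w). L z e w)"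
    by (rule transport[OF half_plane V(1,2) chart]) (assumption | rule that; assumption)+
  have EtV: "z \<in> ?V" "e \<in> E" "f (F e) = exp z" "f (F e) \<in> W" "\<xi> (F e) \<in> Fib" if "(z, e) \<in> log_cover 0 ?V" for z e
    using that V(3)[of z] h(3)[of "F e"] by (auto simp: log_cover_iff)
  have cLw: "continuous_on A (\<lambda>w. L z e w)" if "(z, e) \<in> log_cover 0 ?V" "A \<subseteq> ?V" for z e A
  proof -
    have "continuous_on A (\<lambda>w. (\<lambda>(z, e, w). L z e w) (z, e, w))"
      by (rule continuous_on_compose2[OF cL], intro continuous_intros) (use that in auto)
    then show ?thesis by simp
  qed
  \<comment> \<open>The points \<open>k (exp z, x0)\<close> are close to \<open>q\<close> when \<open>Re z\<close> is very negative; over them \<open>G\<close> gives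
    a lift which is periodic in \<open>z\<close>.\<close>
  define x0 where "x0 = \<xi> q"
  have x0: "x0 \<in> Fib" "k (0, x0) = q" using h(3)[of q] h(4)[of q] q W(1) by (auto simp: x0_def)
  have ck: "continuous_on W (\<lambda>c. k (c, x0))"
    using x0 by (intro continuous_on_compose2[OF h(2)] continuous_intros) auto
  have "open (W \<inter> (\<lambda>c. k (c, x0)) -` U)" by (rule continuous_open_preimage[OF ck W(2) U(1)])
  then have "open ((W \<inter> (\<lambda>c. k (c, x0)) -` U) \<inter> ball 0 \<delta>)" by blast
  moreover have "0 \<in> (W \<inter> (\<lambda>c. k (c, x0)) -` U) \<inter> ball 0 \<delta>" using W(1) x0(2) U(2) \<delta>(1) by simp
  ultimately obtain \<epsilon> where \<epsilon>: "\<epsilon> > 0" "ball 0 \<epsilon> \<subseteq> (W \<inter> (\<lambda>c. k (c, x0)) -` U) \<inter> ball 0 \<delta>"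
    using open_contains_ball by blast
  let ?V1 = "{z. Re z < ln \<epsilon>}"
  have V1: "exp z \<in> ball 0 \<epsilon>" if "z \<in> ?V1" for z
    using that half_plane_iff[OF \<epsilon>(1), of z] by (simp add: dist_norm)
  have V1V: "?V1 \<subseteq> ?V"
  proof
    fix z assume "z \<in> ?V1"
    then have "exp z \<in> ball 0 \<delta>" using V1 \<epsilon>(2) by blast
    then show "z \<in> ?V" unfolding half_plane_iff[OF \<delta>(1)] by (simp add: dist_norm)
  qed
  define g where "g z = G (k (exp z, x0))" for z
  have kU: "k (exp z, x0) \<in> U - f -` {0}" "f (k (exp z, x0)) = exp z" if "z \<in> ?V1" for z
  proof -
    have "exp z \<in> (W \<inter> (\<lambda>c. k (c, x0)) -` U) \<inter> ball 0 \<delta>" using V1[OF that] \<epsilon>(2) by blast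
    then have "exp z \<in> W" "k (exp z, x0) \<in> U" by auto
    then show "f (k (exp z, x0)) = exp z" "k (exp z, x0) \<in> U - f -` {0}" using h(5) x0(1) by auto
  qed
  have gE: "g z \<in> E" "F (g z) = k (exp z, x0)" if "z \<in> ?V1" for z
    using G(2,3)[OF kU(1)[OF that]] by (simp_all add: g_def)
  have gEt: "(z, g z) \<in> log_cover 0 ?V" if "z \<in> ?V1" for z
    using gE[OF that] kU(2)[OF that] that V1V by (auto simp: log_cover_iff)
  have cg: "continuous_on ?V1 g" unfolding g_def
    by (rule continuous_on_compose2[OF G(1)], rule continuous_on_compose2[OF ck], intro continuous_intros)
      (use kU V1 \<epsilon>(2) in blast)+
  define \<zeta> where "\<zeta> = complex_of_real (ln \<epsilon> - 1)"
  have \<zeta>: "\<zeta> \<in> ?V1" "\<zeta> + period j \<in> ?V1" for j by (simp_all add: \<zeta>_def Re_period)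
  define e0 where "e0 = g \<zeta>"
  have gper: "g (\<zeta> + period j) = e0" for j by (simp add: g_def e0_def exp_add_period)
  have e0: "(\<zeta>, e0) \<in> log_cover 0 ?V" "\<zeta> \<in> ?V" using gEt[OF \<zeta>(1)] V1V \<zeta>(1) by (auto simp: e0_def)
  have e0': "(\<zeta>, e0) \<in> log_cover 0 UNIV" using e0(1) by (simp add: log_cover_iff)
  \<comment> \<open>The component of the periodic lift is invariant under all periods and projects onto \<open>E\<close>.\<close>
  define K where "K = connected_component_set (log_cover 0 UNIV) (\<zeta>, e0)"
  have K: "openin (top_of_set (log_cover 0 UNIV)) K" "openin (top_of_set (log_cover 0 UNIV)) (log_cover 0 UNIV - K)"
    unfolding K_def by (rule connected_component_open_split[OF locally_connected_log_cover])+
  have KE: "K \<subseteq> log_cover 0 UNIV" unfolding K_def by (rule connected_component_subset)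
  have cK: "connected K" unfolding K_def by simp
  have curve: "(\<lambda>z. (z, g z)) ` ?V1 \<subseteq> K" unfolding K_def
  proof (rule connected_component_maximal)
    show "(\<zeta>, e0) \<in> (\<lambda>z. (z, g z)) ` ?V1" using \<zeta>(1) by (auto simp: e0_def)
    show "connected ((\<lambda>z. (z, g z)) ` ?V1)"
      by (intro connected_continuous_image continuous_intros cg convex_connected half_plane)
    show "(\<lambda>z. (z, g z)) ` ?V1 \<subseteq> log_cover 0 UNIV" using gEt by (auto simp: log_cover_iff)
  qed
  have Kper: "(z + period j, e) \<in> K" if ze: "(z, e) \<in> K" for z e j
  proof -
    let ?\<tau> = "\<lambda>v::complex \<times> 'a. (fst v + period j, snd v)"
    have z0: "(\<zeta>, e0) \<in> K" unfolding K_def using e0' by (simp add: connected_component_refl)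
    have zj: "(\<zeta> + period j, e0) \<in> K" using curve \<zeta>(2)[of j] gper[of j] by (metis (no_types, lifting) imageI subsetD)
    have "connected (?\<tau> ` K)" by (intro connected_continuous_image continuous_intros cK)
    moreover have "?\<tau> ` K \<subseteq> log_cover 0 UNIV" using KE by (auto simp: log_cover_iff exp_add_period)
    moreover have "(\<zeta> + period j, e0) \<in> ?\<tau> ` K" using z0 by force
    ultimately have "?\<tau> ` K \<subseteq> connected_component_set (log_cover 0 UNIV) (\<zeta> + period j, e0)"
      by (intro connected_component_maximal)
    moreover have "connected_component_set (log_cover 0 UNIV) (\<zeta> + period j, e0) = K"
      using zj unfolding K_def by (simp add: connected_component_eq)
    ultimately show ?thesis using ze by force
  qed
  have eqE: "{e \<in> E. f (F e) \<noteq> 0} = E" using fF_nonzero by blast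
  have covE: "covering_space (log_cover 0 UNIV) snd E" using log_cover_covering[of 0] unfolding eqE .
  have EK: "E \<subseteq> snd ` K"
  proof (rule connected_subset_of_open_split[OF connE order.refl covering_space_image_open[OF covE K(1)]
         covering_space_clopen_image[OF covE locally_connected_E K]])
    have "(\<zeta>, e0) \<in> K" unfolding K_def using e0' by (simp add: connected_component_refl)
    then show "E \<inter> snd ` K \<noteq> {}" using e0' by (force simp: log_cover_iff)
  qed auto
  have KEt: "K = log_cover 0 UNIV"
  proof
    show "log_cover 0 UNIV \<subseteq> K"
    proof
      fix v assume v: "v \<in> log_cover 0 UNIV"
      obtain z e where ze: "v = (z, e)" by (cases v)
      have eE: "e \<in> E" "f (F e) = exp z" using v unfolding ze by (auto simp: log_cover_iff)
      then obtain z' where z': "(z', e) \<in> K" using EK by force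
      then have "f (F e) = exp z'" using KE by (auto simp: log_cover_iff)
      then have "exp z = exp z'" using eE by simp
      then obtain j where "z = z' + period j" using exp_eq_period by blast
      then show "v \<in> K" using Kper[OF z'] ze by simp
    qed
  qed (rule KE)
  have connEt: "connected (log_cover 0 UNIV)" using cK KEt by simp
  \<comment> \<open>A component over the half plane extends to a clopen subset of the connected space of all
    logarithms, so it is the only one.\<close>
  have connV: "connected (log_cover 0 ?V)"
  proof -
    let ?X = "log_cover 0 ?V"
    have oX: "openin (top_of_set (log_cover 0 UNIV)) ?X" by (rule openin_log_cover[OF half_plane(1)])
    have lcX: "locally connected ?X" using locally_connected_log_cover oX locally_open_subset by blast
    define Q where "Q = connected_component_set ?X (\<zeta>, e0)"
    have Q: "openin (top_of_set ?X) Q" "openin (top_of_set ?X) (?X - Q)"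
      unfolding Q_def by (rule connected_component_open_split[OF lcX])+
    have QX: "Q \<subseteq> ?X" unfolding Q_def by (rule connected_component_subset)
    define A where "A z = {e. (z, e) \<in> Q}" for z
    have grA: "graph_of_family ?V A = Q" using QX by (auto simp: graph_of_family_def A_def log_cover_iff)
    have A: "clopen_family 0 ?V A" unfolding clopen_family_def grA
      using QX Q oX openin_trans by blast
    obtain \<rho> where \<rho>: "\<rho> > 0" "ball \<zeta> \<rho> \<subseteq> ?V" using half_plane(1) e0(2) open_contains_ball by blast
    have "clopen_family 0 (ball \<zeta> \<rho>) A" using clopen_family_mono[OF A open_ball \<rho>(2)] .
    then obtain A' where A': "clopen_family 0 UNIV A'" "\<And>z. z \<in> ball \<zeta> \<rho> \<Longrightarrow> A' z = A z"
      using clopen_family_extends_everywhere[OF \<rho>(1)] by blast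
    have graph_of_family': "graph_of_family UNIV A' \<subseteq> log_cover 0 UNIV" "openin (top_of_set (log_cover 0 UNIV)) (graph_of_family UNIV A')"
      "openin (top_of_set (log_cover 0 UNIV)) (log_cover 0 UNIV - graph_of_family UNIV A')"
      using A'(1) by (auto simp: clopen_family_def)
    have AA': "A z = A' z" if z: "z \<in> ?V" for z
    proof (rule clopen_families_agree[OF half_plane(2,1) _ open_ball _ \<rho>(2) A clopen_family_mono[OF A'(1) half_plane(1)] _ z])
      show "ball \<zeta> \<rho> \<noteq> {}" using \<rho>(1) by simp
      show "\<forall>z\<in>ball \<zeta> \<rho>. A z = A' z" using A'(2) by simp
    qed auto
    have "(\<zeta>, e0) \<in> Q" unfolding Q_def using e0(1) by (simp add: connected_component_refl)
    then have "(\<zeta>, e0) \<in> graph_of_family UNIV A'" using AA'[OF e0(2)] by (auto simp: graph_of_family_def A_def)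
    then have "log_cover 0 UNIV \<subseteq> graph_of_family UNIV A'"
      using connected_subset_of_open_split[OF connEt order.refl graph_of_family'(2,3)] e0' by blast
    then have "?X \<subseteq> Q" using AA' unfolding log_cover_def graph_of_family_def A_def by blast
    then have "?X = Q" using QX by blast
    then show ?thesis unfolding Q_def by (metis connected_connected_component)
  qed
  \<comment> \<open>Transport around the meridian lifts the identity and fixes \<open>e0\<close>, so it is the identity.\<close>
  have LG: "L \<zeta> e0 w = g w" if w: "w \<in> ?V1" for w
  proof (rule covering_space_lifts_agree[OF cov, of ?V1 "L \<zeta> e0" g \<zeta>])
    show "connected ?V1" using half_plane(2) convex_connected by blast
    show "continuous_on ?V1 (L \<zeta> e0)" using cLw[OF e0(1) V1V] .
    show "L \<zeta> e0 \<in> ?V1 \<rightarrow> E" using LE[OF e0(1)] V1V by (auto simp: log_cover_iff)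
    show "g \<in> ?V1 \<rightarrow> E" using gE(1) by blast
    show "continuous_on ?V1 g" by (rule cg)
    show "F (L \<zeta> e0 w) = F (g w)" if "w \<in> ?V1" for w
    proof -
      have "\<xi> (F e0) = x0" unfolding e0_def gE(2)[OF \<zeta>(1)]
        using \<xi>k[of "exp \<zeta>" x0] V(3)[OF e0(2)] x0(1) by blast
      then show ?thesis using LF[OF e0(1), of w] gE(2)[OF that] that V1V by auto
    qed
    show "\<zeta> \<in> ?V1" "w \<in> ?V1" by fact+
    show "L \<zeta> e0 \<zeta> = g \<zeta>" using L0[OF e0(1)] by (simp add: e0_def)
  qed
  have Vper: "z + period j \<in> ?V" if "z \<in> ?V" for z j using that by (simp add: Re_period)
  have mono: "L z e (z + period 1) = e" if ze: "(z, e) \<in> log_cover 0 ?V" for z e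
  proof -
    have "(\<lambda>v. L (fst v) (snd v) (fst v + period 1)) (z, e) = snd (z, e)"
    proof (rule covering_space_lifts_agree[OF cov connV, of _ _ "(\<zeta>, e0)"])
      have "continuous_on (log_cover 0 ?V) (\<lambda>v. (\<lambda>(z, e, w). L z e w) (fst v, snd v, fst v + period 1))"
        by (rule continuous_on_compose2[OF cL], intro continuous_intros) (use EtV Vper in auto)
      then show "continuous_on (log_cover 0 ?V) (\<lambda>v. L (fst v) (snd v) (fst v + period 1))" by simp
      show "continuous_on (log_cover 0 ?V) snd" by (intro continuous_intros)
      show "snd \<in> log_cover 0 ?V \<rightarrow> E" by (auto simp: log_cover_iff)
      show "(\<lambda>v. L (fst v) (snd v) (fst v + period 1)) \<in> log_cover 0 ?V \<rightarrow> E"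
      proof
        fix v assume v: "v \<in> log_cover 0 ?V"
        then have v': "(fst v, snd v) \<in> log_cover 0 ?V" by simp
        show "L (fst v) (snd v) (fst v + period 1) \<in> E"
          using LE[OF v' Vper[OF EtV(1)[OF v']]] by (simp add: log_cover_iff)
      qed
      show "F (L (fst v) (snd v) (fst v + period 1)) = F (snd v)" if v: "v \<in> log_cover 0 ?V" for v
      proof -
        have v': "(fst v, snd v) \<in> log_cover 0 ?V" using v by simp
        have "F (L (fst v) (snd v) (fst v + period 1)) = k (f (F (snd v)), \<xi> (F (snd v)))"
          using LF[OF v' Vper[OF EtV(1)[OF v']]] EtV(3)[OF v'] by (simp add: exp_add_period)
        then show ?thesis using h(4)[OF EtV(4)[OF v']] by simp
      qed
      show "(\<zeta>, e0) \<in> log_cover 0 ?V" by (rule e0(1))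
      show "L (fst (\<zeta>, e0)) (snd (\<zeta>, e0)) (fst (\<zeta>, e0) + period 1) = snd (\<zeta>, e0)"
        using LG[OF \<zeta>(2)] gper by simp
      show "(z, e) \<in> log_cover 0 ?V" by (rule ze)
    qed
    then show ?thesis by simp
  qed
  have \<xi>L: "\<xi> (F (L z e w)) = \<xi> (F e)" if "(z, e) \<in> log_cover 0 ?V" "w \<in> ?V" for z e w
    using LF[OF that] \<xi>k[OF V(3)[OF that(2)] EtV(5)[OF that(1)]] by simp
  have comp: "L w0 (L z e w0) w = L z e w" if ze: "(z, e) \<in> log_cover 0 ?V" and w: "w0 \<in> ?V" "w \<in> ?V" for z e w0 w
  proof (rule covering_space_lifts_agree[OF cov, of ?V "L w0 (L z e w0)" "L z e" w0])
    have E1: "(w0, L z e w0) \<in> log_cover 0 ?V" by (rule LE[OF ze w(1)])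
    show "connected ?V" using half_plane(2) convex_connected by blast
    show "continuous_on ?V (L w0 (L z e w0))" "continuous_on ?V (L z e)"
      by (rule cLw[OF E1 order.refl], rule cLw[OF ze order.refl])
    show "L w0 (L z e w0) \<in> ?V \<rightarrow> E" "L z e \<in> ?V \<rightarrow> E" using LE[OF E1] LE[OF ze] by (auto simp: log_cover_iff)
    show "F (L w0 (L z e w0) v) = F (L z e v)" if "v \<in> ?V" for v
      using LF[OF E1 that] LF[OF ze that] \<xi>L[OF ze w(1)] by simp
    show "w0 \<in> ?V" "w \<in> ?V" by (rule w)+
    show "L w0 (L z e w0) w0 = L z e w0" by (rule L0[OF E1])
  qed
  have Lper1: "L z e (w + period 1) = L z e w" if ze: "(z, e) \<in> log_cover 0 ?V" and w: "w \<in> ?V" for z e w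
    using comp[OF ze w Vper[OF w]] mono[OF LE[OF ze w]] by simp
  have Lper: "L z e (w + period j) = L z e w" if ze: "(z, e) \<in> log_cover 0 ?V" and w: "w \<in> ?V" for z e w j
    using period_invariant[of "\<lambda>v. L z e v = L z e w" w j] Lper1[OF ze Vper[OF w]] by simp
  have Llog: "L z e w = L z e w'" if ze: "(z, e) \<in> log_cover 0 ?V" "w \<in> ?V" "w' \<in> ?V" "exp w = exp w'" for z e w w'
  proof -
    obtain j where "w = w' + period j" using exp_eq_period[OF ze(4)] by blast
    then show ?thesis using Lper[OF ze(1,3)] by simp
  qed
  have LnV: "Ln c \<in> ?V" if "c \<in> ball 0 \<delta>" "c \<noteq> 0" for c
    unfolding half_plane_iff[OF \<delta>(1)] using that by (simp add: dist_norm)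
  \<comment> \<open>A section over the fibre of \<open>c = exp \<zeta>\<close> is spread in the direction of the base by transport along
    any logarithm of \<open>f\<close>; the choice of the logarithm does not matter.\<close>
  let ?Z = "f -` {0}"
  have loc: "\<exists>\<rho>>0. ball p \<rho> \<subseteq> UNIV \<and> (\<forall>y\<in>ball p \<rho> - ?Z. \<forall>e\<in>E. F e = y \<longrightarrow>
       (\<exists>s. continuous_on (ball p \<rho> - ?Z) s \<and> s \<in> (ball p \<rho> - ?Z) \<rightarrow> E \<and>
            (\<forall>w\<in>ball p \<rho> - ?Z. F (s w) = w) \<and> s y = e))" if p: "p \<in> UNIV \<inter> ?Z" for p
  proof -
    define c where "c = exp \<zeta>"
    have cW: "c \<in> W" "c \<noteq> 0" using V(3)[OF e0(2)] by (auto simp: c_def)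
    have fp: "f p = 0" using p by simp
    have \<xi>p: "\<xi> p \<in> Fib" using h(3)[of p] fp W(1) by simp
    have "k (c, \<xi> p) \<in> - (f -` {0})" using h(5)[OF cW(1) \<xi>p] cW(2) by simp
    then obtain T \<U> where T: "k (c, \<xi> p) \<in> T" "openin (top_of_set (- (f -` {0}))) T" "\<Union>\<U> = E \<inter> F -` T"
      and \<U>: "\<And>u. u \<in> \<U> \<Longrightarrow> openin (top_of_set E) u" "\<And>u. u \<in> \<U> \<Longrightarrow> \<exists>g. homeomorphism u T F g"
      using covering_space_sheet[OF cov] by metis
    have oT: "open T" using T(2) open_base openin_open_eq by blast
    have c\<xi>: "continuous_on (f -` ball 0 \<delta>) (\<lambda>y. k (c, \<xi> y))"
      by (intro continuous_on_compose2[OF h(2)] continuous_intros continuous_on_subset[OF h(1)])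
        (use \<delta>(2) cW(1) h(3) in auto)
    have "open (f -` ball 0 \<delta> \<inter> (\<lambda>y. k (c, \<xi> y)) -` T)"
      by (rule continuous_open_preimage[OF c\<xi> open_preimage[OF open_ball] oT])
    moreover have "p \<in> f -` ball 0 \<delta> \<inter> (\<lambda>y. k (c, \<xi> y)) -` T" using T(1) fp \<delta>(1) by simp
    ultimately obtain \<rho> where \<rho>: "\<rho> > 0" "ball p \<rho> \<subseteq> f -` ball 0 \<delta> \<inter> (\<lambda>y. k (c, \<xi> y)) -` T"
      using open_contains_ball by blast
    let ?D = "ball p \<rho> - ?Z"
    have D: "f y \<in> ball 0 \<delta>" "f y \<noteq> 0" "f y \<in> W" "k (c, \<xi> y) \<in> T" "\<xi> y \<in> Fib" "Ln (f y) \<in> ?V" if "y \<in> ?D" for y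
    proof -
      have "y \<in> f -` ball 0 \<delta> \<inter> (\<lambda>y. k (c, \<xi> y)) -` T" using that \<rho>(2) by blast
      then show 1: "f y \<in> ball 0 \<delta>" and "k (c, \<xi> y) \<in> T" by auto
      show 2: "f y \<noteq> 0" using that by simp
      show "f y \<in> W" using 1 \<delta>(2) by blast
      then show "\<xi> y \<in> Fib" by (rule h(3))
      show "Ln (f y) \<in> ?V" using LnV 1 2 by blast
    qed
    have "\<exists>s. continuous_on ?D s \<and> s \<in> ?D \<rightarrow> E \<and> (\<forall>w\<in>?D. F (s w) = w) \<and> s y = e"
      if y: "y \<in> ?D" and e: "e \<in> E" "F e = y" for y e
    proof -
      have ye: "(Ln (f y), e) \<in> log_cover 0 ?V" using D[OF y] e by (simp add: log_cover_iff)
      define e' where "e' = L (Ln (f y)) e \<zeta>"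
      have e': "(\<zeta>, e') \<in> log_cover 0 ?V" unfolding e'_def by (rule LE[OF ye e0(2)])
      have Fe': "F e' = k (c, \<xi> y)" unfolding e'_def using LF[OF ye e0(2)] e(2) by (simp add: c_def)
      have "e' \<in> \<Union>\<U>" using T(3) Fe' D(4)[OF y] EtV(2)[OF e'] by simp
      then obtain u where u: "u \<in> \<U>" "e' \<in> u" by blast
      obtain \<sigma> where \<sigma>: "homeomorphism u T F \<sigma>" using \<U>(2)[OF u(1)] by blast
      have uE: "u \<subseteq> E" using openin_imp_subset[OF \<U>(1)[OF u(1)]] .
      define t where "t w = \<sigma> (k (c, \<xi> w))" for w
      have tE: "t w \<in> E" "F (t w) = k (c, \<xi> w)" if "w \<in> ?D" for w
        using D(4)[OF that] homeomorphism_image2[OF \<sigma>] homeomorphism_apply2[OF \<sigma>] uE by (auto simp: t_def)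
      have tEt: "(\<zeta>, t w) \<in> log_cover 0 ?V" if "w \<in> ?D" for w
        using tE[OF that] h(5)[OF cW(1) D(5)[OF that]] e0(2) by (simp add: log_cover_iff c_def)
      have ct: "continuous_on ?D t" unfolding t_def
        by (rule continuous_on_compose2[OF homeomorphism_cont2[OF \<sigma>] continuous_on_subset[OF c\<xi>]])
          (use D in auto)
      define s where "s w = L \<zeta> (t w) (Ln (f w))" for w
      have "continuous_on ?D s"
      proof (rule continuous_on_openin_Union)
        fix w0 assume w0: "w0 \<in> ?D"
        let ?N = "?D \<inter> (\<lambda>w. f w / f w0) -` {c. Re c > 0}"
        have "openin (top_of_set ?D) ?N"
          by (intro continuous_openin_preimage_gen continuous_intros cont_on open_halfspace_Re_gt) (use D(2)[OF w0] in simp)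
        moreover have "w0 \<in> ?N" using w0 D(2)[OF w0] by simp
        moreover have "continuous_on ?N s"
        proof -
          let ?l = "\<lambda>w. Ln (f w0) + Ln (f w / f w0)"
          have el: "exp (?l w) = f w" if "w \<in> ?N" for w
            using that D(2)[OF w0] D(2)[of w] by (simp add: exp_add)
          have lV: "?l w \<in> ?V" if "w \<in> ?N" for w
            unfolding half_plane_iff[OF \<delta>(1)] el[OF that] using D(1)[of w] that by (simp add: dist_norm)
          have cl: "continuous_on ?N ?l"
            by (intro continuous_intros cont_on) (use D(2)[OF w0] in \<open>auto simp: complex_nonpos_Reals_iff\<close>)
          have "continuous_on ?N (\<lambda>w. (\<lambda>(z, e, w). L z e w) (\<zeta>, t w, ?l w))"
            by (rule continuous_on_compose2[OF cL], intro continuous_intros cl continuous_on_subset[OF ct])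
              (use tEt lV in auto)
          then show ?thesis
          proof (rule continuous_on_eq)
            fix w assume w: "w \<in> ?N"
            then have wD: "w \<in> ?D" by blast
            have "L \<zeta> (t w) (?l w) = L \<zeta> (t w) (Ln (f w))"
              by (rule Llog[OF tEt[OF wD] lV[OF w] D(6)[OF wD]]) (use el[OF w] D(2)[OF wD] in simp)
            then show "(\<lambda>(z, e, w). L z e w) (\<zeta>, t w, ?l w) = s w" by (simp add: s_def)
          qed
        qed
        ultimately show "\<exists>U. openin (top_of_set ?D) U \<and> w0 \<in> U \<and> continuous_on U s" by blast
      qed
      moreover have "s \<in> ?D \<rightarrow> E" using LE[OF tEt D(6)] by (auto simp: s_def log_cover_iff)
      moreover have "F (s w) = w" if w: "w \<in> ?D" for w
      proof -
        have "F (s w) = k (exp (Ln (f w)), \<xi> (F (t w)))" unfolding s_def using LF[OF tEt[OF w] D(6)[OF w]] by simp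
        also have "\<dots> = k (f w, \<xi> w)" using D(2)[OF w] tE(2)[OF w] \<xi>k[OF cW(1) D(5)[OF w]] by simp
        also have "\<dots> = w" by (rule h(4)[OF D(3)[OF w]])
        finally show ?thesis .
      qed
      moreover have "s y = e"
      proof -
        have "t y = e'" using homeomorphism_apply1[OF \<sigma> u(2)] Fe' by (simp add: t_def)
        then show ?thesis unfolding s_def e'_def using comp[OF ye e0(2) D(6)[OF y]] L0[OF ye] by simp
      qed
      ultimately show ?thesis by blast
    qed
    then show ?thesis using \<rho>(1) by blast
  qed
  have e0E: "e0 \<in> E" using EtV(2)[OF e0(1)] .
  have "\<exists>s. continuous_on (UNIV - ?Z) s \<and> s \<in> UNIV - ?Z \<rightarrow> E \<and> (\<forall>w\<in>UNIV - ?Z. F (s w) = w) \<and> s (F e0) = e0"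
  proof (rule lift_across_thin_set[OF cov])
    show "connected (U - ?Z) \<and> U - ?Z \<noteq> {}" if "convex U" "open U" "U \<noteq> {}" for U
      using thin[of "{0}" U] that by simp
    show "F e0 \<in> UNIV - ?Z" using fF_nonzero[OF e0E] by simp
  qed (use loc e0E in auto)
  then obtain s where s: "continuous_on (UNIV - ?Z) s" "s \<in> UNIV - ?Z \<rightarrow> E" "\<And>w. f w \<noteq> 0 \<Longrightarrow> F (s w) = w" "s (F e0) = e0"
    by auto
  have FZ: "F e \<in> UNIV - ?Z" if "e \<in> E" for e using fF_nonzero[OF that] by simp
  have "s (F e) = e" if e: "e \<in> E" for e
  proof (rule covering_space_lifts_agree[OF cov connE, of "\<lambda>e. s (F e)" "\<lambda>e. e" e0])
    show "continuous_on E (\<lambda>e. s (F e))" by (rule continuous_on_compose2[OF s(1) contF]) (use FZ in blast)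
    show "(\<lambda>e. s (F e)) \<in> E \<rightarrow> E" using FZ s(2) by blast
  qed (use s fF_nonzero e e0E in auto)
  then show ?thesis by (metis inj_on_inverseI)
qed

section \<open>Coverings with simply connected total space\<close>

text \<open>
  Going around a meridian again and again in a finite fibre, the lift returns to a point that
  it has visited before.  This gives a loop in \<open>E\<close> which is mapped by \<open>f \<circ> F\<close> to a loop around \<open>0\<close>
  with nonzero winding number, although it is null-homotopic.
\<close>

lemma infinite_sheets_of_simply_connected:
  assumes sc: "simply_connected E" and q: "f q = 0"
    and fin: "\<And>y. f y \<noteq> 0 \<Longrightarrow> finite (E \<inter> F -` {y})"
  shows False
proof -
  obtain W Fib \<xi> k where W: "0 \<in> W" and chart: "product_chart W Fib \<xi> k"
    using product_chart_exists[OF zero_notin_B] by metis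
  note h = product_chartD(3,4,6)[OF chart]
  obtain \<delta> where \<delta>: "\<delta> > 0" "ball 0 \<delta> \<subseteq> W" using W product_chartD(1)[OF chart] open_contains_ball by blast
  define \<theta> where "\<theta> t = complex_of_real (ln (\<delta> / 2)) + \<i> * complex_of_real t" for t
  have \<theta>W: "exp (\<theta> t) \<in> W" for t
  proof -
    have "norm (exp (\<theta> t)) = \<delta> / 2" using \<delta>(1) by (simp add: \<theta>_def)
    then show ?thesis using \<delta> by (auto simp: subset_iff)
  qed
  have xF: "\<xi> q \<in> Fib" using h(2)[of q] q W by simp
  define \<Phi> where "\<Phi> t = k (exp (\<theta> t), \<xi> q)" for t
  have f\<Phi>: "f (\<Phi> t) = exp (\<theta> t)" for t unfolding \<Phi>_def by (rule h(3)[OF \<theta>W xF])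
  have c\<Phi>: "continuous_on UNIV \<Phi>" unfolding \<Phi>_def \<theta>_def
    by (intro continuous_on_compose2[OF h(1)] continuous_intros) (use \<theta>W xF in \<open>auto simp: \<theta>_def\<close>)
  have "\<Phi> 0 \<in> - (f -` {0})" using f\<Phi>[of 0] by simp
  then obtain e0 where e0: "e0 \<in> E" "F e0 = \<Phi> 0"
    using covering_space_imp_surjective[OF cov] by (metis imageE)
  have "\<exists>s. continuous_on (UNIV - {}) s \<and> s \<in> UNIV - {} \<rightarrow> E \<and> (\<forall>w\<in>UNIV - {}. F (s w) = \<Phi> w) \<and> s 0 = e0"
    by (rule lift_across_thin_set[OF cov]) (use e0 c\<Phi> f\<Phi> in \<open>auto simp: convex_connected\<close>)
  then obtain s where s: "continuous_on UNIV s" "\<And>t. s t \<in> E" "\<And>t. F (s t) = \<Phi> t" by auto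
  define \<sigma> where "\<sigma> n = s (2 * pi * real n)" for n
  have "exp (\<theta> (2 * pi * real n)) = exp (\<theta> 0)" for n
    using exp_add_period[of "\<theta> 0" "int n"] by (simp add: \<theta>_def period_def algebra_simps)
  then have "\<sigma> ` UNIV \<subseteq> E \<inter> F -` {\<Phi> 0}" using s by (auto simp: \<sigma>_def \<Phi>_def)
  moreover have "f (\<Phi> 0) \<noteq> 0" using f\<Phi> by simp
  ultimately have "finite (\<sigma> ` UNIV)" using fin finite_subset by blast
  then have "\<not> inj \<sigma>" using finite_imageD infinite_UNIV_nat by blast
  then obtain m n where mn: "\<sigma> m = \<sigma> n" "m \<noteq> n" unfolding inj_def by blast
  define \<gamma> where "\<gamma> t = s (2 * pi * real m + t * (2 * pi * (real n - real m)))" for t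
  have c\<gamma>: "continuous_on A \<gamma>" for A unfolding \<gamma>_def
    by (intro continuous_on_compose2[OF s(1)] continuous_intros) auto
  have \<gamma>ends: "\<gamma> 0 = \<sigma> m" "\<gamma> 1 = \<sigma> n" by (simp_all add: \<gamma>_def \<sigma>_def algebra_simps)
  have hom: "homotopic_loops E \<gamma> (\<lambda>_. \<sigma> m)"
  proof -
    have "path \<gamma>" "path_image \<gamma> \<subseteq> E" "pathfinish \<gamma> = pathstart \<gamma>"
      using c\<gamma> s(2) \<gamma>ends mn by (auto simp: path_def path_image_def pathstart_def pathfinish_def \<gamma>_def)
    moreover have "path (\<lambda>_. \<sigma> m)" "path_image (\<lambda>_. \<sigma> m) \<subseteq> E" "pathfinish (\<lambda>_. \<sigma> m) = pathstart (\<lambda>_. \<sigma> m)"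
      using s(2) by (auto simp: path_def path_image_def pathstart_def pathfinish_def \<sigma>_def)
    ultimately show ?thesis using sc unfolding simply_connected_def by blast
  qed
  let ?h = "\<lambda>e. f (F e)"
  have "homotopic_loops (- {0}) (?h \<circ> \<gamma>) (?h \<circ> (\<lambda>_. \<sigma> m))"
    by (rule homotopic_loops_continuous_image[OF hom cont_fF]) (use fF_nonzero in auto)
  moreover have "?h \<circ> (\<lambda>_. \<sigma> m) = linepath (?h (\<sigma> m)) (?h (\<sigma> m))"
    by (simp add: linepath_def fun_eq_iff scaleR_left_distrib[symmetric])
  ultimately have "homotopic_loops (- {0}) (?h \<circ> \<gamma>) (linepath (?h (\<sigma> m)) (?h (\<sigma> m)))" by simp
  then have hp: "homotopic_paths (- {0}) (?h \<circ> \<gamma>) (linepath (pathstart (?h \<circ> \<gamma>)) (pathstart (?h \<circ> \<gamma>)))"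
    by (rule homotopic_loops_imp_homotopic_paths_null)
  define c where "c = pathstart (?h \<circ> \<gamma>)"
  \<comment> \<open>A logarithm of the image loop, whose end points differ by a nonzero multiple of \<open>2 * pi * \<i>\<close>.\<close>
  define l where "l t = \<theta> (2 * pi * real m + t * (2 * pi * (real n - real m)))" for t
  have hl: "exp (l t) = (?h \<circ> \<gamma>) t" for t using s(3) f\<Phi> by (simp add: l_def \<gamma>_def)
  have "pathfinish l = pathfinish (linepath (l 0) (l 0))"
  proof (rule covering_space_monodromy[OF covering_space_exp_punctured_plane])
    show "homotopic_paths (- {0}) (?h \<circ> \<gamma>) (linepath c c)" using hp by (simp add: c_def)
    then show "path (?h \<circ> \<gamma>)" "path_image (?h \<circ> \<gamma>) \<subseteq> - {0}" "path (linepath c c)" "path_image (linepath c c) \<subseteq> - {0}"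
      using homotopic_paths_imp_path homotopic_paths_imp_subset by blast+
    show "path l" unfolding path_def l_def \<theta>_def by (intro continuous_intros)
    show "exp (l t) = (?h \<circ> \<gamma>) t" for t by (rule hl)
    show "exp (linepath (l 0) (l 0) t) = linepath c c t" for t
      using hl[of 0] by (simp add: c_def pathstart_def linepath_refl)
    show "pathstart l = pathstart (linepath (l 0) (l 0))" by (simp add: pathstart_def linepath_refl)
  qed auto
  then have "l 1 = l 0" by (simp add: pathfinish_def linepath_refl)
  then show False using mn(2) by (simp add: l_def \<theta>_def algebra_simps)
qed

end

section \<open>Hypersurfaces and the number of sheets\<close>

lemma poly_eval_on_line:
  fixes g :: "'n::finite cpoly"
  shows "\<exists>p. \<forall>s. poly_eval g (y + s *s v) = poly p s"
proof -
  define P where "P = (\<Sum>m\<in>Poly_Mapping.keys g. [:Poly_Mapping.lookup g m:] *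
     (\<Prod>i\<in>UNIV. [:y $ i, v $ i:] ^ Poly_Mapping.lookup m i))"
  have "poly_eval g (y + s *s v) = poly P s" for s
    by (simp add: P_def poly_eval_def poly_sum poly_prod mult.commute)
  then show ?thesis by blast
qed

lemma minimal_polynomial_exists:
  assumes "hypersurface D"
  obtains f where "minimal_polynomial f D"
proof -
  from assms obtain g where "zero_set g = D" unfolding hypersurface_def by blast
  then have "\<exists>f. zero_set f = D \<and> (\<forall>g. zero_set g = D \<longrightarrow> total_degree f \<le> total_degree g)"
    using ex_has_least_nat[of "\<lambda>f. zero_set f = D" g total_degree] by blast
  then show ?thesis using that unfolding minimal_polynomial_def by blast
qed

text \<open>
  If \<open>D\<close> were the whole space, its minimal polynomial would vanish identically and all
  partial derivatives with it.
\<close>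

lemma smooth_hypersurface_proper:
  assumes "smooth_hypersurface D"
  shows "D \<noteq> UNIV"
proof
  assume D: "D = UNIV"
  obtain f where f: "minimal_polynomial f D"
    using assms minimal_polynomial_exists unfolding smooth_hypersurface_def by blast
  then have "poly_eval f z = 0" for z using D unfolding minimal_polynomial_def zero_set_def by auto
  then have "partial_deriv i f z = 0" for i z by (simp add: partial_deriv_def)
  then show False using assms f D unfolding smooth_hypersurface_def by blast
qed

lemma affine_fibration_of_minimal_polynomial:
  assumes f: "minimal_polynomial f D" and D: "smooth_hypersurface D" "connected D" "non_bifurcated D" "D \<noteq> {}"
  obtains B where "affine_fibration (poly_eval f) B"
proof -
  have DZ: "D = poly_eval f -` {0}" using f by (auto simp: minimal_polynomial_def zero_set_def)
  have "0 \<notin> bifurcation_locus f" using D(3) f by (simp add: non_bifurcated_def)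
  then obtain B where B: "fibration_away_from f B" "0 \<notin> B" by (auto simp: bifurcation_locus_def)
  have fB: "finite B" using B(1) by (simp add: fibration_away_from_def)
  have oB: "open (-B)" using fB by (simp add: finite_imp_closed open_Compl)
  have "affine_fibration (poly_eval f) B"
  proof
    show "continuous_on UNIV (poly_eval f)" by (rule continuous_on_poly_eval)
    show "\<exists>p. \<forall>s. poly_eval f (y + s *s v) = poly p s" for y v by (rule poly_eval_on_line)
    show "\<exists>y z. poly_eval f y \<noteq> poly_eval f z"
      using D(4) smooth_hypersurface_proper[OF D(1)] unfolding DZ by (metis UNIV_eq_I ex_in_conv vimage_singleton_eq)
    show "finite B" "0 \<notin> B" by fact+
    show "connected (poly_eval f -` {0})" using D(2) DZ by simp
    fix c assume c: "c \<notin> B"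
    obtain W and Fib :: "(complex ^ 'a) set" and h k where W: "c \<in> W" "openin (top_of_set (- B)) W"
      "homeomorphism (- (poly_eval f -` B) \<inter> poly_eval f -` W) (W \<times> Fib) h k"
      "\<forall>x \<in> - (poly_eval f -` B) \<inter> poly_eval f -` W. fst (h x) = poly_eval f x"
      using B(1) c unfolding fibration_away_from_def locally_trivial_fibration_def by blast
    have oW: "open W" using W(2) oB openin_open_eq by blast
    have "W \<subseteq> - B" using W(2) openin_imp_subset by blast
    then have eq: "- (poly_eval f -` B) \<inter> poly_eval f -` W = poly_eval f -` W" by blast
    show "\<exists>W (Fib :: (complex ^ 'a) set) h k. c \<in> W \<and> open W \<and>
        homeomorphism (poly_eval f -` W) (W \<times> Fib) h k \<and> (\<forall>x\<in>poly_eval f -` W. fst (h x) = poly_eval f x)"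
      using W(1,3,4) oW unfolding eq by blast
  qed
  then show ?thesis by (rule that)
qed

lemma sheeted_covering_injective:
  assumes cov: "sheeted_covering d E p S" and inj: "inj_on p E" and S: "S \<noteq> {}"
  shows "d = 1"
proof -
  obtain y where y: "y \<in> S" using S by blast
  then obtain e where e: "e \<in> E" "p e = y"
    using cov covering_space_imp_surjective unfolding sheeted_covering_def by (metis imageE)
  then have "E \<inter> p -` {y} = {e}" using inj by (auto dest: inj_onD)
  moreover have "ecard (E \<inter> p -` {y}) = d" using cov y unfolding sheeted_covering_def by blast
  ultimately show ?thesis by (simp add: ecard_def one_enat_def)
qed

theorem theorem1p1:
  fixes D :: "(complex ^ 'n::finite) set"
    and X :: "'a::topological_space set"
    and \<A> :: "('a set \<times> ('a \<Rightarrow> 'e::euclidean_space)) set"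
    and F :: "'a \<Rightarrow> complex ^ 'n"
    and d :: enat
  assumes "CARD('n) > 1"
    and "smooth_hypersurface D"
    and "connected D"
    and "non_bifurcated D"
    and "smooth_manifold X \<A>"
    and "simply_connected X"
    and "local_diffeomorphism X \<A> F"
    and "d > 0"
    and "covering_away_from d X F D"
  shows "d = 1 \<or> d = \<infinity>"
proof -
  let ?E = "X - F -` D"
  have sheets: "sheeted_covering d ?E F (- D)" using assms(9) by (simp add: covering_away_from_def)
  then have cov: "covering_space ?E F (- D)" by (simp add: sheeted_covering_def)
  have connX: "connected X" by (rule simply_connected_connected[OF assms(6)])
  have proper: "- D \<noteq> {}" using smooth_hypersurface_proper[OF assms(2)] by blast
  show ?thesis
  proof (cases "D = {}")
    case True
    then have "inj_on F ?E" using covering_of_normed_space_injective[of X F] cov connX by simp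
    then show ?thesis using sheeted_covering_injective[OF sheets _ proper] by blast
  next
    case False
    obtain f where f: "minimal_polynomial f D"
      using assms(2) minimal_polynomial_exists unfolding smooth_hypersurface_def by blast
    have DZ: "D = poly_eval f -` {0}" using f by (auto simp: minimal_polynomial_def zero_set_def)
    obtain B where "affine_fibration (poly_eval f) B"
      using affine_fibration_of_minimal_polynomial[OF f assms(2-4) False] by blast
    then interpret affine_fibration "poly_eval f" B .
    interpret covered_fibration "poly_eval f" B ?E F
      by unfold_locales (use cov DZ in simp)
    have loc: "\<exists>U G. p \<in> U \<and> openin (top_of_set X) U \<and> open (F ` U) \<and> homeomorphism U (F ` U) F G"
      if "p \<in> X" for p
      using assms(7) that unfolding local_diffeomorphism_def by blast
    show ?thesis
    proof (cases "X \<inter> F -` D = {}")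
      case True
      then have EX: "?E = X" by blast
      show ?thesis
      proof (rule ccontr)
        assume "\<not> ?thesis"
        then have "d \<noteq> \<infinity>" by blast
        have "finite (?E \<inter> F -` {y})" if "poly_eval f y \<noteq> 0" for y
        proof -
          have "ecard (?E \<inter> F -` {y}) = d" using sheets that DZ by (simp add: sheeted_covering_def)
          then show ?thesis using \<open>d \<noteq> \<infinity>\<close> by (auto simp: ecard_def split: if_splits)
        qed
        moreover obtain q where "poly_eval f q = 0" using surjective by blast
        ultimately show False using infinite_sheets_of_simply_connected assms(6) EX by metis
      qed
    next
      case False
      then obtain p where p: "p \<in> X" "F p \<in> D" by blast
      obtain U G where U: "p \<in> U" "openin (top_of_set X) U" "open (F ` U)" "homeomorphism U (F ` U) F G"
        using loc[OF p(1)] by blast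
      have UX: "U \<subseteq> X" using openin_imp_subset[OF U(2)] .
      have thinD: "connected (ball q r - D) \<and> ball q r - D \<noteq> {}" if "r > 0" for q r
        using thin[of "{0}" "ball q r"] that DZ by simp
      have "closed D" unfolding DZ by (rule closed_vimage[OF closed_singleton continuous_on_poly_eval])
      then have connE: "connected ?E"
        using connected_minus_thin_preimage[OF connX _ loc thinD] by blast
      have "inj_on F ?E"
      proof (rule injective_of_local_section[OF connE])
        show "poly_eval f (F p) = 0" using p(2) DZ by simp
        show "open (F ` U)" "F p \<in> F ` U" using U(1,3) by auto
        show "continuous_on (F ` U - poly_eval f -` {0}) G"
          by (rule continuous_on_subset[OF homeomorphism_cont2[OF U(4)]]) blast
        show FG: "F (G y) = y" if "y \<in> F ` U - poly_eval f -` {0}" for y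
          using homeomorphism_apply2[OF U(4)] that by blast
        show "G y \<in> ?E" if y: "y \<in> F ` U - poly_eval f -` {0}" for y
          using FG[OF y] y homeomorphism_image2[OF U(4)] UX DZ by auto
      qed
      then show ?thesis using sheeted_covering_injective[OF sheets _ proper] by blast
    qed
  qed
qed

end
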